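(* Let $s:\mathbb{R}\to\mathbb{R}^3$ be a sufficiently smooth regular curve, let $u,\varepsilon\in\mathbb{R}$ with $\kappa(u)\neq0$, and let $\gamma:\mathbb{Z}\to\mathbb{R}^3$, $\gamma_k=\gamma(k)=s(u+(2k-1)\varepsilon)$, be a sampling of $s$. Let $\tau$ be the torsion of $s$ at $u$ and $\tau_0$ the discrete torsion of $\gamma$ at the edge $\gamma_0\gamma_1$. Then, as $\varepsilon\to0$ (with $\varepsilon\neq 0$), $$\tau_0=\tau+O(\varepsilon^2).$$
   Context: Regular means $s'\neq0$ everywhere; sufficiently smooth means of class $C^k$ with $k$ large enough. Smooth curvature and torsion: $\kappa=\frac{\|s'\times s''\|}{\|s'\|^3}$, $\tau=-\frac{\langle s'\times s'',s'''\rangle}{\|s'\times s''\|^2}$ (note the sign convention). Quaternions are written $[r,v]$ with $r\in\mathbb{R}$, $v\in\mathbb{R}^3$, $\mathrm{Re}[r,v]=r$, $\mathrm{Im}[r,v]=v$, with product $[r,v][s,w]=[rs-\langle v,w\rangle,\,rw+sv+v\times w]$, and $\mathbb{R}^3$ is identified with $\mathrm{Im}\,\mathbb{H}$ via $v\leftrightarrow[0,v]$. For $q=|q|[\cos\phi,v\sin\phi]$ with $\|v\|=1$, $\phi\in[0,\pi]$, set $\sqrt q=\sqrt{|q|}\,[\cos\frac\phi2,v\sin\frac\phi2]$ (well defined unless $q$ is a negative real). The cross-ratio is $\mathrm{cr}(a,b,c,d)=(a-b)(b-c)^{-1}(c-d)(d-a)^{-1}$. For pairwise distinct $a,b,c,d\in\mathrm{Im}\,\mathbb{H}$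 with $\mathrm{cr}(c,a,b,d)\notin\mathbb{R}_{<0}$ set $$f(a,b,c,d)=\big((b-a)(c-a)^{-1}\sqrt{\mathrm{cr}(c,a,b,d)}+1\big)^{-1}\big((b-a)(c-a)^{-1}\sqrt{\mathrm{cr}(c,a,b,d)}\,c+b\big)\in\mathbb{R}^3\cup\{\infty\}.$$ For a discrete curve $\gamma:\mathbb{Z}\to\mathbb{R}^3$ and $(a,b,c,d)=(\gamma_{i-1},\gamma_i,\gamma_{i+1},\gamma_{i+2})$ put $p_{ab}=f(d,a,b,c)$, $p_{bc}=f(a,b,c,d)$, $p_{cd}=f(b,c,d,a)$, $p_{da}=f(c,d,a,b)$ (cross-ratios involved assumed not negative real). These four points lie on a common circle $k_i$, the discrete curvature circle at the edge $\gamma_i\gamma_{i+1}$, with center $m_i$; the discrete curvature $\kappa_i$ is the inverse of its radius. The discrete unit normal $N_i$ is the unit normal of $k_i$ at $p_{bc}$ in the plane of $k_i$, oriented towards the center: $N_i=(m_i-p_{bc})/\|m_i-p_{bc}\|$. The discrete torsion at the edge $\gamma_i\gamma_{i+1}$ is $$\tau_i:=-\frac{9\,\langle\mathrm{Im}\,\mathrm{cr}(\gamma_{i-1},\gamma_i,\gamma_{i+1},\gamma_{i+2}),N_i\rangle}{2\,\kappa_i\,\|\gamma_i-\gamma_{i+1}\|^2}.$$ *)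

theory Defs
  imports "HOL-Analysis.Analysis" "HOL-Library.Landau_Symbols"
begin

unbundle cross3_syntax

section \<open>Smooth space curves\<close>

definition nth_vderiv :: "nat \<Rightarrow> (real \<Rightarrow> real^3) \<Rightarrow> real \<Rightarrow> real^3" where
  "nth_vderiv n s = ((\<lambda>g t. vector_derivative g (at t)) ^^ n) s"

definition C_class :: "nat \<Rightarrow> (real \<Rightarrow> real^3) \<Rightarrow> bool" where
  "C_class k s \<longleftrightarrow>
     (\<forall>j<k. \<forall>t. nth_vderiv j s differentiable (at t)) \<and> continuous_on UNIV (nth_vderiv k s)"

definition regular_curve :: "(real \<Rightarrow> real^3) \<Rightarrow> bool" where
  "regular_curve s \<longleftrightarrow> (\<forall>t. nth_vderiv 1 s t \<noteq> 0)"

definition smooth_curvature :: "(real \<Rightarrow> real^3) \<Rightarrow> real \<Rightarrow> real" where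
  "smooth_curvature s t =
     norm (nth_vderiv 1 s t \<times> nth_vderiv 2 s t) / norm (nth_vderiv 1 s t) ^ 3"

text \<open>The torsion carries a minus sign: it is the negative of the more common convention.\<close>

definition smooth_torsion :: "(real \<Rightarrow> real^3) \<Rightarrow> real \<Rightarrow> real" where
  "smooth_torsion s t =
     - (((nth_vderiv 1 s t \<times> nth_vderiv 2 s t) \<bullet> nth_vderiv 3 s t)
        / (norm (nth_vderiv 1 s t \<times> nth_vderiv 2 s t))\<^sup>2)"


section \<open>Quaternions\<close>

datatype quat = Quat (qRe: real) (qIm: "real^3")

lemma quat_eq_iff: "p = q \<longleftrightarrow> qRe p = qRe q \<and> qIm p = qIm q"
  by (cases p; cases q) simp

instantiation quat :: real_div_algebra
begin

definition "0 = Quat 0 0"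
definition "1 = Quat 1 0"
definition "p + q = Quat (qRe p + qRe q) (qIm p + qIm q)"
definition "p - q = Quat (qRe p - qRe q) (qIm p - qIm q)"
definition "- p = Quat (- qRe p) (- qIm p)"
definition "p * q =
  Quat (qRe p * qRe q - qIm p \<bullet> qIm q)
       (qRe p *\<^sub>R qIm q + qRe q *\<^sub>R qIm p + qIm p \<times> qIm q)"
definition "r *\<^sub>R p = Quat (r * qRe p) (r *\<^sub>R qIm p)"
definition "inverse p =
  Quat (qRe p / ((qRe p)\<^sup>2 + (norm (qIm p))\<^sup>2))
       (- (1 / ((qRe p)\<^sup>2 + (norm (qIm p))\<^sup>2)) *\<^sub>R qIm p)"
definition "p div q = p * inverse (q :: quat)"
lemmas quat_ops =
  zero_quat_def one_quat_def plus_quat_def minus_quat_def uminus_quat_def times_quat_def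
  scaleR_quat_def

instance
proof
  fix p q r :: quat and a b :: real
  show "p + q + r = p + (q + r)" "p + q = q + p" "0 + p = p" "- p + p = 0" "p - q = p + - q"
    by (simp_all add: quat_ops quat_eq_iff)
  show "a *\<^sub>R (p + q) = a *\<^sub>R p + a *\<^sub>R q" "(a + b) *\<^sub>R p = a *\<^sub>R p + b *\<^sub>R p"
    "a *\<^sub>R b *\<^sub>R p = (a * b) *\<^sub>R p" "1 *\<^sub>R p = p"
    by (simp_all add: quat_ops quat_eq_iff algebra_simps)
  show "p * q * r = p * (q * r)"
    by (simp add: quat_ops quat_eq_iff cross3_def vec_eq_iff forall_3 inner_vec_def sum_3
          algebra_simps)
  show "(p + q) * r = p * r + q * r" "p * (q + r) = p * q + p * r" "1 * p = p" "p * 1 = p"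
    "a *\<^sub>R p * q = a *\<^sub>R (p * q)" "p * a *\<^sub>R q = a *\<^sub>R (p * q)"
    by (simp_all add: quat_ops quat_eq_iff algebra_simps cross_mult_left cross_mult_right
          cross_add_left cross_add_right)
  show "(0::quat) \<noteq> 1" by (simp add: quat_ops)
  have nz: "(qRe p)\<^sup>2 + (norm (qIm p))\<^sup>2 \<noteq> 0" if "p \<noteq> 0" for p :: quat
    using that by (auto simp: quat_ops quat_eq_iff sum_power2_eq_zero_iff)
  have sq: "v \<bullet> v = (norm v)\<^sup>2" for v :: "real^3" by (simp add: power2_norm_eq_inner)
  show "inverse p * p = 1" if "p \<noteq> 0"
    using nz[OF that]
    by (auto simp: quat_ops inverse_quat_def quat_eq_iff sq cross_mult_left cross_mult_right
          simp flip: add_divide_distrib power2_eq_square)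
  show "p * inverse p = 1" if "p \<noteq> 0"
    using nz[OF that]
    by (auto simp: quat_ops inverse_quat_def quat_eq_iff sq cross_mult_left cross_mult_right
          simp flip: add_divide_distrib power2_eq_square)
  show "p div q = p * inverse q" by (rule divide_quat_def)
  show "inverse (0::quat) = 0" by (simp add: inverse_quat_def quat_ops)
qed

end

instantiation quat :: real_normed_div_algebra
begin

definition "norm p = sqrt ((qRe p)\<^sup>2 + (norm (qIm p))\<^sup>2)"
definition "sgn p = p /\<^sub>R norm (p :: quat)"
definition "dist p q = norm (p - q :: quat)"
definition [code del]:
  "(uniformity :: (quat \<times> quat) filter) = (INF e\<in>{0 <..}. principal {(x, y). dist x y < e})"
definition [code del]:
  "open (U :: quat set) \<longleftrightarrow> (\<forall>x\<in>U. eventually (\<lambda>(x', y). x' = x \<longrightarrow> y \<in> U) uniformity)"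

instance
proof
  fix p q :: quat and a :: real
  show "(norm p = 0) = (p = 0)"
    by (simp add: norm_quat_def quat_ops quat_eq_iff)
  have nn: "norm q = norm (qRe q, qIm q)" for q :: quat
    by (simp add: norm_quat_def norm_prod_def)
  show "norm (p + q) \<le> norm p + norm q"
    using norm_triangle_ineq[of "(qRe p, qIm p)" "(qRe q, qIm q)"] by (simp add: nn quat_ops)
  show "norm (a *\<^sub>R p) = \<bar>a\<bar> * norm p"
    using norm_scaleR[of a "(qRe p, qIm p)"] by (simp add: nn quat_ops)
  show "norm (p * q) = norm p * norm q"
    unfolding norm_quat_def real_sqrt_mult[symmetric]
    by (rule arg_cong[where f = sqrt])
       (unfold power2_norm_eq_inner,
        simp add: quat_ops cross3_def inner_vec_def sum_3 power2_eq_square algebra_simps)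
qed (rule sgn_quat_def dist_quat_def open_quat_def uniformity_quat_def)+

end

text \<open>Identification of \<open>\<real>\<^sup>3\<close> with the imaginary quaternions.\<close>

definition im_quat :: "real^3 \<Rightarrow> quat" where
  "im_quat v = Quat 0 v"

definition neg_real_quat :: "quat \<Rightarrow> bool" where
  "neg_real_quat q \<longleftrightarrow> (\<exists>r<0. q = of_real r)"

text \<open>The description below has exactly one solution unless \<open>q\<close> is a negative real.\<close>

definition qsqrt :: "quat \<Rightarrow> quat" where
  "qsqrt q = (THE w. \<exists>\<phi> v. norm v = 1 \<and> \<phi> \<in> {0..pi} \<and>
      q = norm q *\<^sub>R Quat (cos \<phi>) (sin \<phi> *\<^sub>R v) \<and>
      w = sqrt (norm q) *\<^sub>R Quat (cos (\<phi> / 2)) (sin (\<phi> / 2) *\<^sub>R v))"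

definition cross_ratio :: "real^3 \<Rightarrow> real^3 \<Rightarrow> real^3 \<Rightarrow> real^3 \<Rightarrow> quat" where
  "cross_ratio a b c d =
     (im_quat a - im_quat b) * inverse (im_quat b - im_quat c) *
     (im_quat c - im_quat d) * inverse (im_quat d - im_quat a)"


section \<open>Discrete curvature circle, curvature and torsion\<close>

text \<open>
  Values in \<open>\<real>\<^sup>3 \<union> {\<infinity>}\<close> are modelled by \<open>option\<close>, with \<open>None\<close> for \<open>\<infinity>\<close>. The quotient is
  always purely imaginary on the domain \<open>f_point_dom\<close>, so that \<open>qIm\<close> merely undoes the
  identification \<open>im_quat\<close>. When the denominator vanishes, the numerator equals \<open>b - c \<noteq> 0\<close>.
\<close>

definition f_point_dom :: "real^3 \<Rightarrow> real^3 \<Rightarrow> real^3 \<Rightarrow> real^3 \<Rightarrow> bool" where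
  "f_point_dom a b c d \<longleftrightarrow> distinct [a, b, c, d] \<and> \<not> neg_real_quat (cross_ratio c a b d)"

definition f_point :: "real^3 \<Rightarrow> real^3 \<Rightarrow> real^3 \<Rightarrow> real^3 \<Rightarrow> (real^3) option" where
  "f_point a b c d =
     (let q = (im_quat b - im_quat a) * inverse (im_quat c - im_quat a) *
              qsqrt (cross_ratio c a b d)
      in if q + 1 = 0 then None
         else Some (qIm (inverse (q + 1) * (q * im_quat c + im_quat b))))"

definition p_ab :: "(int \<Rightarrow> real^3) \<Rightarrow> int \<Rightarrow> (real^3) option" where
  "p_ab \<gamma> i = f_point (\<gamma> (i + 2)) (\<gamma> (i - 1)) (\<gamma> i) (\<gamma> (i + 1))"

definition p_bc :: "(int \<Rightarrow> real^3) \<Rightarrow> int \<Rightarrow> (real^3) option" where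
  "p_bc \<gamma> i = f_point (\<gamma> (i - 1)) (\<gamma> i) (\<gamma> (i + 1)) (\<gamma> (i + 2))"

definition p_cd :: "(int \<Rightarrow> real^3) \<Rightarrow> int \<Rightarrow> (real^3) option" where
  "p_cd \<gamma> i = f_point (\<gamma> i) (\<gamma> (i + 1)) (\<gamma> (i + 2)) (\<gamma> (i - 1))"

definition p_da :: "(int \<Rightarrow> real^3) \<Rightarrow> int \<Rightarrow> (real^3) option" where
  "p_da \<gamma> i = f_point (\<gamma> (i + 1)) (\<gamma> (i + 2)) (\<gamma> (i - 1)) (\<gamma> i)"

definition is_circle :: "real^3 \<Rightarrow> real \<Rightarrow> (real^3) set \<Rightarrow> bool" where
  "is_circle m r K \<longleftrightarrow>
     r > 0 \<and> (\<exists>P. affine P \<and> aff_dim P = 2 \<and> m \<in> P \<and> K = sphere m r \<inter> P)"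

definition circle_center :: "(real^3) set \<Rightarrow> real^3" where
  "circle_center K = (THE m. \<exists>r. is_circle m r K)"

definition circle_radius :: "(real^3) set \<Rightarrow> real" where
  "circle_radius K = (THE r. \<exists>m. is_circle m r K)"

definition through_points :: "(int \<Rightarrow> real^3) \<Rightarrow> int \<Rightarrow> (real^3) set \<Rightarrow> bool" where
  "through_points \<gamma> i K \<longleftrightarrow>
     (\<exists>m r. is_circle m r K) \<and> {p_ab \<gamma> i, p_bc \<gamma> i, p_cd \<gamma> i, p_da \<gamma> i} \<subseteq> Some ` K"

definition curvature_circle :: "(int \<Rightarrow> real^3) \<Rightarrow> int \<Rightarrow> (real^3) set" where
  "curvature_circle \<gamma> i = (THE K. through_points \<gamma> i K)"

text \<open>
  All expressions entering the discrete torsion at the edge \<open>\<gamma>\<^sub>i \<gamma>\<^sub>i\<^sub>+\<^sub>1\<close> are meaningful, and the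
  curvature circle is a genuine circle with finite center and radius (not a line through \<open>\<infinity>\<close>).
\<close>

definition discrete_torsion_defined :: "(int \<Rightarrow> real^3) \<Rightarrow> int \<Rightarrow> bool" where
  "discrete_torsion_defined \<gamma> i \<longleftrightarrow>
     f_point_dom (\<gamma> (i + 2)) (\<gamma> (i - 1)) (\<gamma> i) (\<gamma> (i + 1)) \<and>
     f_point_dom (\<gamma> (i - 1)) (\<gamma> i) (\<gamma> (i + 1)) (\<gamma> (i + 2)) \<and>
     f_point_dom (\<gamma> i) (\<gamma> (i + 1)) (\<gamma> (i + 2)) (\<gamma> (i - 1)) \<and>
     f_point_dom (\<gamma> (i + 1)) (\<gamma> (i + 2)) (\<gamma> (i - 1)) (\<gamma> i) \<and>
     (\<exists>!K. through_points \<gamma> i K)"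

definition discrete_curvature :: "(int \<Rightarrow> real^3) \<Rightarrow> int \<Rightarrow> real" where
  "discrete_curvature \<gamma> i = 1 / circle_radius (curvature_circle \<gamma> i)"

definition discrete_normal :: "(int \<Rightarrow> real^3) \<Rightarrow> int \<Rightarrow> real^3" where
  "discrete_normal \<gamma> i =
     (let w = circle_center (curvature_circle \<gamma> i) - the (p_bc \<gamma> i) in w /\<^sub>R norm w)"

definition discrete_torsion :: "(int \<Rightarrow> real^3) \<Rightarrow> int \<Rightarrow> real" where
  "discrete_torsion \<gamma> i =
     - (9 * (qIm (cross_ratio (\<gamma> (i - 1)) (\<gamma> i) (\<gamma> (i + 1)) (\<gamma> (i + 2))) \<bullet> discrete_normal \<gamma> i)
        / (2 * discrete_curvature \<gamma> i * (norm (\<gamma> i - \<gamma> (i + 1)))\<^sup>2))"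

definition sampling :: "(real \<Rightarrow> real^3) \<Rightarrow> real \<Rightarrow> real \<Rightarrow> int \<Rightarrow> real^3" where
  "sampling s u \<epsilon> k = s (u + (2 * real_of_int k - 1) * \<epsilon>)"

end

theory Submission
  imports Defs
begin

text \<open>
  The torsion formula contains the discrete curvature circle only through the vector \<open>w\<close>
  from \<open>p\<^sub>b\<^sub>c\<close> to its centre. Indeed \<open>N\<^sub>0 / \<kappa>\<^sub>0 = w\<close>, since \<open>w\<close> has length \<open>1 / \<kappa>\<^sub>0\<close> and
  direction \<open>N\<^sub>0\<close>, so \<open>\<tau>\<^sub>0 = - 9 \<langle>Im cr, w\<rangle> / (2 |b - c|\<^sup>2)\<close>, where \<open>a, b, c, d\<close> are the four
  samples around the edge. Three things have to be shown: the circle exists, the formula has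
  an expansion \<open>\<tau>\<^sub>0 = \<tau> + \<beta> \<epsilon> + O(\<epsilon>\<^sup>2)\<close>, and \<open>\<beta> = 0\<close>.

  The circle exists because of Moebius geometry. Invert at \<open>c\<close> and write \<open>A, B, D\<close> for the
  images of \<open>a, b, d\<close>. The quaternionic geometric mean \<open>gmean x z = x (x\<^sup>-\<^sup>1 z)\<^sup>1\<^sup>/\<^sup>2\<close> of two
  vectors is again a vector, and with \<open>g = gmean (A - B) (D - B)\<close>, \<open>h = gmean (D - B) (D -
  A)\<close> the points \<open>p\<^sub>b\<^sub>c, p\<^sub>d\<^sub>a, p\<^sub>a\<^sub>b, p\<^sub>c\<^sub>d\<close> are the preimages of \<open>B - g\<close>, \<open>B + g\<close>, \<open>D - h\<close>, \<open>D +
  h\<close> (\<open>f_point_inversion_at_third\<close>, \<open>f_point_inversion_at_first\<close>). A second inversion, at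
  \<open>p\<^sub>b\<^sub>c\<close>, takes \<open>p\<^sub>d\<^sub>a\<close> to the midpoint of the images of \<open>p\<^sub>a\<^sub>b\<close> and \<open>p\<^sub>c\<^sub>d\<close>
  (\<open>harmonic_square_roots\<close>). So these three images lie on a line, the four points lie on a
  circle, and \<open>w\<close> is read off from the foot of the perpendicular from the origin to that
  line (\<open>circle_from_inverse_points\<close>).

  The expansion comes from the difference quotients \<open>Q = (c - b) / (2 \<epsilon>)\<close>, \<open>X = (c - 2 b +
  a) / (2 \<epsilon>\<^sup>2)\<close> and \<open>Z = (d - 3 c + 3 b - a) / (2 \<epsilon>\<^sup>3)\<close>, which by Taylor's formula have the
  form \<open>c\<^sub>0 + c\<^sub>1 \<epsilon> + O(\<epsilon>\<^sup>2)\<close>. Functions of this form are closed under products, inverses and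
  square roots. Two divisions by small quantities remain, and both are controlled by one
  cancellation: \<open>4 (A - B) - (D - B)\<close> is \<open>\<epsilon>\<close> times a bounded quantity although its terms
  have size \<open>1 / \<epsilon>\<close> (\<open>four_alpha_minus_delta\<close>). It makes \<open>B + g\<close> bounded, which keeps \<open>p\<^sub>d\<^sub>a\<close>
  away from \<open>p\<^sub>b\<^sub>c\<close>, and it makes the cross-ratio equal to \<open>- 1 / 3 + O(\<epsilon>\<^sup>2)\<close>, which gives a
  limit for \<open>Im cr / \<epsilon>\<^sup>2\<close>. The limits of \<open>Im cr / \<epsilon>\<^sup>2\<close> and of \<open>w\<close> combine to the torsion
  (\<open>limit_cross_ratio\<close>, \<open>limit_offset\<close>).

  The linear coefficient vanishes by a symmetry that spares its computation. Replacing \<open>\<epsilon>\<close>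
  by \<open>- \<epsilon>\<close> reverses the four samples. The map \<open>f\<close> is symmetric enough for the circle and \<open>w\<close>
  to stay the same, while \<open>Im cr\<close> changes by \<open>- 2 \<langle>Im cr, T\<rangle> T\<close> with \<open>T\<close> the unit vector
  along \<open>d - a\<close> (\<open>cross_ratio_reverse\<close>). Both \<open>\<langle>Im cr, T\<rangle> / \<epsilon>\<^sup>2\<close> and \<open>\<langle>T, w\<rangle>\<close> are \<open>O(\<epsilon>)\<close>, so
  \<open>\<tau>\<^sub>0\<close> is even up to \<open>O(\<epsilon>\<^sup>2)\<close> and \<open>\<beta> = 0\<close> (\<open>expandable_even_bigo\<close>).
\<close>

section \<open>Expansions at zero with bounded remainder\<close>

text \<open>
  The expansion is peeled off one coefficient at a time and keeps the coefficients hidden.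
  In this form each closure property is an induction in which only the current coefficient
  appears; with explicit polynomials every product, inverse and root would need a
  coefficient formula.
\<close>
primrec expandable :: "nat \<Rightarrow> (real \<Rightarrow> 'a::real_normed_vector) \<Rightarrow> bool" where
  "expandable 0 = (\<lambda>f. Bfun f (at 0))"
| "expandable (Suc n) =
     (\<lambda>f. \<exists>c g. expandable n g \<and> (\<forall>\<^sub>F \<epsilon> in at 0. f \<epsilon> = c + \<epsilon> *\<^sub>R g \<epsilon>))"

lemma expandable_cong:
  assumes "expandable n f" "\<forall>\<^sub>F \<epsilon> in at 0. f \<epsilon> = g \<epsilon>"
  shows "expandable n g"
proof (cases n)
  case 0
  then obtain K where "K > 0" "\<forall>\<^sub>F \<epsilon> in at 0. norm (f \<epsilon>) \<le> K"
    using assms(1) by (auto simp: Bfun_def)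
  moreover from this(2) assms(2) have "\<forall>\<^sub>F \<epsilon> in at 0. norm (g \<epsilon>) \<le> K"
    by eventually_elim simp
  ultimately show ?thesis
    using 0 by (auto simp: Bfun_def)
next
  case (Suc m)
  then obtain c k where "expandable m k" "\<forall>\<^sub>F \<epsilon> in at 0. f \<epsilon> = c + \<epsilon> *\<^sub>R k \<epsilon>"
    using assms(1) by auto
  moreover from this(2) assms(2) have "\<forall>\<^sub>F \<epsilon> in at 0. g \<epsilon> = c + \<epsilon> *\<^sub>R k \<epsilon>"
    by eventually_elim simp
  ultimately show ?thesis
    using Suc by auto
qed

lemma expandable_tendsto_of_bounded:
  fixes f g :: "real \<Rightarrow> 'a::real_normed_vector"
  assumes "Bfun g (at 0)" "\<forall>\<^sub>F \<epsilon> in at 0. f \<epsilon> = c + \<epsilon> *\<^sub>R g \<epsilon>"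
  shows "(f \<longlongrightarrow> c) (at (0::real))"
proof -
  have "Zfun (\<lambda>\<epsilon>::real. \<epsilon>) (at 0)"
    by (simp add: tendsto_Zfun_iff[of _ 0, simplified, symmetric])
  then have "Zfun (\<lambda>\<epsilon>. \<epsilon> *\<^sub>R g \<epsilon>) (at 0)"
    by (rule bounded_bilinear.Zfun_prod_Bfun[OF bounded_bilinear_scaleR _ assms(1)])
  then have "((\<lambda>\<epsilon>. c + \<epsilon> *\<^sub>R g \<epsilon>) \<longlongrightarrow> c) (at 0)"
    by (simp add: tendsto_Zfun_iff)
  moreover have "\<forall>\<^sub>F \<epsilon> in at 0. c + \<epsilon> *\<^sub>R g \<epsilon> = f \<epsilon>"
    using assms(2) by eventually_elim simp
  ultimately show ?thesis
    by (rule Lim_transform_eventually)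
qed

lemma expandable_const [simp]: "expandable n (\<lambda>_. c)"
proof (induction n arbitrary: c)
  case 0
  show ?case by (auto simp: Bfun_def intro!: exI[of _ "norm c + 1"] add_nonneg_pos)
next
  case (Suc n)
  show ?case
    using Suc[of 0] by (auto intro!: exI[of _ c] exI[of _ "\<lambda>_. 0"])
qed

lemma tendsto_imp_Bfun:
  fixes f :: "real \<Rightarrow> 'a::real_normed_vector"
  assumes "(f \<longlongrightarrow> c) F"
  shows "Bfun f F"
proof -
  have "\<forall>\<^sub>F x in F. dist (f x) c < 1"
    using assms by (rule tendstoD) simp
  then have "\<forall>\<^sub>F x in F. norm (f x) \<le> norm c + 1"
    by eventually_elim (smt (verit) dist_norm norm_triangle_sub)
  then show ?thesis
    by (auto simp: Bfun_def intro!: exI[of _ "norm c + 1"] add_nonneg_pos)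
qed

lemma expandable_bounded: "expandable n f \<Longrightarrow> Bfun f (at 0)"
proof (induction n arbitrary: f)
  case (Suc n)
  then obtain c g where "expandable n g" "\<forall>\<^sub>F \<epsilon> in at 0. f \<epsilon> = c + \<epsilon> *\<^sub>R g \<epsilon>"
    by auto
  then show ?case
    using Suc.IH expandable_tendsto_of_bounded tendsto_imp_Bfun by blast
qed simp

lemma expandable_SucE:
  assumes "expandable (Suc n) f"
  obtains c g where "expandable n g" "\<forall>\<^sub>F \<epsilon> in at 0. f \<epsilon> = c + \<epsilon> *\<^sub>R g \<epsilon>"
    "(f \<longlongrightarrow> c) (at 0)"
  using assms expandable_bounded expandable_tendsto_of_bounded by auto blast

lemma expandable_SucI:
  "expandable n g \<Longrightarrow> \<forall>\<^sub>F \<epsilon> in at 0. f \<epsilon> = c + \<epsilon> *\<^sub>R g \<epsilon> \<Longrightarrow> expandable (Suc n) f"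
  by auto

lemma expandable_SucD: "expandable (Suc n) f \<Longrightarrow> expandable n f"
proof (induction n arbitrary: f)
  case 0
  then show ?case using expandable_bounded by fastforce
next
  case (Suc n)
  then show ?case by (meson expandable_SucE expandable_SucI)
qed

lemma expandable_Suc_limitE:
  assumes "expandable (Suc n) f" "(f \<longlongrightarrow> c) (at 0)"
  obtains g where "expandable n g" "\<forall>\<^sub>F \<epsilon> in at 0. f \<epsilon> = c + \<epsilon> *\<^sub>R g \<epsilon>"
proof -
  obtain c' g where g: "expandable n g" "\<forall>\<^sub>F \<epsilon> in at 0. f \<epsilon> = c' + \<epsilon> *\<^sub>R g \<epsilon>"
    "(f \<longlongrightarrow> c') (at 0)"
    using assms(1) by (rule expandable_SucE)
  then have "c' = c"
    using assms(2) tendsto_unique trivial_limit_at by blast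
  with g that show thesis by simp
qed

lemma expandable_add:
  "expandable n f \<Longrightarrow> expandable n g \<Longrightarrow> expandable n (\<lambda>\<epsilon>. f \<epsilon> + g \<epsilon>)"
proof (induction n arbitrary: f g)
  case 0
  then obtain C D where *: "\<forall>\<^sub>F x in at 0. norm (f x) \<le> C" "\<forall>\<^sub>F x in at 0. norm (g x) \<le> D"
    "C > 0" "D > 0"
    by (auto simp: Bfun_def)
  from *(1,2) have "\<forall>\<^sub>F x in at 0. norm (f x + g x) \<le> C + D"
    by eventually_elim (rule norm_triangle_mono)
  with * show ?case
    by (auto simp: Bfun_def intro!: exI[of _ "C + D"])
next
  case (Suc n)
  obtain c k where 1: "expandable n k" "\<forall>\<^sub>F \<epsilon> in at 0. f \<epsilon> = c + \<epsilon> *\<^sub>R k \<epsilon>"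
    using Suc.prems(1) by auto
  obtain d l where 2: "expandable n l" "\<forall>\<^sub>F \<epsilon> in at 0. g \<epsilon> = d + \<epsilon> *\<^sub>R l \<epsilon>"
    using Suc.prems(2) by auto
  have "\<forall>\<^sub>F \<epsilon> in at 0. f \<epsilon> + g \<epsilon> = (c + d) + \<epsilon> *\<^sub>R (k \<epsilon> + l \<epsilon>)"
    using 1(2) 2(2) by eventually_elim (simp add: algebra_simps)
  with Suc.IH[OF 1(1) 2(1)] show ?case
    by (rule expandable_SucI)
qed

lemma (in bounded_linear) expandable:
  "expandable n g \<Longrightarrow> expandable n (\<lambda>\<epsilon>. f (g \<epsilon>))"
proof (induction n arbitrary: g)
  case 0
  then obtain C where *: "\<forall>\<^sub>F x in at 0. norm (g x) \<le> C" "C > 0"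
    by (auto simp: Bfun_def)
  obtain K where K: "K > 0" "\<And>x. norm (f x) \<le> norm x * K"
    using pos_bounded by blast
  have "\<forall>\<^sub>F x in at 0. norm (f (g x)) \<le> C * K"
    using *(1) by eventually_elim (use K in \<open>meson mult_right_mono order_trans less_imp_le\<close>)
  with * K show ?case
    by (auto simp: Bfun_def intro!: exI[of _ "C * K"])
next
  case (Suc n)
  obtain c k where 1: "expandable n k" "\<forall>\<^sub>F \<epsilon> in at 0. g \<epsilon> = c + \<epsilon> *\<^sub>R k \<epsilon>"
    using Suc.prems by auto
  have "\<forall>\<^sub>F \<epsilon> in at 0. f (g \<epsilon>) = f c + \<epsilon> *\<^sub>R f (k \<epsilon>)"
    using 1(2) by eventually_elim (simp add: add scaleR)
  with Suc.IH[OF 1(1)] show ?case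
    by (rule expandable_SucI)
qed

lemma (in bounded_bilinear) expandable:
  "expandable n f \<Longrightarrow> expandable n g \<Longrightarrow> expandable n (\<lambda>\<epsilon>. prod (f \<epsilon>) (g \<epsilon>))"
proof (induction n arbitrary: f g)
  case 0
  then obtain C D where *: "\<forall>\<^sub>F x in at 0. norm (f x) \<le> C" "\<forall>\<^sub>F x in at 0. norm (g x) \<le> D"
    "C > 0" "D > 0"
    by (auto simp: Bfun_def)
  obtain K where K: "K > 0" "\<And>x y. norm (prod x y) \<le> norm x * norm y * K"
    using pos_bounded by blast
  have "\<forall>\<^sub>F x in at 0. norm (prod (f x) (g x)) \<le> C * D * K"
    using *(1,2)
  proof eventually_elim
    case (elim x)
    have "norm (f x) * norm (g x) * K \<le> C * D * K"
      using elim * K by (intro mult_mono) auto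
    with K(2) show ?case by (rule order_trans)
  qed
  with * K show ?case
    by (auto simp: Bfun_def intro!: exI[of _ "C * D * K"])
next
  case (Suc n)
  obtain c k where 1: "expandable n k" "\<forall>\<^sub>F \<epsilon> in at 0. f \<epsilon> = c + \<epsilon> *\<^sub>R k \<epsilon>"
    using Suc.prems(1) by auto
  obtain d l where 2: "expandable n l" "\<forall>\<^sub>F \<epsilon> in at 0. g \<epsilon> = d + \<epsilon> *\<^sub>R l \<epsilon>"
    using Suc.prems(2) by auto
  have "\<forall>\<^sub>F \<epsilon> in at 0. prod (f \<epsilon>) (g \<epsilon>) = prod c d + \<epsilon> *\<^sub>R (prod (k \<epsilon>) (g \<epsilon>) + prod c (l \<epsilon>))"
    using 1(2) 2(2)
    by eventually_elim (simp add: add_left add_right scaleR_left scaleR_right algebra_simps)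
  moreover have "expandable n (\<lambda>\<epsilon>. prod (k \<epsilon>) (g \<epsilon>) + prod c (l \<epsilon>))"
    using Suc.IH 1 2 expandable_SucD[OF Suc.prems(2)] by (intro expandable_add) auto
  ultimately show ?case
    by (blast intro: expandable_SucI)
qed

lemmas expandable_mult = bounded_bilinear.expandable[OF bounded_bilinear_mult]
lemmas expandable_scaleR = bounded_bilinear.expandable[OF bounded_bilinear_scaleR]
lemmas expandable_inner = bounded_bilinear.expandable[OF bounded_bilinear_inner]
lemmas expandable_minus = bounded_linear.expandable[OF bounded_linear_minus[OF bounded_linear_ident]]

lemma expandable_diff:
  "expandable n f \<Longrightarrow> expandable n g \<Longrightarrow> expandable n (\<lambda>\<epsilon>. f \<epsilon> - g \<epsilon>)"
  using expandable_add[OF _ expandable_minus, of n f g] by simp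

lemma expandable_times_ident:
  "expandable n f \<Longrightarrow> expandable (Suc n) (\<lambda>\<epsilon>. \<epsilon> *\<^sub>R f \<epsilon>)"
  by (rule expandable_SucI[where c = 0 and g = f]) simp_all

lemma expandable_ident [simp]: "expandable n (\<lambda>\<epsilon>. \<epsilon>)"
proof -
  have "expandable (Suc n) (\<lambda>\<epsilon>. \<epsilon> *\<^sub>R (1::real))"
    by (rule expandable_times_ident) simp
  then show ?thesis
    using expandable_SucD by fastforce
qed

text \<open>
  For \<open>f = c + \<epsilon> k\<close> the difference \<open>inverse f - inverse c\<close> equals \<open>- \<epsilon> (inverse f * k *
  inverse c)\<close>. Its order \<open>n + 1\<close> expansion only needs the order \<open>n\<close> expansion of \<open>inverse
  f\<close>, so the induction closes, also without commutativity.
\<close>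
lemma expandable_inverse:
  fixes f :: "real \<Rightarrow> 'a::real_normed_div_algebra"
  assumes "(f \<longlongrightarrow> c) (at 0)" "c \<noteq> 0"
  shows "expandable n f \<Longrightarrow> expandable n (\<lambda>\<epsilon>. inverse (f \<epsilon>))"
proof (induction n)
  case 0
  show ?case
    using Bfun_inverse[OF assms] by simp
next
  case (Suc n)
  obtain k where k: "expandable n k" "\<forall>\<^sub>F \<epsilon> in at 0. f \<epsilon> = c + \<epsilon> *\<^sub>R k \<epsilon>"
    using Suc.prems assms(1) by (rule expandable_Suc_limitE)
  have "\<forall>\<^sub>F \<epsilon> in at 0. f \<epsilon> \<noteq> 0"
    using assms tendsto_imp_eventually_ne by blast
  with k(2) have
    "\<forall>\<^sub>F \<epsilon> in at 0. inverse (f \<epsilon>) = inverse c + \<epsilon> *\<^sub>R (- (inverse (f \<epsilon>) * k \<epsilon> * inverse c))"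
  proof eventually_elim
    case (elim \<epsilon>)
    have "inverse (f \<epsilon>) - inverse c = - (inverse (f \<epsilon>) * (f \<epsilon> - c) * inverse c)"
      using elim assms(2) by (rule_tac inverse_diff_inverse) auto
    also have "f \<epsilon> - c = \<epsilon> *\<^sub>R k \<epsilon>" using elim by simp
    finally show ?case by (simp add: algebra_simps)
  qed
  moreover have "expandable n (\<lambda>\<epsilon>. - (inverse (f \<epsilon>) * k \<epsilon> * inverse c))"
    using Suc.IH expandable_SucD[OF Suc.prems] k(1)
    by (intro expandable_minus expandable_mult) auto
  ultimately show ?case
    by (blast intro: expandable_SucI)
qed

text \<open>
  If \<open>f = c + b \<epsilon> + O(\<epsilon>\<^sup>2)\<close>, then \<open>f (- \<epsilon>) - f \<epsilon> = - 2 b \<epsilon> + O(\<epsilon>\<^sup>2)\<close>, and this is \<open>O(\<epsilon>\<^sup>2)\<close> only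
  for \<open>b = 0\<close>. Approximate evenness suffices, which matters because the discrete torsion is
  not exactly invariant under reversal of the curve.
\<close>
lemma expandable_even_bigo:
  fixes f :: "real \<Rightarrow> real"
  assumes f: "expandable 2 f" "(f \<longlongrightarrow> c) (at 0)"
    and even: "(\<lambda>\<epsilon>. f (- \<epsilon>) - f \<epsilon>) \<in> O[at 0](\<lambda>\<epsilon>. \<epsilon>\<^sup>2)"
  shows "(\<lambda>\<epsilon>. f \<epsilon> - c) \<in> O[at 0](\<lambda>\<epsilon>. \<epsilon>\<^sup>2)"
proof -
  obtain g where g: "expandable 1 g" "\<forall>\<^sub>F \<epsilon> in at 0. f \<epsilon> = c + \<epsilon> * g \<epsilon>"
    using expandable_Suc_limitE[of 1 f c] f by (auto simp: numeral_2_eq_2)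
  obtain b h where h: "Bfun h (at 0)" "\<forall>\<^sub>F \<epsilon> in at 0. g \<epsilon> = b + \<epsilon> * h \<epsilon>"
    using g(1) by auto
  then obtain C where C: "\<forall>\<^sub>F \<epsilon> in at 0. \<bar>h \<epsilon>\<bar> \<le> C" "C > 0"
    by (auto simp: Bfun_def)
  obtain D where D: "\<forall>\<^sub>F \<epsilon> in at 0. \<bar>f (- \<epsilon>) - f \<epsilon>\<bar> \<le> D * \<epsilon>\<^sup>2" "D > 0"
    using even by (auto elim!: landau_o.bigE)
  define nondegenerate where "nondegenerate \<epsilon> \<longleftrightarrow> f \<epsilon> = c + \<epsilon> * (b + \<epsilon> * h \<epsilon>) \<and> \<bar>h \<epsilon>\<bar> \<le> C" for \<epsilon>
  have nondegenerate: "\<forall>\<^sub>F \<epsilon> in at 0. nondegenerate \<epsilon>"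
    using g(2) h(2) C(1) by eventually_elim (simp add: nondegenerate_def)
  then have "\<forall>\<^sub>F \<epsilon> in filtermap uminus (at 0). nondegenerate \<epsilon>"
    by (simp add: filtermap_at_minus)
  then have good': "\<forall>\<^sub>F \<epsilon> in at 0. nondegenerate (- \<epsilon>)"
    by (simp add: eventually_filtermap)
  have ev: "\<forall>\<^sub>F \<epsilon> in at 0. \<bar>b\<bar> \<le> (D / 2 + C) * \<bar>\<epsilon>\<bar>"
    using nondegenerate good' D(1) eventually_neq_at_within[of 0 0 UNIV]
  proof eventually_elim
    case (elim \<epsilon>)
    have "2 * (\<bar>b\<bar> * \<bar>\<epsilon>\<bar>) = \<bar>(f (- \<epsilon>) - f \<epsilon>) - \<epsilon>\<^sup>2 * (h (- \<epsilon>) - h \<epsilon>)\<bar>"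
    proof -
      have "(f (- \<epsilon>) - f \<epsilon>) - \<epsilon>\<^sup>2 * (h (- \<epsilon>) - h \<epsilon>) = - 2 * (b * \<epsilon>)"
        using elim by (simp add: nondegenerate_def algebra_simps power2_eq_square)
      then show ?thesis
        by (simp add: abs_mult)
    qed
    also have "\<dots> \<le> \<bar>f (- \<epsilon>) - f \<epsilon>\<bar> + \<bar>\<epsilon>\<^sup>2 * (h (- \<epsilon>) - h \<epsilon>)\<bar>"
      by linarith
    also have "\<bar>\<epsilon>\<^sup>2 * (h (- \<epsilon>) - h \<epsilon>)\<bar> \<le> \<epsilon>\<^sup>2 * (2 * C)"
      using elim unfolding abs_mult by (intro mult_mono) (auto simp: nondegenerate_def)
    finally have "\<bar>b\<bar> * \<bar>\<epsilon>\<bar> \<le> ((D / 2 + C) * \<bar>\<epsilon>\<bar>) * \<bar>\<epsilon>\<bar>"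
      using elim by (simp add: algebra_simps power2_eq_square)
    then show ?case
      using elim by (simp add: mult_le_cancel_right)
  qed
  have "((\<lambda>\<epsilon>::real. (D / 2 + C) * \<bar>\<epsilon>\<bar>) \<longlongrightarrow> (D / 2 + C) * \<bar>0\<bar>) (at 0)"
    by (intro tendsto_intros)
  then have "\<bar>b\<bar> \<le> (D / 2 + C) * \<bar>0\<bar>"
    using ev by (rule tendsto_lowerbound) simp
  then have "b = 0" by simp
  have "\<forall>\<^sub>F \<epsilon> in at 0. norm (f \<epsilon> - c) \<le> C * norm (\<epsilon>\<^sup>2)"
    using nondegenerate
  proof eventually_elim
    case (elim \<epsilon>)
    then have "f \<epsilon> - c = \<epsilon>\<^sup>2 * h \<epsilon>"
      by (simp add: nondegenerate_def \<open>b = 0\<close> power2_eq_square)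
    with elim show ?case
      by (simp add: nondegenerate_def abs_mult mult.commute mult_right_mono)
  qed
  then show ?thesis
    by (rule landau_o.bigI[OF C(2)])
qed

section \<open>Quaternions, square roots and geometric means\<close>

lemma quat_sel [simp]:
  "qRe 0 = 0" "qIm 0 = 0" "qRe 1 = 1" "qIm 1 = 0"
  "qRe (p + q) = qRe p + qRe q" "qIm (p + q) = qIm p + qIm q"
  "qRe (p - q) = qRe p - qRe q" "qIm (p - q) = qIm p - qIm q"
  "qRe (- p) = - qRe p" "qIm (- p) = - qIm p"
  "qRe (r *\<^sub>R p) = r * qRe p" "qIm (r *\<^sub>R p) = r *\<^sub>R qIm p"
  "qRe (of_real r) = r" "qIm (of_real r) = 0"
  "qRe (im_quat v) = 0" "qIm (im_quat v) = v"
  by (simp_all add: quat_ops of_real_def im_quat_def)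

lemma quat_sel_numeral [simp]: "qRe (numeral n) = numeral n" "qIm (numeral n) = 0"
  using quat_sel(13,14)[of "numeral n"] by simp_all

lemma quat_mult_sel:
  "qRe (p * q) = qRe p * qRe q - qIm p \<bullet> qIm q"
  "qIm (p * q) = qRe p *\<^sub>R qIm q + qRe q *\<^sub>R qIm p + qIm p \<times> qIm q"
  by (simp_all add: quat_ops)

lemma norm_quat_squared: "(norm (q::quat))\<^sup>2 = (qRe q)\<^sup>2 + qIm q \<bullet> qIm q"
  by (simp add: norm_quat_def power2_norm_eq_inner)

lemma im_quat_qIm: "qRe q = 0 \<Longrightarrow> im_quat (qIm q) = q"
  by (simp add: quat_eq_iff)

lemma im_quat_diff: "im_quat (v - w) = im_quat v - im_quat w"
  and im_quat_add: "im_quat (v + w) = im_quat v + im_quat w"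
  and im_quat_scaleR: "im_quat (r *\<^sub>R v) = r *\<^sub>R im_quat v"
  by (simp_all add: quat_eq_iff)

lemma im_quat_eq_iff [simp]: "im_quat v = im_quat w \<longleftrightarrow> v = w"
  by (simp add: quat_eq_iff)

lemma im_quat_0 [simp]: "im_quat 0 = 0"
  by (simp add: quat_eq_iff)

lemma im_quat_eq_0_iff [simp]: "im_quat v = 0 \<longleftrightarrow> v = 0"
  by (simp add: quat_eq_iff)

lemma norm_im_quat [simp]: "norm (im_quat v) = norm v"
  by (simp add: norm_quat_def)

lemma bounded_linear_im_quat: "bounded_linear im_quat"
  by (rule bounded_linear_intro[where K = 1]) (simp_all add: im_quat_add im_quat_scaleR)

lemma bounded_linear_qIm: "bounded_linear qIm"
  by (rule bounded_linear_intro[where K = 1])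
     (auto simp: norm_quat_def intro: real_le_rsqrt)

lemma bounded_linear_qRe: "bounded_linear qRe"
  by (rule bounded_linear_intro[where K = 1])
     (auto simp: norm_quat_def intro: real_le_rsqrt)

lemmas expandable_im_quat = bounded_linear.expandable[OF bounded_linear_im_quat]
lemmas expandable_qIm = bounded_linear.expandable[OF bounded_linear_qIm]
lemmas tendsto_im_quat = bounded_linear.tendsto[OF bounded_linear_im_quat]
lemmas tendsto_qIm = bounded_linear.tendsto[OF bounded_linear_qIm]

lemma qRe_mult_commute: "qRe (p * q) = qRe (q * p)"
  by (simp add: quat_mult_sel inner_commute mult.commute)

lemma qRe_conjugate: "z \<noteq> 0 \<Longrightarrow> qRe (z * q * inverse z) = qRe q"
  using qRe_mult_commute[of "z * q" "inverse z"] by (simp flip: mult.assoc)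

lemma qRe_inverse: "qRe (inverse q) = qRe q / (norm q)\<^sup>2"
  and qIm_inverse: "qIm (inverse q) = - (qIm q /\<^sub>R (norm q)\<^sup>2)"
  by (simp_all add: inverse_quat_def norm_quat_def divide_inverse)

lemma inverse_im_quat: "inverse (im_quat v) = im_quat (- (1 / (v \<bullet> v)) *\<^sub>R v)"
  by (simp add: quat_eq_iff qRe_inverse qIm_inverse power2_norm_eq_inner divide_inverse)

text \<open>
  Every quaternion satisfies a real quadratic equation. Therefore a square root of \<open>q\<close> with
  nonzero real part is a real combination of \<open>1\<close> and \<open>q\<close>, which gives existence and
  uniqueness of the root as well as \<open>qRe_gmean\<close>.
\<close>
lemma quat_square: "q * q = (2 * qRe q) *\<^sub>R q - (norm q)\<^sup>2 *\<^sub>R 1"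
  by (simp add: quat_eq_iff quat_mult_sel norm_quat_squared power2_eq_square[of "qRe q"]
      flip: scaleR_add_left)

text \<open>
  The norm and the real part of the square determine norm and real part of the root (given
  the sign), and \<open>quat_square\<close> is then a linear equation for the root.
\<close>
lemma quat_sqrt_unique:
  assumes "r * r = s * s" "qRe r > 0" "qRe s > 0"
  shows "r = (s :: quat)"
proof -
  have "norm r * norm r = norm s * norm s"
    using assms(1) by (metis norm_mult)
  then have n: "norm r = norm s"
    by (metis norm_ge_zero power2_eq_iff_nonneg power2_eq_square)
  have "2 * (qRe r * qRe r) = qRe (r * r) + (norm r)\<^sup>2" for r :: quat
    by (simp add: quat_square)
  then have "qRe r * qRe r = qRe s * qRe s"
    using assms(1) n by (metis mult_cancel_left zero_neq_numeral)
  then have re: "qRe r = qRe s"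
    using assms by (metis abs_of_pos power2_eq_iff power2_eq_square abs_minus_cancel)
  have "(2 * qRe r) *\<^sub>R r = (2 * qRe r) *\<^sub>R s"
    using assms(1) quat_square[of r] quat_square[of s] n re by simp
  then show ?thesis
    using assms(2) by simp
qed

text \<open>
  Zero is excluded along with the negative reals: on this domain the principal root has
  positive real part, in particular it is invertible.
\<close>
definition slit_quat :: "quat \<Rightarrow> bool" where
  "slit_quat q \<longleftrightarrow> q \<noteq> 0 \<and> \<not> neg_real_quat q"

lemma slit_quat_iff: "slit_quat q \<longleftrightarrow> norm q + qRe q > 0"
proof -
  have *: "qRe q \<le> norm q" "- qRe q \<le> norm q"
    by (auto simp: norm_quat_def intro!: real_le_rsqrt)
  have "norm q + qRe q \<noteq> 0" if "slit_quat q"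
  proof
    assume "norm q + qRe q = 0"
    then have "norm q = - qRe q"
      by simp
    then have "qIm q \<bullet> qIm q = 0"
      using norm_quat_squared[of q] by simp
    then have "q = of_real (qRe q)"
      by (simp add: quat_eq_iff)
    with that \<open>norm q = - qRe q\<close> show False
      unfolding slit_quat_def neg_real_quat_def
      by (metis add.inverse_inverse linorder_cases neg_0_less_iff_less not_less_iff_gr_or_eq
          of_real_0 zero_less_norm_iff)
  qed
  moreover have "slit_quat q" if "norm q + qRe q > 0"
    using that unfolding slit_quat_def neg_real_quat_def by auto
  ultimately show ?thesis
    using * by force
qed

text \<open>
  Solving \<open>quat_square\<close> for the root gives \<open>r = (q + |q|) / (2 Re r)\<close>, where \<open>(2 Re r)\<^sup>2 = 2
  (|q| + Re q)\<close>.
\<close>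
lemma quat_sqrt_exists:
  assumes "slit_quat q"
  obtains r where "r * r = q" "qRe r > 0"
proof -
  define t where "t = sqrt (2 * (norm q + qRe q))"
  have t: "t > 0" "t * t = 2 * (norm q + qRe q)"
    using assms by (simp_all add: t_def slit_quat_iff)
  define r where "r = (q + norm q *\<^sub>R 1) /\<^sub>R t"
  have "(q + norm q *\<^sub>R 1) * (q + norm q *\<^sub>R 1) =
      q * q + (2 * norm q) *\<^sub>R q + (norm q)\<^sup>2 *\<^sub>R 1"
    by (simp add: distrib_left distrib_right power2_eq_square scaleR_add_right)
       (simp flip: scaleR_add_left)
  also have "\<dots> = (t * t) *\<^sub>R q"
    unfolding t(2) quat_square[of q] by (simp add: algebra_simps)
  finally have "(q + norm q *\<^sub>R 1) * (q + norm q *\<^sub>R 1) = (t * t) *\<^sub>R q" .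
  moreover have "inverse t * (inverse t * (t * t)) = 1"
    using t(1) by (simp add: field_simps)
  ultimately have "r * r = q"
    by (simp add: r_def)
  moreover have "qRe r > 0"
    using t assms by (simp add: r_def slit_quat_iff add.commute)
  ultimately show thesis ..
qed

lemma slit_quat_if_sqrt:
  assumes "qRe r > 0"
  shows "slit_quat (r * r)"
proof -
  have "qRe (r * r) = 2 * (qRe r * qRe r) - (norm r)\<^sup>2"
    unfolding quat_square[of r] by simp
  then have "norm (r * r) + qRe (r * r) = 2 * (qRe r * qRe r)"
    by (simp add: norm_mult power2_eq_square)
  then show ?thesis
    using assms by (simp add: slit_quat_iff)
qed

lemma quat_polar_square:
  fixes v :: "real^3"
  assumes "norm v = 1"
  shows "Quat (cos x) (sin x *\<^sub>R v) * Quat (cos x) (sin x *\<^sub>R v) =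
    Quat (cos (2 * x)) (sin (2 * x) *\<^sub>R v)"
  using assms
  by (simp add: quat_eq_iff quat_mult_sel cos_double sin_double power2_eq_square
      norm_eq_1 cross_mult_left cross_mult_right flip: scaleR_add_left)

lemma quat_polar_form:
  obtains \<phi> v where "norm v = 1" "\<phi> \<in> {0..pi}" "q = norm q *\<^sub>R Quat (cos \<phi>) (sin \<phi> *\<^sub>R v)"
proof -
  have *: "\<bar>qRe q\<bar> \<le> norm q"
    by (auto simp: norm_quat_def intro!: real_le_rsqrt)
  define \<phi> where "\<phi> = arccos (qRe q / norm q)"
  define v where "v = (if qIm q = 0 then axis 1 1 else sgn (qIm q))"
  have v: "norm v = 1" "qIm q = norm (qIm q) *\<^sub>R v"
    by (simp_all add: v_def norm_sgn sgn_div_norm)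
  have b: "\<bar>qRe q / norm q\<bar> \<le> 1"
    using * by (cases "q = 0") simp_all
  then have "cos \<phi> = qRe q / norm q" and "\<phi> \<in> {0..pi}"
    unfolding \<phi>_def abs_le_iff by (simp_all add: arccos_lbound arccos_ubound cos_arccos)
  then have \<phi>: "\<phi> \<in> {0..pi}" "norm q * cos \<phi> = qRe q"
    using * by (cases "q = 0"; simp)+
  have "norm q * sin \<phi> = norm (qIm q)"
  proof (rule power2_eq_imp_eq)
    have "(norm q * sin \<phi>)\<^sup>2 = (norm q)\<^sup>2 - (norm q * cos \<phi>)\<^sup>2"
      by (simp add: power_mult_distrib sin_squared_eq algebra_simps)
    also have "\<dots> = (norm (qIm q))\<^sup>2"
      unfolding \<phi>(2) by (simp add: norm_quat_squared power2_norm_eq_inner)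
    finally show "(norm q * sin \<phi>)\<^sup>2 = (norm (qIm q))\<^sup>2" .
    show "norm q * sin \<phi> \<ge> 0"
      using \<phi> by (auto intro!: mult_nonneg_nonneg sin_ge_zero)
  qed simp
  then have "q = norm q *\<^sub>R Quat (cos \<phi>) (sin \<phi> *\<^sub>R v)"
    using \<phi> v by (simp add: quat_eq_iff)
  with v \<phi> that show thesis by blast
qed

text \<open>
  A root with positive real part has polar angle below \<open>\<pi> / 2\<close>. Doubling the angle gives a
  polar form of \<open>q\<close> as in the definition of \<open>qsqrt\<close>. Conversely any polar form of \<open>q\<close> yields
  a root with positive real part, because the angle \<open>\<pi>\<close> would put \<open>q\<close> on the slit. From here
  on, identities for \<open>qsqrt\<close> are proved by squaring.
\<close>
lemma qsqrt_eqI: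
  assumes "r * r = q" "qRe r > 0"
  shows "qsqrt q = r"
  unfolding qsqrt_def
proof (rule the_equality, goal_cases)
  case 1
  obtain \<phi> v where v: "norm v = 1" "\<phi> \<in> {0..pi}" "r = norm r *\<^sub>R Quat (cos \<phi>) (sin \<phi> *\<^sub>R v)"
    by (rule quat_polar_form)
  have "norm r > 0"
    using assms by auto
  moreover have "qRe r = norm r * cos \<phi>"
    by (subst v(3)) simp
  ultimately have "cos \<phi> > 0"
    using assms(2) zero_less_mult_pos by metis
  then have "\<phi> \<le> pi / 2"
    using v(2) by (metis atLeastAtMost_iff cos_monotone_0_pi_le cos_pi_half leD less_eq_real_def
        linorder_not_le pi_ge_zero divide_nonneg_pos zero_less_numeral)
  have q: "norm q = norm r * norm r"
    using assms(1) norm_mult by metis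
  have "q = norm q *\<^sub>R Quat (cos (2 * \<phi>)) (sin (2 * \<phi>) *\<^sub>R v)"
    unfolding q quat_polar_square[OF v(1), symmetric]
    using assms(1) v(3) by (metis mult_scaleR_left mult_scaleR_right scaleR_scaleR)
  moreover have "r = sqrt (norm q) *\<^sub>R Quat (cos (2 * \<phi> / 2)) (sin (2 * \<phi> / 2) *\<^sub>R v)"
    using v(3) q by simp
  ultimately show ?case
    using v \<open>\<phi> \<le> pi / 2\<close> by (intro exI[of _ "2 * \<phi>"] exI[of _ v]) auto
next
  case (2 w)
  then obtain \<phi> v where v: "norm v = 1" "\<phi> \<in> {0..pi}"
    "q = norm q *\<^sub>R Quat (cos \<phi>) (sin \<phi> *\<^sub>R v)"
    "w = sqrt (norm q) *\<^sub>R Quat (cos (\<phi> / 2)) (sin (\<phi> / 2) *\<^sub>R v)"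
    by blast
  have "w * w = q"
    using v(3) quat_polar_square[OF v(1), of "\<phi> / 2"] by (simp add: v(4))
  have slit: "slit_quat q"
    using slit_quat_if_sqrt[OF assms(2)] assms(1) by simp
  have "\<phi> \<noteq> pi"
  proof
    assume "\<phi> = pi"
    then have "qRe q = - norm q"
      by (subst v(3)) simp
    with slit show False
      by (simp add: slit_quat_iff)
  qed
  then have "cos (\<phi> / 2) > 0"
    using v(2) by (intro cos_gt_zero_pi) auto
  then have "qRe w > 0"
    using slit by (simp add: v(4) slit_quat_def)
  moreover have "w * w = r * r"
    using \<open>w * w = q\<close> assms(1) by (rule trans[OF _ sym])
  ultimately show ?case
    using assms(2) by (rule_tac quat_sqrt_unique)
qed

lemma
  assumes "slit_quat q"
  shows qsqrt_square: "qsqrt q * qsqrt q = q"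
    and qRe_qsqrt_pos: "qRe (qsqrt q) > 0"
  using quat_sqrt_exists[OF assms] qsqrt_eqI by metis+

lemma qsqrt_nonzero: "slit_quat q \<Longrightarrow> qsqrt q \<noteq> 0"
  using qRe_qsqrt_pos by fastforce

lemma slit_quat_conjugate:
  assumes "z \<noteq> 0" "slit_quat q"
  shows "slit_quat (z * q * inverse z)"
proof -
  have "norm (z * q * inverse z) = norm q"
    using assms(1) by (simp add: norm_mult norm_inverse)
  then show ?thesis
    using assms unfolding slit_quat_iff by (simp only: qRe_conjugate[OF assms(1)])
qed

lemma qsqrt_conjugate:
  assumes "z \<noteq> 0" "slit_quat q"
  shows "qsqrt (z * q * inverse z) = z * qsqrt q * inverse z"
proof (rule qsqrt_eqI)
  have "z * qsqrt q * inverse z * (z * qsqrt q * inverse z) =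
      z * qsqrt q * (inverse z * z) * qsqrt q * inverse z"
    by (simp only: mult.assoc)
  also have "\<dots> = z * (qsqrt q * qsqrt q) * inverse z"
    using assms(1) by (simp add: mult.assoc)
  finally show "z * qsqrt q * inverse z * (z * qsqrt q * inverse z) = z * q * inverse z"
    by (simp only: qsqrt_square[OF assms(2)])
qed (use assms in \<open>simp add: qRe_conjugate qRe_qsqrt_pos\<close>)

lemma slit_quat_inverse:
  assumes "slit_quat q"
  shows "slit_quat (inverse q)"
proof -
  have "norm (inverse q) + qRe (inverse q) = (norm q + qRe q) / (norm q)\<^sup>2"
    by (cases "q = 0")
       (simp_all only: norm_inverse qRe_inverse, simp_all add: field_simps power2_eq_square)
  with assms show ?thesis
    by (auto simp: slit_quat_iff intro!: divide_pos_pos)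
qed

lemma qsqrt_inverse:
  assumes "slit_quat q"
  shows "qsqrt (inverse q) = inverse (qsqrt q)"
  using assms qsqrt_square[OF assms] qRe_qsqrt_pos[OF assms] qsqrt_nonzero[OF assms]
  by (intro qsqrt_eqI) (auto simp: qRe_inverse simp flip: nonzero_inverse_mult_distrib)

text \<open>
  Conjugation by \<open>z\<close> fixes \<open>q\<close>, hence also its principal root.
\<close>
lemma qsqrt_commute:
  assumes "slit_quat q" "z * q = q * z"
  shows "z * qsqrt q = qsqrt q * z"
proof (cases "z = 0")
  case False
  then have "z * q * inverse z = q"
    using assms(2) by (simp add: mult.assoc)
  then have "z * qsqrt q * inverse z = qsqrt q"
    using qsqrt_conjugate[OF False assms(1)] by simp
  then have "z * qsqrt q * inverse z * z = qsqrt q * z"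
    by simp
  with False show ?thesis
    by (simp add: mult.assoc)
qed simp

text \<open>
  The geometric mean of two noncommuting quantities. For imaginary \<open>x\<close> and \<open>z\<close> it is the
  vector that bisects the angle between \<open>x\<close> and \<open>z\<close> and has length \<open>sqrt (|x| |z|)\<close>.
\<close>
definition gmean :: "quat \<Rightarrow> quat \<Rightarrow> quat" where
  "gmean x z = x * qsqrt (inverse x * z)"

lemma gmean_left:
  assumes "x \<noteq> 0" "slit_quat (inverse x * z)"
  shows "gmean x z = qsqrt (z * inverse x) * x"
  using qsqrt_conjugate[OF assms] assms(1) by (simp add: gmean_def mult.assoc flip: mult.assoc[of x "inverse x"])

text \<open>
  \<open>z (z\<^sup>-\<^sup>1 x)\<^sup>1\<^sup>/\<^sup>2 = z r\<^sup>-\<^sup>1 = x r r r\<^sup>-\<^sup>1 = x r\<close> for \<open>r = (x\<^sup>-\<^sup>1 z)\<^sup>1\<^sup>/\<^sup>2\<close>.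
\<close>
lemma gmean_commute:
  assumes "x \<noteq> 0" "slit_quat (inverse x * z)"
  shows "gmean z x = gmean x z"
proof -
  have z: "z \<noteq> 0"
    using assms by (auto simp: slit_quat_def)
  define r where "r = qsqrt (inverse x * z)"
  have "inverse z * x = inverse (inverse x * z)"
    using assms z by (simp add: nonzero_inverse_mult_distrib)
  then have "gmean z x = z * inverse r"
    using assms by (simp add: gmean_def qsqrt_inverse r_def)
  moreover have "z = x * r * r"
    using assms qsqrt_square[OF assms(2)]
    by (simp add: r_def mult.assoc flip: mult.assoc[of x "inverse x"])
  then have "z * inverse r = x * r * (r * inverse r)"
    by (metis mult.assoc)
  then have "z * inverse r = x * r"
    using qsqrt_nonzero[OF assms(2)] by (simp add: r_def)
  ultimately show ?thesis
    using z by (simp add: gmean_def r_def)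
qed

lemma gmean_nonzero: "x \<noteq> 0 \<Longrightarrow> slit_quat (inverse x * z) \<Longrightarrow> gmean x z \<noteq> 0"
  by (simp add: gmean_def qsqrt_nonzero)

lemma gmean_scaleR:
  assumes "t \<noteq> 0"
  shows "gmean (t *\<^sub>R x) (t *\<^sub>R z) = t *\<^sub>R gmean x z"
proof (cases "x = 0")
  case False
  then have "inverse (t *\<^sub>R x) * (t *\<^sub>R z) = inverse x * z"
    using assms by (simp add: nonzero_inverse_scaleR_distrib)
  then show ?thesis
    by (simp add: gmean_def)
qed (simp add: gmean_def)

lemma gmean_minus: "gmean (- x) (- z) = - gmean x z"
  using gmean_scaleR[of "- 1" x z] by simp

text \<open>
  With \<open>q = x\<^sup>-\<^sup>1 z\<close> the root is a real combination of \<open>q\<close> and \<open>1\<close>, so the mean is a real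
  combination of \<open>z\<close> and \<open>x\<close>. This is why the points \<open>f(a, b, c, d)\<close> lie in space.
\<close>
lemma qRe_gmean:
  assumes "x \<noteq> 0" "slit_quat (inverse x * z)" "qRe x = 0" "qRe z = 0"
  shows "qRe (gmean x z) = 0"
proof -
  define q where "q = inverse x * z"
  define r where "r = qsqrt q"
  have r: "r * r = q" "qRe r > 0"
    using assms by (simp_all add: r_def q_def qsqrt_square qRe_qsqrt_pos)
  have "(2 * qRe r) *\<^sub>R gmean x z = x * ((2 * qRe r) *\<^sub>R r)"
    by (simp add: gmean_def r_def q_def)
  also have "(2 * qRe r) *\<^sub>R r = q + (norm r)\<^sup>2 *\<^sub>R 1"
    using quat_square[of r] r by simp
  also have "x * \<dots> = z + (norm r)\<^sup>2 *\<^sub>R x"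
    using assms(1) by (simp add: q_def distrib_left flip: mult.assoc)
  finally have "qRe ((2 * qRe r) *\<^sub>R gmean x z) = qRe (z + (norm r)\<^sup>2 *\<^sub>R x)"
    by simp
  then show ?thesis
    using assms r by simp
qed

lemma eventually_slit_quat:
  assumes "(f \<longlongrightarrow> of_real c) F" "c > 0"
  shows "\<forall>\<^sub>F x in F. slit_quat (f x)"
proof -
  have "((\<lambda>x. qRe (f x)) \<longlongrightarrow> qRe (of_real c)) F"
    by (rule bounded_linear.tendsto[OF bounded_linear_qRe assms(1)])
  then have "\<forall>\<^sub>F x in F. qRe (f x) > 0"
    using assms(2) by (intro order_tendstoD) auto
  then show ?thesis
    by eventually_elim (simp add: slit_quat_iff add_nonneg_pos)
qed

text \<open>
  The factorisation \<open>q - c = (r - sqrt c) (r + sqrt c)\<close>, where \<open>r\<close> is the root of \<open>q\<close>. The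
  second factor stays away from zero, so differences of roots inherit the size and the
  expansion of \<open>q - c\<close>, without differentiating the root.
\<close>
lemma qsqrt_minus_sqrt:
  assumes "slit_quat q" "c > 0"
  shows "qsqrt q - of_real (sqrt c) = (q - of_real c) * inverse (qsqrt q + of_real (sqrt c))"
proof -
  have ne: "qsqrt q + of_real (sqrt c) \<noteq> 0"
  proof
    assume "qsqrt q + of_real (sqrt c) = 0"
    then have "qRe (qsqrt q + of_real (sqrt c)) = 0"
      by simp
    then show False
      using add_pos_pos[OF qRe_qsqrt_pos[OF assms(1)], of "sqrt c"] assms(2) by simp
  qed
  have "of_real c = of_real (sqrt c) * (of_real (sqrt c) :: quat)"
    using assms(2) by (simp flip: of_real_mult)
  then have "q - of_real c = (qsqrt q - of_real (sqrt c)) * (qsqrt q + of_real (sqrt c))"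
    using qsqrt_square[OF assms(1)] by (simp add: algebra_simps of_real_def)
  then show ?thesis
    using ne by (simp add: mult.assoc)
qed

lemma tendsto_qsqrt:
  assumes "(f \<longlongrightarrow> of_real c) F" "c > 0"
  shows "((\<lambda>x. qsqrt (f x)) \<longlongrightarrow> of_real (sqrt c)) F"
proof -
  have "((\<lambda>x. norm (f x - of_real c) / sqrt c) \<longlongrightarrow> 0 / sqrt c) F"
    using assms(2) by (intro tendsto_intros tendsto_norm_zero) (use assms(1) in \<open>auto simp: LIM_zero_iff\<close>)
  moreover have "\<forall>\<^sub>F x in F. norm (qsqrt (f x) - of_real (sqrt c)) \<le> norm (f x - of_real c) / sqrt c"
    using eventually_slit_quat[OF assms]
  proof eventually_elim
    case (elim x)
    have "sqrt c \<le> qRe (qsqrt (f x) + of_real (sqrt c))"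
      using qRe_qsqrt_pos[OF elim] by simp
    also have "\<dots> \<le> norm (qsqrt (f x) + of_real (sqrt c))"
      unfolding norm_quat_def by (rule real_le_rsqrt) simp
    finally show ?case
      unfolding qsqrt_minus_sqrt[OF elim assms(2)] norm_mult norm_inverse
      using assms(2) by (auto simp: divide_inverse intro!: mult_left_mono le_imp_inverse_le)
  qed
  ultimately have "((\<lambda>x. qsqrt (f x) - of_real (sqrt c)) \<longlongrightarrow> 0) F"
    using Lim_null_comparison by fastforce
  then show ?thesis
    by (simp add: LIM_zero_iff)
qed

lemma expandable_qsqrt:
  assumes "(f \<longlongrightarrow> of_real c) (at 0)" "c > 0"
  shows "expandable n f \<Longrightarrow> expandable n (\<lambda>\<epsilon>. qsqrt (f \<epsilon>))"
proof (induction n)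
  case 0
  show ?case
    using tendsto_imp_Bfun[OF tendsto_qsqrt[OF assms]] by simp
next
  case (Suc n)
  obtain k where k: "expandable n k" "\<forall>\<^sub>F \<epsilon> in at 0. f \<epsilon> = of_real c + \<epsilon> *\<^sub>R k \<epsilon>"
    using Suc.prems assms(1) by (rule expandable_Suc_limitE)
  let ?h = "\<lambda>\<epsilon>. k \<epsilon> * inverse (qsqrt (f \<epsilon>) + of_real (sqrt c))"
  have "expandable n ?h"
  proof (intro expandable_mult expandable_inverse expandable_add)
    show "((\<lambda>\<epsilon>. qsqrt (f \<epsilon>) + of_real (sqrt c)) \<longlongrightarrow> of_real (sqrt c) + of_real (sqrt c)) (at 0)"
      by (intro tendsto_intros tendsto_qsqrt assms)
    show "of_real (sqrt c) + of_real (sqrt c) \<noteq> (0 :: quat)"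
      using assms(2) by (simp flip: of_real_add)
  qed (use k Suc expandable_SucD in auto)
  moreover have "\<forall>\<^sub>F \<epsilon> in at 0. qsqrt (f \<epsilon>) = of_real (sqrt c) + \<epsilon> *\<^sub>R ?h \<epsilon>"
    using eventually_slit_quat[OF assms] k(2)
  proof eventually_elim
    case (elim \<epsilon>)
    have "f \<epsilon> - of_real c = \<epsilon> *\<^sub>R k \<epsilon>"
      using elim(2) by simp
    then show ?case
      using qsqrt_minus_sqrt[OF elim(1) assms(2)] by (simp add: algebra_simps)
  qed
  ultimately show ?case
    by (rule expandable_SucI)
qed

section \<open>The points f(a,b,c,d) after an inversion\<close>

lemma inverse_diff_right:
  fixes x y :: "'a::division_ring"
  assumes "x \<noteq> 0" "y \<noteq> 0"
  shows "inverse x - inverse y = inverse y * (y - x) * inverse x"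
  using assms by (simp add: right_diff_distrib left_diff_distrib mult.assoc)

lemma inverse_diff_left:
  fixes x y :: "'a::division_ring"
  assumes "x \<noteq> 0" "y \<noteq> 0"
  shows "inverse x - inverse y = inverse x * (y - x) * inverse y"
  using assms by (simp add: right_diff_distrib left_diff_distrib mult.assoc)

lemma mult_inverse_cancel_left:
  fixes x y :: "'a::division_ring"
  assumes "x \<noteq> 0"
  shows "x * (inverse x * y) = y" "inverse x * (x * y) = y"
  using assms by (simp_all flip: mult.assoc)

text \<open>
  Up to a reflection, inversion in the unit sphere around \<open>c\<close>: for imaginary \<open>v\<close> the
  quaternion inverse is \<open>- v / |v|\<^sup>2\<close>.
\<close>
abbreviation inv_at :: "real^3 \<Rightarrow> real^3 \<Rightarrow> quat" where
  "inv_at c x \<equiv> inverse (im_quat x - im_quat c)"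

text \<open>
  Inversion at \<open>c\<close> sends \<open>c\<close> to infinity, and the cross-ratio loses the factors that contain
  it. The three versions differ in the slot that holds the centre. If the first slot holds
  it, the conjugating factors cancel as well.
\<close>
lemma cross_ratio_inversion_first:
  assumes "distinct [a, b, c, d]"
  shows "cross_ratio c a b d = inverse (inv_at c a - inv_at c b) * (inv_at c d - inv_at c b)"
proof -
  have ne: "im_quat a - im_quat c \<noteq> 0" "im_quat b - im_quat c \<noteq> 0" "im_quat d - im_quat c \<noteq> 0"
    "im_quat b - im_quat a \<noteq> 0" "im_quat b - im_quat d \<noteq> 0"
    using assms by auto
  have 1: "inverse (inv_at c a - inv_at c b) =
      (im_quat a - im_quat c) * inverse (im_quat b - im_quat a) * (im_quat b - im_quat c)"
    unfolding inverse_diff_right[OF ne(1,2)]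
    using ne by (simp add: nonzero_inverse_mult_distrib mult.assoc)
  have 2: "inv_at c d - inv_at c b =
      inverse (im_quat b - im_quat c) * (im_quat b - im_quat d) * inverse (im_quat d - im_quat c)"
    using inverse_diff_right[OF ne(3,2)] by simp
  have 3: "im_quat c - im_quat a = - (im_quat a - im_quat c)"
    "inverse (im_quat a - im_quat b) = - inverse (im_quat b - im_quat a)"
    by (simp_all flip: inverse_minus_eq)
  show ?thesis
    unfolding cross_ratio_def 1 2 3 using ne
    by (simp add: mult.assoc mult_inverse_cancel_left del: minus_diff_eq)
qed

text \<open>
  With \<open>\<alpha> = A - B\<close> and \<open>\<delta> = D - B\<close> the middle factor is \<open>(1 - \<delta> \<alpha>\<^sup>-\<^sup>1)\<^sup>-\<^sup>1\<close>. For equally spaced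
  points on a line \<open>\<delta> = 4 \<alpha>\<close>, and the cross-ratio is \<open>- 1 / 3\<close>.
\<close>
lemma cross_ratio_inversion_third:
  fixes a b c d
  defines "A \<equiv> inv_at c a" and "B \<equiv> inv_at c b" and "D \<equiv> inv_at c d"
  assumes "distinct [a, b, c, d]"
  shows "cross_ratio a b c d = inverse A * inverse (1 - (D - B) * inverse (A - B)) * A"
proof -
  have ne: "A \<noteq> 0" "B \<noteq> 0" "D \<noteq> 0" "A - B \<noteq> 0" "A - D \<noteq> 0"
    using assms by auto
  have i: "inverse A = im_quat a - im_quat c" "inverse B = im_quat b - im_quat c"
    "inverse D = im_quat d - im_quat c"
    by (simp_all add: A_def B_def D_def)
  have ab: "im_quat a - im_quat b = inverse A * (B - A) * inverse B"
    using inverse_diff_left[OF ne(1,2)] by (simp add: i)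
  have da: "im_quat d - im_quat a = inverse A * (A - D) * inverse D"
    using inverse_diff_right[OF ne(3,1)] by (simp add: i)
  have bc: "inverse (im_quat b - im_quat c) = B" and cd: "im_quat c - im_quat d = - inverse D"
    by (simp_all add: B_def i)
  have "1 - (D - B) * inverse (A - B) = (A - D) * inverse (A - B)"
  proof -
    have "(A - B) * inverse (A - B) - (D - B) * inverse (A - B) = (A - D) * inverse (A - B)"
      unfolding left_diff_distrib[symmetric] by simp
    then show ?thesis
      using ne by simp
  qed
  then have r: "inverse (1 - (D - B) * inverse (A - B)) = (A - B) * inverse (A - D)"
    using ne by (simp add: nonzero_inverse_mult_distrib)
  have m: "B - A = - (A - B)"
    by simp
  show ?thesis
    unfolding cross_ratio_def ab da bc cd r m using ne
    by (simp add: nonzero_inverse_mult_distrib mult.assoc mult_inverse_cancel_left del: minus_diff_eq)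
qed

text \<open>
  With \<open>q\<close> the factor in the definition of \<open>f\<close>, one has \<open>q = - B\<^sup>-\<^sup>1 g\<close>. The defining equation
  \<open>q (p - c) = b - p\<close> then reads \<open>(q + 1) (p - c) = b - c\<close>, so \<open>p - c = (B - g)\<^sup>-\<^sup>1\<close>. Relative
  to the image of \<open>b\<close>, the image of \<open>p\<close> is minus the geometric mean of the images of \<open>a\<close> and
  \<open>d\<close>.
\<close>
lemma f_point_inversion_at_third:
  fixes a b c d
  defines "A \<equiv> inv_at c a" and "B \<equiv> inv_at c b" and "D \<equiv> inv_at c d"
  assumes "distinct [a, b, c, d]"
  shows "f_point a b c d = (let g = gmean (A - B) (D - B)
    in if B = g then None else Some (qIm (im_quat c + inverse (B - g))))"
proof -
  have ne: "im_quat a - im_quat c \<noteq> 0" "im_quat b - im_quat c \<noteq> 0"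
    using assms(4) by auto
  then have "B \<noteq> 0" by (simp add: B_def)
  define g where "g = gmean (A - B) (D - B)"
  define q where "q = (im_quat b - im_quat a) * inverse (im_quat c - im_quat a) *
              qsqrt (cross_ratio c a b d)"
  have "inverse (im_quat c - im_quat a) = - A"
    unfolding A_def by (simp flip: inverse_minus_eq)
  moreover have "A - B = B * (im_quat b - im_quat a) * A"
    unfolding A_def B_def inverse_diff_right[OF ne] by simp
  then have "(im_quat b - im_quat a) * A = inverse B * (A - B)"
    using \<open>B \<noteq> 0\<close> by (simp add: mult.assoc mult_inverse_cancel_left)
  ultimately have q: "q = - (inverse B * g)"
    unfolding q_def g_def gmean_def cross_ratio_inversion_first[OF assms(4)]
      A_def[symmetric] B_def[symmetric] D_def[symmetric]
    by (simp add: mult.assoc)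
  then have q1: "q + 1 = inverse B * (B - g)"
    using \<open>B \<noteq> 0\<close> by (simp add: right_diff_distrib)
  have "inverse (q + 1) * (q * im_quat c + im_quat b) = im_quat c + inverse (B - g)" if "B \<noteq> g"
  proof -
    have "q * im_quat c + im_quat b = (q + 1) * im_quat c + (im_quat b - im_quat c)"
      by (simp add: distrib_right)
    also have "im_quat b - im_quat c = inverse B"
      by (simp add: B_def)
    finally have "inverse (q + 1) * (q * im_quat c + im_quat b) =
        inverse (q + 1) * ((q + 1) * im_quat c) + inverse (q + 1) * inverse B"
      by (simp only: distrib_left)
    also have "inverse (q + 1) * inverse B = inverse (B - g)"
      using that \<open>B \<noteq> 0\<close> by (simp add: q1 nonzero_inverse_mult_distrib mult.assoc)
    finally show ?thesis
      using that \<open>B \<noteq> 0\<close> by (simp add: q1 mult_inverse_cancel_left)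
  qed
  then show ?thesis
    using q1 \<open>B \<noteq> 0\<close> by (simp add: f_point_def Let_def flip: q_def g_def)
qed

lemma cross_ratio_inversion_second:
  fixes c x y z
  defines "X \<equiv> inv_at c x" and "Y \<equiv> inv_at c y" and "Z \<equiv> inv_at c z"
  assumes "distinct [c, x, y, z]"
  shows "cross_ratio y c x z = inverse Y * ((X - Z) * inverse (Y - Z)) * Y"
proof -
  have ne: "im_quat x - im_quat c \<noteq> 0" "im_quat y - im_quat c \<noteq> 0" "im_quat z - im_quat c \<noteq> 0"
    "im_quat z - im_quat y \<noteq> 0"
    using assms(4) by auto
  have 1: "inverse (Y - Z) =
      (im_quat z - im_quat c) * inverse (im_quat z - im_quat y) * (im_quat y - im_quat c)"
    unfolding Y_def Z_def inverse_diff_left[OF ne(2,3)]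
    using ne by (simp add: nonzero_inverse_mult_distrib mult.assoc)
  have 2: "X - Z = inverse (im_quat x - im_quat c) * (im_quat z - im_quat x) * inverse (im_quat z - im_quat c)"
    unfolding X_def Z_def using inverse_diff_left[OF ne(1,3)] by simp
  have 3: "im_quat x - im_quat z = - (im_quat z - im_quat x)"
    "inverse (im_quat c - im_quat x) = - inverse (im_quat x - im_quat c)"
    by (simp_all flip: inverse_minus_eq)
  show ?thesis
    unfolding cross_ratio_def 1 2 3 using ne
    by (simp add: Y_def mult.assoc mult_inverse_cancel_left del: minus_diff_eq)
qed

text \<open>
  Now the centre is the first argument of \<open>f\<close>, and the positive sign of the mean appears.
  For \<open>\<theta>\<close> the root of \<open>(X - Z) (Y - Z)\<^sup>-\<^sup>1\<close>, the image \<open>P\<close> satisfies \<open>P - X = - \<theta> (P - Y)\<close>.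
  Since \<open>X - Z = \<theta>\<^sup>2 (Y - Z)\<close>, this is solved by \<open>P - Z = \<theta> (Y - Z)\<close>.
\<close>
lemma f_point_inversion_at_first:
  fixes c x y z
  defines "X \<equiv> inv_at c x" and "Y \<equiv> inv_at c y" and "Z \<equiv> inv_at c z"
  assumes "distinct [c, x, y, z]" "slit_quat (inverse (Y - Z) * (X - Z))"
  shows "f_point c x y z = (let g = gmean (Y - Z) (X - Z)
    in if Z + g = 0 then None else Some (qIm (im_quat c + inverse (Z + g))))"
proof -
  have ne: "im_quat x - im_quat c \<noteq> 0" "im_quat y - im_quat c \<noteq> 0" "im_quat z - im_quat c \<noteq> 0"
    using assms(4) by auto
  then have XYZ: "X \<noteq> 0" "Y \<noteq> 0" "Z \<noteq> 0" by (simp_all add: X_def Y_def Z_def)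
  have yz: "Y - Z \<noteq> 0"
    using assms(4) by (auto simp: Y_def Z_def)
  have slit: "slit_quat ((X - Z) * inverse (Y - Z))"
    using slit_quat_conjugate[OF yz assms(5)] yz by (simp add: mult_inverse_cancel_left flip: mult.assoc[of "Y - Z"])
  define \<theta> where "\<theta> = qsqrt ((X - Z) * inverse (Y - Z))"
  define g where "g = gmean (Y - Z) (X - Z)"
  have g: "g = \<theta> * (Y - Z)"
    unfolding g_def \<theta>_def by (rule gmean_left[OF yz assms(5)])
  have \<theta>1: "\<theta> + 1 \<noteq> 0"
    using qRe_qsqrt_pos[OF slit] unfolding \<theta>_def[symmetric]
    by (auto simp: quat_eq_iff)
  define q where "q = (im_quat x - im_quat c) * inverse (im_quat y - im_quat c) *
              qsqrt (cross_ratio y c x z)"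
  have "qsqrt (cross_ratio y c x z) = inverse Y * \<theta> * Y"
    using qsqrt_conjugate[of "inverse Y", OF _ slit] XYZ
    unfolding cross_ratio_inversion_second[OF assms(4)] X_def[symmetric] Y_def[symmetric] Z_def[symmetric]
    by (simp add: \<theta>_def)
  then have q: "q = inverse X * \<theta> * Y"
    unfolding q_def Y_def[symmetric] using XYZ
    by (simp add: X_def mult.assoc mult_inverse_cancel_left)
  have "\<theta> * \<theta> * (Y - Z) = X - Z"
    using qsqrt_square[OF slit] yz by (simp add: \<theta>_def mult.assoc)
  then have "(\<theta> + 1) * (Z + g) = \<theta> * Y + X"
    unfolding g by (simp add: algebra_simps)
  then have q1: "q + 1 = inverse X * ((\<theta> + 1) * (Z + g))"
    unfolding q using XYZ by (simp add: algebra_simps)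
  have "inverse (q + 1) * (q * im_quat y + im_quat x) = im_quat c + inverse (Z + g)" if "Z + g \<noteq> 0"
  proof -
    have "q * im_quat y + im_quat x =
        (q + 1) * im_quat c + (q * (im_quat y - im_quat c) + (im_quat x - im_quat c))"
      by (simp add: algebra_simps)
    also have "q * (im_quat y - im_quat c) + (im_quat x - im_quat c) = inverse X * (\<theta> + 1)"
      unfolding q Y_def X_def using ne
      by (simp add: mult.assoc distrib_left)
    finally have "inverse (q + 1) * (q * im_quat y + im_quat x) =
        inverse (q + 1) * ((q + 1) * im_quat c) + inverse (q + 1) * (inverse X * (\<theta> + 1))"
      by (simp only: distrib_left)
    also have "inverse (q + 1) * (inverse X * (\<theta> + 1)) = inverse (Z + g)"
      using that XYZ \<theta>1 by (simp add: q1 nonzero_inverse_mult_distrib mult.assoc mult_inverse_cancel_left)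
    finally show ?thesis
      using that XYZ \<theta>1 by (simp add: q1 mult_inverse_cancel_left)
  qed
  then show ?thesis
    using q1 XYZ \<theta>1 by (simp add: f_point_def Let_def flip: q_def g_def)
qed

lemma f_point_dom_iff:
  "f_point_dom a b c d \<longleftrightarrow> distinct [a, b, c, d] \<and> slit_quat (cross_ratio c a b d)"
  by (auto simp: f_point_dom_def slit_quat_def cross_ratio_def)

text \<open>
  Symmetry of the geometric mean, seen after inversion at \<open>c\<close>.
\<close>
lemma f_point_swap_outer:
  assumes "f_point_dom a b c d"
  shows "f_point_dom d b c a" "f_point d b c a = f_point a b c d"
proof -
  have d: "distinct [a, b, c, d]" "distinct [d, b, c, a]"
    and slit: "slit_quat (inverse (inv_at c a - inv_at c b) * (inv_at c d - inv_at c b))"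
    using assms by (auto simp: f_point_dom_iff simp flip: cross_ratio_inversion_first)
  have ne: "inv_at c a - inv_at c b \<noteq> 0" "inv_at c d - inv_at c b \<noteq> 0"
    using d by auto
  have "inverse (inv_at c d - inv_at c b) * (inv_at c a - inv_at c b) =
      inverse (inverse (inv_at c a - inv_at c b) * (inv_at c d - inv_at c b))"
    using ne by (simp add: nonzero_inverse_mult_distrib)
  then show "f_point_dom d b c a"
    using slit_quat_inverse[OF slit] d by (simp add: f_point_dom_iff cross_ratio_inversion_first)
  show "f_point d b c a = f_point a b c d"
    unfolding f_point_inversion_at_third[OF d(1)] f_point_inversion_at_third[OF d(2)]
      gmean_commute[OF ne(1) slit] ..
qed

text \<open>
  Exchanging \<open>b\<close> and \<open>c\<close> replaces the factor \<open>q\<close> in the definition by its inverse. The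
  equation \<open>q (p - c) = b - p\<close> becomes \<open>q\<^sup>-\<^sup>1 (p - b) = c - p\<close>, which has the same solution.
\<close>
lemma f_point_swap_inner:
  assumes "f_point_dom a b c d"
  shows "f_point_dom a c b d" "f_point a c b d = f_point a b c d"
proof -
  have d: "distinct [a, b, c, d]" "distinct [a, c, b, d]" and slit: "slit_quat (cross_ratio c a b d)"
    using assms by (auto simp: f_point_dom_iff)
  have ne: "im_quat b - im_quat a \<noteq> 0" "im_quat c - im_quat a \<noteq> 0" "im_quat b - im_quat d \<noteq> 0"
    "im_quat c - im_quat d \<noteq> 0"
    using d by auto
  define x where "x = (im_quat b - im_quat a) * inverse (im_quat c - im_quat a)"
  define z where "z = (im_quat b - im_quat d) * inverse (im_quat c - im_quat d)"
  have x0: "x \<noteq> 0" "z \<noteq> 0"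
    using ne by (simp_all add: x_def z_def)
  have s: "im_quat c - im_quat a = - (im_quat a - im_quat c)"
    "inverse (im_quat b - im_quat a) = - inverse (im_quat a - im_quat b)"
    "inverse (im_quat c - im_quat a) = - inverse (im_quat a - im_quat c)"
    "im_quat b - im_quat d = - (im_quat d - im_quat b)"
    "inverse (im_quat b - im_quat d) = - inverse (im_quat d - im_quat b)"
    "inverse (im_quat c - im_quat d) = - inverse (im_quat d - im_quat c)"
    "im_quat c - im_quat d = - (im_quat d - im_quat c)"
    by (simp_all flip: inverse_minus_eq)
  have ix: "inverse x = (im_quat c - im_quat a) * inverse (im_quat b - im_quat a)"
    and iz: "inverse z = (im_quat c - im_quat d) * inverse (im_quat b - im_quat d)"
    using ne by (simp_all add: x_def z_def nonzero_inverse_mult_distrib)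
  have cr: "cross_ratio c a b d = inverse x * z"
    unfolding ix z_def cross_ratio_def s(2,6) by (simp add: mult.assoc)
  have "cross_ratio b a c d = x * inverse z"
    unfolding iz x_def cross_ratio_def s(3,5,7) by (simp add: mult.assoc)
  also have "\<dots> = x * inverse (cross_ratio c a b d) * inverse x"
    unfolding cr using x0 by (simp add: nonzero_inverse_mult_distrib mult.assoc)
  finally have cr': "cross_ratio b a c d = x * inverse (cross_ratio c a b d) * inverse x" .
  show "f_point_dom a c b d"
    using d slit x0 by (simp add: f_point_dom_iff cr' slit_quat_conjugate slit_quat_inverse del: distinct.simps)
  define q where "q = x * qsqrt (cross_ratio c a b d)"
  have q0: "q \<noteq> 0"
    using x0 slit by (simp add: q_def qsqrt_nonzero)
  have "inverse x * qsqrt (cross_ratio b a c d) = inverse q"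
    unfolding cr' qsqrt_conjugate[OF x0(1) slit_quat_inverse[OF slit]] qsqrt_inverse[OF slit] q_def
    using x0 qsqrt_nonzero[OF slit] by (simp add: nonzero_inverse_mult_distrib mult.assoc mult_inverse_cancel_left)
  then have fc: "f_point a c b d = (if inverse q + 1 = 0 then None
      else Some (qIm (inverse (inverse q + 1) * (inverse q * im_quat b + im_quat c))))"
    by (simp add: f_point_def Let_def ix)
  have q1: "inverse q + 1 = inverse q * (q + 1)"
    using q0 by (simp add: distrib_left add.commute)
  have "inverse (inverse q + 1) * (inverse q * im_quat b + im_quat c) =
      inverse (q + 1) * (q * im_quat c + im_quat b)" if "q + 1 \<noteq> 0"
    unfolding q1 using that q0
    by (simp add: nonzero_inverse_mult_distrib mult.assoc distrib_left[of q] mult_inverse_cancel_left add.commute)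
  moreover have "inverse q + 1 = 0 \<longleftrightarrow> q + 1 = 0"
    unfolding q1 using q0 by simp
  ultimately show "f_point a c b d = f_point a b c d"
    unfolding fc by (simp add: f_point_def Let_def q_def x_def)
qed

section \<open>Circles and inversion\<close>

lemma orthogonal_to_cross_frame:
  fixes u v z :: "real^3"
  assumes "u \<times> v \<noteq> 0" "u \<bullet> z = 0" "v \<bullet> z = 0" "(u \<times> v) \<bullet> z = 0"
  shows "z = 0"
proof -
  have "(u \<times> v) \<times> z = (u \<bullet> z) *\<^sub>R v - (v \<bullet> z) *\<^sub>R u"
    by (simp add: cross3_simps forall_3)
  then have "(norm (u \<times> v) * norm z)\<^sup>2 = 0"
    using assms by (simp flip: norm_cross_dot)
  with assms(1) show ?thesis by simp
qed

text \<open>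
  Three points off a line span a unique plane, and inside it the equations \<open>u \<bullet> w = |u|\<^sup>2 /
  2\<close> and \<open>v \<bullet> w = |v|\<^sup>2 / 2\<close> say that \<open>p + w\<close> has the same distance from \<open>p\<close>, \<open>p + u\<close> and \<open>p
  + v\<close>. Any other centre differs from \<open>p + w\<close> by a vector orthogonal to \<open>u\<close>, \<open>v\<close> and \<open>u \<times>
  v\<close>.
\<close>
lemma circle_through_three_points:
  fixes p u v w :: "real^3"
  assumes indep: "u \<times> v \<noteq> 0"
    and w: "u \<bullet> w = (u \<bullet> u) / 2" "v \<bullet> w = (v \<bullet> v) / 2" "(u \<times> v) \<bullet> w = 0"
  defines "K0 \<equiv> sphere (p + w) (norm w) \<inter> {x. (u \<times> v) \<bullet> x = (u \<times> v) \<bullet> p}"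
  shows "is_circle (p + w) (norm w) K0" "{p, p + u, p + v} \<subseteq> K0"
    and "is_circle m r K \<Longrightarrow> {p, p + u, p + v} \<subseteq> K \<Longrightarrow> m = p + w \<and> r = norm w \<and> K = K0"
proof -
  define n where "n = u \<times> v"
  define H where "H = {x. n \<bullet> x = n \<bullet> p}"
  have n: "n \<bullet> u = 0" "n \<bullet> v = 0"
    by (simp_all add: n_def dot_cross_self)
  have H: "affine H" "aff_dim H = 2"
    using indep by (simp_all add: H_def n_def affine_hyperplane)
  have pH: "{p, p + u, p + v} \<subseteq> H"
    by (simp add: H_def inner_add_right n)
  have "\<not> collinear {p + u, p, p + v}"
    using indep by (simp add: collinear_3[of "p + u"] cross_eq_0)
  then have ind: "\<not> affine_dependent {p, p + u, p + v}" "p \<noteq> p + u" "p \<noteq> p + v" "p + u \<noteq> p + v"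
    by (auto simp: collinear_3_eq_affine_dependent insert_commute)
  then have dim: "aff_dim (affine hull {p, p + u, p + v}) = 2"
    using aff_dim_affine_independent[OF ind(1)] by simp
  have plane: "P = H" if "affine P" "aff_dim P = 2" "{p, p + u, p + v} \<subseteq> P" for P
  proof -
    have "affine hull {p, p + u, p + v} = P" if "affine P" "aff_dim P = 2" "{p, p + u, p + v} \<subseteq> P" for P
      using that dim by (intro affine_dim_equal) (simp_all add: hull_minimal)
    from this[OF that] this[OF H pH] show ?thesis by simp
  qed
  have "w \<noteq> 0"
    using w indep by auto
  then show "is_circle (p + w) (norm w) K0"
    unfolding is_circle_def using H w
    by (intro conjI exI[of _ H])
       (simp_all add: K0_def H_def inner_add_right flip: n_def)
  have dist: "dist (p + w) (p + x) = norm w \<longleftrightarrow> x \<bullet> w = (x \<bullet> x) / 2" for x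
    by (auto simp: dist_norm norm_eq inner_diff algebra_simps inner_commute)
  show "{p, p + u, p + v} \<subseteq> K0"
    using pH dist[of 0] dist[of u] dist[of v] w unfolding K0_def H_def n_def by auto
  assume K: "is_circle m r K" "{p, p + u, p + v} \<subseteq> K"
  then obtain P where P: "affine P" "aff_dim P = 2" "m \<in> P" "K = sphere m r \<inter> P"
    by (auto simp: is_circle_def)
  then have "P = H"
    using plane[of P] K(2) by auto
  define z where "z = m - p - w"
  have m: "m = p + (w + z)"
    by (simp add: z_def)
  have r: "dist m p = r" "dist m (p + u) = r" "dist m (p + v) = r"
    using K(2) P(4) by auto
  then have "norm (w + z - u) = norm (w + z)" "norm (w + z - v) = norm (w + z)"
    by (simp_all add: m dist_norm algebra_simps)
  then have "u \<bullet> z = 0" "v \<bullet> z = 0"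
    using w by (simp_all add: norm_eq inner_diff inner_add algebra_simps inner_commute)
  moreover have "n \<bullet> z = 0"
    using P(3) w unfolding \<open>P = H\<close> H_def n_def[symmetric] by (simp add: m inner_add_right)
  ultimately have "z = 0"
    using orthogonal_to_cross_frame indep unfolding n_def by blast
  with m r \<open>P = H\<close> P(4) show "m = p + w \<and> r = norm w \<and> K = K0"
    by (simp add: K0_def H_def n_def dist_norm)
qed

text \<open>
  The point nearest to the origin on the line through \<open>y\<close> with direction \<open>e\<close>.
\<close>
definition foot_point :: "real^3 \<Rightarrow> real^3 \<Rightarrow> real^3" where
  "foot_point y e = y - ((y \<bullet> e) / (e \<bullet> e)) *\<^sub>R e"

text \<open>
  The map \<open>v \<mapsto> - v / |v|\<^sup>2\<close> takes the line through \<open>y\<close> with direction \<open>e\<close> to a circle through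
  the origin. The foot \<open>n\<close> of the line goes to the point opposite to the origin, so the
  centre is half its image, \<open>- n / (2 |n|\<^sup>2)\<close>.
\<close>
definition centre_offset :: "real^3 \<Rightarrow> real^3 \<Rightarrow> real^3" where
  "centre_offset y e = - (1 / (2 * (foot_point y e \<bullet> foot_point y e))) *\<^sub>R foot_point y e"

lemma foot_point_scaleR: "t \<noteq> 0 \<Longrightarrow> foot_point y (t *\<^sub>R e) = foot_point y e"
  by (simp add: foot_point_def)

lemma centre_offset_scaleR: "t \<noteq> 0 \<Longrightarrow> centre_offset y (t *\<^sub>R e) = centre_offset y e"
  by (simp add: centre_offset_def foot_point_scaleR)

lemma centre_offset_inner:
  assumes "y \<times> e \<noteq> 0"
  shows "e \<bullet> centre_offset y e = 0" "y \<bullet> centre_offset y e = - 1 / 2"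
    "(y \<times> e) \<bullet> centre_offset y e = 0"
proof -
  let ?n = "foot_point y e"
  have "e \<noteq> 0"
    using assms by auto
  then have e: "e \<bullet> ?n = 0"
    by (simp add: foot_point_def inner_diff_right inner_commute)
  have "?n \<times> e = y \<times> e"
    by (simp add: foot_point_def Cross3.left_diff_distrib cross_mult_left)
  with assms have "?n \<noteq> 0"
    by auto
  have "y \<bullet> ?n = (?n + ((y \<bullet> e) / (e \<bullet> e)) *\<^sub>R e) \<bullet> ?n"
    by (simp add: foot_point_def)
  also have "\<dots> = ?n \<bullet> ?n"
    unfolding inner_add_left inner_scaleR_left e by simp
  finally have y: "y \<bullet> ?n = ?n \<bullet> ?n" .
  show "e \<bullet> centre_offset y e = 0"
    by (simp add: centre_offset_def e)
  show "y \<bullet> centre_offset y e = - 1 / 2"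
    using \<open>?n \<noteq> 0\<close> by (simp add: centre_offset_def y)
  have "(y \<times> e) \<bullet> ?n = 0"
    by (simp add: foot_point_def inner_diff_right dot_cross_self)
  then show "(y \<times> e) \<bullet> centre_offset y e = 0"
    by (simp add: centre_offset_def)
qed

lemma expandable_centre_offset:
  assumes "expandable n y" "expandable n e" "(y \<longlongrightarrow> y0) (at 0)" "(e \<longlongrightarrow> e0) (at 0)"
    and indep: "y0 \<times> e0 \<noteq> 0"
  shows "expandable n (\<lambda>\<epsilon>. centre_offset (y \<epsilon>) (e \<epsilon>))"
    and "((\<lambda>\<epsilon>. centre_offset (y \<epsilon>) (e \<epsilon>)) \<longlongrightarrow> centre_offset y0 e0) (at 0)"
proof -
  let ?f = "\<lambda>\<epsilon>. foot_point (y \<epsilon>) (e \<epsilon>)"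
  have e0: "e0 \<bullet> e0 \<noteq> 0"
    using indep by auto
  have "foot_point y0 e0 \<times> e0 = y0 \<times> e0"
    by (simp add: foot_point_def Cross3.left_diff_distrib cross_mult_left)
  then have f0: "foot_point y0 e0 \<bullet> foot_point y0 e0 \<noteq> 0"
    using indep by auto
  have f: "expandable n ?f"
    unfolding foot_point_def divide_inverse
    by (intro expandable_diff expandable_scaleR expandable_mult expandable_inner assms(1,2)
        expandable_inverse[OF tendsto_inner[OF assms(4,4)] e0])
  have fl: "(?f \<longlongrightarrow> foot_point y0 e0) (at 0)"
    unfolding foot_point_def by (intro tendsto_intros assms(3,4) e0)
  have eq: "centre_offset y e = (- (1 / 2) * inverse (foot_point y e \<bullet> foot_point y e)) *\<^sub>R foot_point y e"
    for y e
  proof -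
    have "- (1 / (2 * t)) = - (1 / 2) * inverse t" for t :: real
      by (cases "t = 0") (simp_all add: field_simps)
    then show ?thesis
      by (simp only: centre_offset_def)
  qed
  show "expandable n (\<lambda>\<epsilon>. centre_offset (y \<epsilon>) (e \<epsilon>))"
    unfolding eq
    by (intro expandable_scaleR expandable_mult f expandable_const
        expandable_inverse[OF tendsto_inner[OF fl fl] f0] expandable_inner)
  show "((\<lambda>\<epsilon>. centre_offset (y \<epsilon>) (e \<epsilon>)) \<longlongrightarrow> centre_offset y0 e0) (at 0)"
    unfolding eq by (intro tendsto_intros fl f0)
qed

text \<open>
  A point \<open>v\<close> lies on the sphere through the origin with centre \<open>w\<close> iff its quaternion
  inverse lies on the plane \<open>x \<bullet> w = - 1 / 2\<close>.
\<close>
lemma inner_inverse_im_quat: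
  assumes "v \<noteq> 0"
  shows "qIm (inverse (im_quat v)) \<bullet> w = - 1 / 2 \<longleftrightarrow> v \<bullet> w = (v \<bullet> v) / 2"
proof -
  have "qIm (inverse (im_quat v)) \<bullet> w = - ((v \<bullet> w) / (v \<bullet> v))"
    by (simp add: qIm_inverse power2_norm_eq_inner divide_inverse)
  then show ?thesis
    using assms by (simp only:) (auto simp: field_simps)
qed

text \<open>
  Inversion at \<open>p\<close> turns the concyclicity of four points into the collinearity of three.
  Here collinearity is given in the form that one image is the midpoint of the other two,
  that is, the four points are in harmonic position.
\<close>
lemma circle_from_inverse_points:
  fixes p v1 v2 v3 :: "real^3"
  defines "y1 \<equiv> qIm (inverse (im_quat v1))" and "y2 \<equiv> qIm (inverse (im_quat v2))"
    and "y3 \<equiv> qIm (inverse (im_quat v3))"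
  assumes nz: "v1 \<noteq> 0" "v2 \<noteq> 0" "v3 \<noteq> 0"
    and harmonic: "y1 + y2 = 2 *\<^sub>R y3" and indep: "y3 \<times> (y1 - y2) \<noteq> 0"
  defines "w \<equiv> centre_offset y3 (y1 - y2)"
  obtains K where "is_circle (p + w) (norm w) K" "{p, p + v1, p + v2, p + v3} \<subseteq> K"
    "\<And>m r K'. is_circle m r K' \<Longrightarrow> {p, p + v1, p + v2, p + v3} \<subseteq> K' \<Longrightarrow>
      m = p + w \<and> r = norm w \<and> K' = K"
proof -
  note c = centre_offset_inner[OF indep, folded w_def]
  define e where "e = y1 - y2"
  have y12: "y1 = y3 + (1/2) *\<^sub>R e" "y2 = y3 - (1/2) *\<^sub>R e"
    using harmonic unfolding e_def
    by (simp_all add: algebra_simps vec_eq_iff forall_3) 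
  have w1: "y1 \<bullet> w = - 1 / 2" and w2: "y2 \<bullet> w = - 1 / 2"
    using c(1,2) unfolding e_def[symmetric] y12 by (simp_all add: inner_add_left inner_diff_left)
  have v: "v1 \<bullet> w = (v1 \<bullet> v1) / 2" "v2 \<bullet> w = (v2 \<bullet> v2) / 2" "v3 \<bullet> w = (v3 \<bullet> v3) / 2"
    using inner_inverse_im_quat[OF nz(1)] inner_inverse_im_quat[OF nz(2)]
      inner_inverse_im_quat[OF nz(3)] w1 w2 c(2)
    unfolding y1_def y2_def y3_def by blast+
  define k where "k v = - inverse ((norm v)\<^sup>2)" for v :: "real^3"
  have k: "k v \<noteq> 0" "qIm (inverse (im_quat v)) = k v *\<^sub>R v" if "v \<noteq> 0" for v
    using that by (simp_all add: k_def qIm_inverse)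
  have "y1 \<times> y2 = - (y3 \<times> e)"
    unfolding y12 by (simp add: cross_add_left cross_mult_left cross_mult_right
        Cross3.left_diff_distrib Cross3.right_diff_distrib cross_skew[of e y3] flip: scaleR_add_left)
  then have cross: "(k v1 * k v2) *\<^sub>R (v1 \<times> v2) = - (y3 \<times> e)"
    using k(2) nz by (simp add: y1_def y2_def cross_mult_left cross_mult_right mult.commute)
  have "y3 \<times> e \<noteq> 0"
    using indep by (simp add: e_def)
  then have ind: "v1 \<times> v2 \<noteq> 0"
    using cross by auto
  have kk: "k v1 * k v2 \<noteq> 0"
    using k(1) nz by simp
  have "(k v1 * k v2) * ((v1 \<times> v2) \<bullet> w) = 0"
    using c(3) arg_cong[OF cross, of "\<lambda>x. x \<bullet> w"] by (simp add: e_def)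
  then have n: "(v1 \<times> v2) \<bullet> w = 0"
    using kk by simp
  have "(k v1 * k v2) * ((v1 \<times> v2) \<bullet> v3) = 0"
    using arg_cong[OF cross, of "\<lambda>x. x \<bullet> v3"] k[OF nz(3)]
    by (simp add: y3_def cross_mult_left dot_cross_self)
  then have n3: "(v1 \<times> v2) \<bullet> v3 = 0"
    using kk by simp
  let ?K = "sphere (p + w) (norm w) \<inter> {x. (v1 \<times> v2) \<bullet> x = (v1 \<times> v2) \<bullet> p}"
  note C = circle_through_three_points[OF ind v(1,2) n, where p = p]
  have "norm (w - v3) = norm w"
    using v(3) by (simp add: norm_eq inner_diff algebra_simps inner_commute)
  then have "p + v3 \<in> ?K"
    using n3 by (simp add: dist_norm inner_add_right)
  then have "{p, p + v1, p + v2, p + v3} \<subseteq> ?K"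
    using C(2) by blast
  then show thesis
  proof (rule that[OF C(1)])
    fix m r K'
    assume "is_circle m r K'" "{p, p + v1, p + v2, p + v3} \<subseteq> K'"
    then show "m = p + w \<and> r = norm w \<and> K' = ?K"
      by (intro C(3)) simp_all
  qed
qed

lemma is_circle_unique:
  assumes "is_circle m r K" "S \<subseteq> K"
    and "\<And>m' r' K'. is_circle m' r' K' \<Longrightarrow> S \<subseteq> K' \<Longrightarrow> m' = m \<and> r' = r \<and> K' = K"
  shows "circle_center K = m" "circle_radius K = r"
  unfolding circle_center_def circle_radius_def
  by (rule the_equality; use assms in metis)+

section \<open>The discrete curvature circle at an edge\<close>

text \<open>
  Everything here is \<open>\<alpha>\<close> multiplied from the left by an element of one commutative algebra.
  With \<open>\<sigma>\<^sup>2 = \<delta> \<alpha>\<^sup>-\<^sup>1\<close> and \<open>\<rho>\<^sup>2 = 1 - \<sigma>\<^sup>-\<^sup>2\<close> one has \<open>g = \<sigma> \<alpha>\<close>, \<open>\<delta> = \<sigma>\<^sup>2 \<alpha>\<close> and \<open>h = \<rho> \<sigma>\<^sup>2 \<alpha>\<close>. For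
  \<open>u = \<sigma>\<^sup>2 + \<sigma>\<close> and \<open>v = \<rho> \<sigma>\<^sup>2\<close> the two denominators are \<open>(u - v) \<alpha>\<close> and \<open>(u + v) \<alpha>\<close>, and \<open>u\<^sup>2
  - v\<^sup>2 = 2 \<sigma> u\<close>. So the inverses add up to \<open>\<alpha>\<^sup>-\<^sup>1 \<cdot> 2 u / (2 \<sigma> u) = (\<sigma> \<alpha>)\<^sup>-\<^sup>1\<close>.
\<close>
lemma harmonic_square_roots:
  fixes \<alpha> \<delta> :: quat
  defines "g \<equiv> gmean \<alpha> \<delta>" and "h \<equiv> gmean \<delta> (\<delta> - \<alpha>)"
  assumes nz: "\<alpha> \<noteq> 0" "\<delta> \<noteq> 0"
    and slit: "slit_quat (inverse \<alpha> * \<delta>)" "slit_quat (inverse \<delta> * (\<delta> - \<alpha>))"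
  shows "\<delta> - h + g \<noteq> 0" "\<delta> + h + g \<noteq> 0"
    and "inverse (\<delta> - h + g) + inverse (\<delta> + h + g) = inverse g"
proof -
  define \<sigma> where "\<sigma> = qsqrt (\<delta> * inverse \<alpha>)"
  define \<rho> where "\<rho> = qsqrt ((\<delta> - \<alpha>) * inverse \<delta>)"
  have slit\<sigma>: "slit_quat (\<delta> * inverse \<alpha>)"
    using slit_quat_conjugate[OF nz(1) slit(1)] nz(1) by (simp add: mult.assoc mult_inverse_cancel_left)
  have slit\<rho>: "slit_quat ((\<delta> - \<alpha>) * inverse \<delta>)"
    using slit_quat_conjugate[OF nz(2) slit(2)] nz(2) by (simp add: mult.assoc mult_inverse_cancel_left)
  have \<sigma>0: "\<sigma> \<noteq> 0" "\<sigma> + 1 \<noteq> 0"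
    using qRe_qsqrt_pos[OF slit\<sigma>] by (auto simp: quat_eq_iff simp flip: \<sigma>_def)
  have g: "g = \<sigma> * \<alpha>"
    unfolding g_def \<sigma>_def by (rule gmean_left[OF nz(1) slit(1)])
  have \<delta>: "\<delta> = \<sigma> * \<sigma> * \<alpha>"
    using qsqrt_square[OF slit\<sigma>] nz by (simp add: \<sigma>_def mult.assoc)
  have "h = \<rho> * \<delta>"
    unfolding h_def \<rho>_def by (rule gmean_left[OF nz(2) slit(2)])
  then have h: "h = \<rho> * \<sigma> * \<sigma> * \<alpha>"
    by (simp add: \<delta> mult.assoc)
  have e: "(\<delta> - \<alpha>) * inverse \<delta> = 1 - inverse \<sigma> * inverse \<sigma>"
    using nz \<sigma>0 unfolding \<delta>
    by (simp add: nonzero_inverse_mult_distrib left_diff_distrib mult.assoc mult_inverse_cancel_left)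
  then have \<rho>2: "\<rho> * \<rho> = 1 - inverse \<sigma> * inverse \<sigma>"
    using qsqrt_square[OF slit\<rho>] by (simp only: \<rho>_def)
  have "\<sigma> * ((\<delta> - \<alpha>) * inverse \<delta>) = (\<delta> - \<alpha>) * inverse \<delta> * \<sigma>"
    unfolding e using \<sigma>0
    by (simp add: left_diff_distrib right_diff_distrib mult.assoc mult_inverse_cancel_left)
  then have \<rho>\<sigma>: "\<sigma> * \<rho> = \<rho> * \<sigma>"
    unfolding \<rho>_def by (rule qsqrt_commute[OF slit\<rho>])
  define u where "u = \<sigma> * \<sigma> + \<sigma>"
  define v where "v = \<rho> * \<sigma> * \<sigma>"
  have comm: "u * v = v * u" "\<sigma> * u = u * \<sigma>" "\<sigma> * v = v * \<sigma>"
    using \<rho>\<sigma> unfolding u_def v_def by (simp_all add: algebra_simps) (metis mult.assoc)+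
  have "v * v = \<rho> * \<rho> * \<sigma> * \<sigma> * \<sigma> * \<sigma>"
    unfolding v_def using \<rho>\<sigma> by (metis mult.assoc)
  also have "\<dots> = \<sigma> * \<sigma> * \<sigma> * \<sigma> - \<sigma> * \<sigma>"
    unfolding \<rho>2 using \<sigma>0 by (simp add: left_diff_distrib mult.assoc mult_inverse_cancel_left)
  finally have v2: "v * v = \<sigma> * \<sigma> * \<sigma> * \<sigma> - \<sigma> * \<sigma>" .
  have "u * u - v * v = \<sigma> * (u + u)"
    unfolding v2 u_def by (simp add: algebra_simps)
  then have prod: "(u - v) * (u + v) = \<sigma> * (u + u)"
    using comm(1) by (simp add: algebra_simps)
  have "u + u \<noteq> 0"
  proof -
    have "u = \<sigma> * (\<sigma> + 1)"
      by (simp add: u_def algebra_simps)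
    then have "u \<noteq> 0"
      using \<sigma>0 by simp
    then show ?thesis
      by (simp flip: scaleR_2)
  qed
  then have nuv: "u - v \<noteq> 0" "u + v \<noteq> 0"
    using prod \<sigma>0 by auto
  have m: "\<delta> - h + g = (u - v) * \<alpha>" and p: "\<delta> + h + g = (u + v) * \<alpha>"
    unfolding g h u_def v_def by (simp_all add: \<delta> algebra_simps)
  show "\<delta> - h + g \<noteq> 0" "\<delta> + h + g \<noteq> 0"
    unfolding m p using nuv nz by simp_all
  have "(u - v) * inverse \<sigma> * (u + v) = inverse \<sigma> * ((u - v) * (u + v))"
  proof -
    have "\<sigma> * (u - v) = (u - v) * \<sigma>"
      using comm by (simp add: algebra_simps)
    then have "inverse \<sigma> * (u - v) = (u - v) * inverse \<sigma>"
      using \<sigma>0 by (metis mult.assoc mult_inverse_cancel_left(2) right_inverse mult.right_neutral)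
    then show ?thesis
      by (simp flip: mult.assoc)
  qed
  also have "\<dots> = (u - v) + (u + v)"
    unfolding prod using \<sigma>0 by (simp add: mult_inverse_cancel_left)
  finally have "inverse (u - v) * ((u - v) * inverse \<sigma> * (u + v)) * inverse (u + v) =
      inverse (u - v) + inverse (u + v)"
    by (simp only: division_ring_inverse_add[OF nuv])
  then have "inverse (u - v) + inverse (u + v) = inverse \<sigma>"
    by (simp only: mult.assoc mult_inverse_cancel_left[OF nuv(1)] right_inverse[OF nuv(2)] mult_1_right)
  then show "inverse (\<delta> - h + g) + inverse (\<delta> + h + g) = inverse g"
    unfolding m p unfolding g using nuv nz \<sigma>0
    by (simp add: nonzero_inverse_mult_distrib flip: distrib_left)
qed

text \<open>
  Passing from inversion at one centre to inversion at another, in terms of the image \<open>P\<close> of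
  the new centre and the displacement \<open>t\<close> of a second image point. The result is an affine
  function of \<open>t\<^sup>-\<^sup>1\<close>, so relations between midpoints can be checked on the inverses \<open>t\<^sup>-\<^sup>1\<close>.
\<close>
lemma inverse_of_inverse_diff:
  fixes P t :: "'a::division_ring"
  assumes "P \<noteq> 0" "P + t \<noteq> 0" "t \<noteq> 0"
  shows "inverse (inverse (P + t) - inverse P) = - (P * inverse t * P) - P"
    and "inverse (P + t) - inverse P \<noteq> 0"
proof -
  have *: "inverse (P + t) - inverse P = inverse (P + t) * (- t) * inverse P"
    using inverse_diff_left[OF assms(2,1)] by simp
  show "inverse (P + t) - inverse P \<noteq> 0"
    unfolding * using assms by simp
  show "inverse (inverse (P + t) - inverse P) = - (P * inverse t * P) - P"
    unfolding * using assms
    by (simp add: nonzero_inverse_mult_distrib mult.assoc distrib_left)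
qed

text \<open>
  The four samples at an edge, inverted at \<open>c\<close>. The points \<open>B - g\<close>, \<open>B + g\<close>, \<open>D - h\<close> and \<open>D
  + h\<close> are the images of \<open>p\<^sub>b\<^sub>c\<close>, \<open>p\<^sub>d\<^sub>a\<close>, \<open>p\<^sub>a\<^sub>b\<close> and \<open>p\<^sub>c\<^sub>d\<close>; that they do not vanish keeps these
  points finite.
\<close>
locale inverted_edge =
  fixes \<gamma> :: "int \<Rightarrow> real^3" and i :: int
  fixes a b c d :: "real^3" and A B D \<alpha> \<delta> g h :: quat
  defines "a \<equiv> \<gamma> (i - 1)" and "b \<equiv> \<gamma> i" and "c \<equiv> \<gamma> (i + 1)" and "d \<equiv> \<gamma> (i + 2)"
    and "A \<equiv> inv_at c a" and "B \<equiv> inv_at c b" and "D \<equiv> inv_at c d"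
    and "\<alpha> \<equiv> A - B" and "\<delta> \<equiv> D - B" and "g \<equiv> gmean \<alpha> \<delta>" and "h \<equiv> gmean \<delta> (\<delta> - \<alpha>)"
  assumes distinct: "distinct [a, b, c, d]"
    and slit: "slit_quat (inverse \<alpha> * \<delta>)" "slit_quat (inverse \<delta> * (\<delta> - \<alpha>))"
    and finite_points: "B - g \<noteq> 0" "B + g \<noteq> 0" "D - h \<noteq> 0" "D + h \<noteq> 0"
begin

definition point :: "quat \<Rightarrow> real^3" where
  "point x = qIm (im_quat c + inverse x)"

lemma nonzero: "\<alpha> \<noteq> 0" "\<delta> \<noteq> 0"
  using distinct by (auto simp: \<alpha>_def \<delta>_def A_def B_def D_def)

lemma imaginary: "qRe A = 0" "qRe B = 0" "qRe D = 0" "qRe \<alpha> = 0" "qRe \<delta> = 0" "qRe g = 0" "qRe h = 0"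
proof -
  show *: "qRe A = 0" "qRe B = 0" "qRe D = 0"
    by (simp_all add: A_def B_def D_def qRe_inverse)
  then show **: "qRe \<alpha> = 0" "qRe \<delta> = 0"
    by (simp_all add: \<alpha>_def \<delta>_def)
  then show "qRe g = 0" "qRe h = 0"
    unfolding g_def h_def using nonzero slit by (auto intro!: qRe_gmean)
qed

lemma domains:
  "f_point_dom a b c d" "f_point_dom b c d a" "f_point_dom c d a b" "f_point_dom d a b c"
  and points: "p_bc \<gamma> i = Some (point (B - g))" "p_cd \<gamma> i = Some (point (D + h))"
  "p_da \<gamma> i = Some (point (B + g))" "p_ab \<gamma> i = Some (point (D - h))"
proof -
  have dist: "distinct [b, d, c, a]" "distinct [c, d, a, b]" "distinct [c, a, b, d]"
    using distinct by auto
  have e: "B - D = - \<delta>" "A - D = - (\<delta> - \<alpha>)"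
    by (simp_all add: \<alpha>_def \<delta>_def)
  have neg: "inverse (- \<delta>) * (- (\<delta> - \<alpha>)) = inverse \<delta> * (\<delta> - \<alpha>)"
    by (simp del: minus_diff_eq)
  show 1: "f_point_dom a b c d"
    using distinct slit(1) unfolding f_point_dom_iff cross_ratio_inversion_first[OF distinct]
    by (simp add: \<alpha>_def \<delta>_def A_def B_def D_def)
  show "p_bc \<gamma> i = Some (point (B - g))"
    using finite_points(1) f_point_inversion_at_third[OF distinct]
    by (simp add: p_bc_def point_def Let_def g_def \<alpha>_def \<delta>_def A_def B_def D_def
        a_def b_def c_def d_def)
  \<comment> \<open>Swapping the middle arguments brings the centre \<open>c\<close> into the third slot.\<close>
  have 2: "f_point_dom b d c a"
    using dist(1) slit(2) unfolding f_point_dom_iff cross_ratio_inversion_first[OF dist(1)]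
      A_def[symmetric] B_def[symmetric] D_def[symmetric] e neg
    by simp
  show "f_point_dom b c d a"
    by (rule f_point_swap_inner[OF 2])
  have "f_point b c d a = Some (point (D + h))"
    unfolding f_point_swap_inner(2)[OF 2] f_point_inversion_at_third[OF dist(1)]
      A_def[symmetric] B_def[symmetric] D_def[symmetric] e gmean_minus h_def[symmetric]
    using finite_points(4) by (simp add: point_def Let_def eq_neg_iff_add_eq_0)
  then show "p_cd \<gamma> i = Some (point (D + h))"
    by (simp add: p_cd_def a_def b_def c_def d_def)
  have slit3: "slit_quat (\<delta> * inverse \<alpha>)"
    using slit_quat_conjugate[OF nonzero(1) slit(1)] nonzero(1)
    by (simp add: mult.assoc mult_inverse_cancel_left)
  have "A \<noteq> 0" "B \<noteq> 0"
    using distinct by (auto simp: A_def B_def)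
  then show 3: "f_point_dom c d a b"
    using slit_quat_conjugate[of "inverse A", OF _ slit3] dist(2)
    unfolding f_point_dom_iff cross_ratio_inversion_second[OF dist(2)]
    by (simp add: \<alpha>_def \<delta>_def A_def B_def D_def)
  have "f_point c d a b = Some (point (B + g))"
    using f_point_inversion_at_first[OF dist(2)] slit(1) finite_points(2)
    unfolding A_def[symmetric] B_def[symmetric] D_def[symmetric] \<alpha>_def[symmetric]
      \<delta>_def[symmetric] g_def[symmetric]
    by (simp add: point_def Let_def)
  then show "p_da \<gamma> i = Some (point (B + g))"
    by (simp add: p_da_def a_def b_def c_def d_def)
  have slit4: "slit_quat ((\<delta> - \<alpha>) * inverse \<delta>)"
    using slit_quat_conjugate[OF nonzero(2) slit(2)] nonzero(2)
    by (simp add: mult.assoc mult_inverse_cancel_left)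
  have neg': "- (\<delta> - \<alpha>) * inverse (- \<delta>) = (\<delta> - \<alpha>) * inverse \<delta>"
    by (simp del: minus_diff_eq)
  \<comment> \<open>Swapping the outer arguments brings the centre \<open>c\<close> into the first slot.\<close>
  have 4: "f_point_dom c a b d"
    using slit_quat_conjugate[of "inverse B", OF _ slit4] dist(3) \<open>B \<noteq> 0\<close>
    unfolding f_point_dom_iff cross_ratio_inversion_second[OF dist(3)]
      A_def[symmetric] B_def[symmetric] D_def[symmetric] e neg'
    by simp
  show "f_point_dom d a b c"
    by (rule f_point_swap_outer[OF 4])
  have "f_point d a b c = f_point c a b d"
    by (rule f_point_swap_outer(2)[OF 4])
  also have "\<dots> = Some (point (D - h))"
    using f_point_inversion_at_first[OF dist(3)] slit(2) finite_points(3)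
    unfolding A_def[symmetric] B_def[symmetric] D_def[symmetric] e neg gmean_minus h_def[symmetric]
    by (simp add: point_def Let_def)
  finally show "p_ab \<gamma> i = Some (point (D - h))"
    by (simp add: p_ab_def a_def b_def c_def d_def)
qed

text \<open>
  The image of \<open>p\<^sub>d\<^sub>a\<close> under inversion at \<open>p\<^sub>b\<^sub>c\<close>. The factor \<open>B + g\<close> is kept separate because
  it is the one that becomes small compared with the others.
\<close>
definition inv_far :: "real^3" where
  "inv_far = qIm (- ((B - g) * inverse (2 *\<^sub>R g) * (B + g)))"

text \<open>
  The difference of the images of \<open>p\<^sub>a\<^sub>b\<close> and \<open>p\<^sub>c\<^sub>d\<close> under inversion at \<open>p\<^sub>b\<^sub>c\<close>.
\<close>
definition inv_line :: "real^3" where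
  "inv_line = qIm (- ((B - g) * (inverse (\<delta> - h + g) - inverse (\<delta> + h + g)) * (B - g)))"

definition offset :: "real^3" where
  "offset = centre_offset inv_far inv_line"

lemma im_quat_point: "qRe x = 0 \<Longrightarrow> im_quat (point x) = im_quat c + inverse x"
  unfolding point_def by (rule im_quat_qIm) (simp add: qRe_inverse)

text \<open>
  Curvature and normal enter the discrete torsion as \<open>N / \<kappa>\<close>, which is the vector from \<open>p\<^sub>b\<^sub>c\<close>
  to the centre.
\<close>
lemma discrete_torsion_inverted_edge:
  assumes indep: "inv_far \<times> inv_line \<noteq> 0"
  shows "discrete_torsion_defined \<gamma> i"
    and "circle_center (curvature_circle \<gamma> i) - the (p_bc \<gamma> i) = offset"
    and "discrete_torsion \<gamma> i = - (9 * (qIm (cross_ratio a b c d) \<bullet> offset) / (2 * (norm (b - c))\<^sup>2))"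
proof -
  define p where "p = point (B - g)"
  define v1 where "v1 = point (D - h) - p"
  define v2 where "v2 = point (D + h) - p"
  define v3 where "v3 = point (B + g) - p"
  note H = harmonic_square_roots[OF nonzero slit, folded g_def h_def]
  have g0: "2 *\<^sub>R g \<noteq> 0"
    unfolding g_def using gmean_nonzero[OF nonzero(1) slit(1)] by simp
  have P: "D - h = (B - g) + (\<delta> - h + g)" "D + h = (B - g) + (\<delta> + h + g)" "B + g = (B - g) + 2 *\<^sub>R g"
    by (simp_all add: \<delta>_def scaleR_2)
  have im: "im_quat v1 = inverse (D - h) - inverse (B - g)"
    "im_quat v2 = inverse (D + h) - inverse (B - g)"
    "im_quat v3 = inverse (B + g) - inverse (B - g)"
    by (simp_all add: v1_def v2_def v3_def p_def im_quat_diff im_quat_point imaginary)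
  note Q = inverse_of_inverse_diff[OF finite_points(1)]
  have Q1: "inverse (im_quat v1) = - ((B - g) * inverse (\<delta> - h + g) * (B - g)) - (B - g)" "v1 \<noteq> 0"
    using Q[of "\<delta> - h + g"] H(1) finite_points(3) unfolding P(1)[symmetric] im(1)[symmetric] by auto
  have Q2: "inverse (im_quat v2) = - ((B - g) * inverse (\<delta> + h + g) * (B - g)) - (B - g)" "v2 \<noteq> 0"
    using Q[of "\<delta> + h + g"] H(2) finite_points(4) unfolding P(2)[symmetric] im(2)[symmetric] by auto
  have Q3: "inverse (im_quat v3) = - ((B - g) * inverse (2 *\<^sub>R g) * (B - g)) - (B - g)" "v3 \<noteq> 0"
    using Q[of "2 *\<^sub>R g"] g0 finite_points(2) unfolding P(3)[symmetric] im(3)[symmetric] by auto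
  have y3: "qIm (inverse (im_quat v3)) = inv_far"
  proof -
    have "(B - g) * inverse (2 *\<^sub>R g) * (B + g) = (B - g) * inverse (2 *\<^sub>R g) * (B - g) + (B - g)"
      unfolding P(3) distrib_left
      by (simp only: mult.assoc left_inverse[OF g0] mult.right_neutral)
    then show ?thesis
      by (simp add: Q3(1) inv_far_def)
  qed
  have y12: "qIm (inverse (im_quat v1)) - qIm (inverse (im_quat v2)) = inv_line"
    unfolding inv_line_def Q1(1) Q2(1) quat_sel(8)[symmetric]
    by (rule arg_cong[where f = qIm])
       (simp only: left_diff_distrib right_diff_distrib, simp)
  have harm: "qIm (inverse (im_quat v1)) + qIm (inverse (im_quat v2)) =
      2 *\<^sub>R qIm (inverse (im_quat v3))"
  proof -
    have "inverse (im_quat v1) + inverse (im_quat v2) =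
        - ((B - g) * (inverse (\<delta> - h + g) + inverse (\<delta> + h + g)) * (B - g)) - 2 *\<^sub>R (B - g)"
      unfolding Q1(1) Q2(1) by (simp add: distrib_left distrib_right scaleR_2)
    also have "\<dots> = 2 *\<^sub>R inverse (im_quat v3)"
      unfolding Q3(1) H(3) using g0
      by (simp add: nonzero_inverse_scaleR_distrib scaleR_diff_right)
    finally show ?thesis
      by (metis quat_sel(6,12))
  qed
  obtain K where K: "is_circle (p + offset) (norm offset) K"
    "{p, p + v1, p + v2, p + v3} \<subseteq> K"
    and uniq: "\<And>m r K'. is_circle m r K' \<Longrightarrow> {p, p + v1, p + v2, p + v3} \<subseteq> K' \<Longrightarrow>
      m = p + offset \<and> r = norm offset \<and> K' = K"
    using circle_from_inverse_points[OF Q1(2) Q2(2) Q3(2) harm, of p] indep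
    unfolding y3 y12 offset_def by blast
  have tp: "through_points \<gamma> i K' \<longleftrightarrow>
      (\<exists>m r. is_circle m r K') \<and> {p, p + v1, p + v2, p + v3} \<subseteq> K'" for K'
    unfolding through_points_def points v1_def v2_def v3_def p_def by auto
  then have tpK: "through_points \<gamma> i K"
    using K by (auto simp del: insert_subset)
  have tp_eq: "K' = K" if K': "through_points \<gamma> i K'" for K'
  proof -
    obtain m r where "is_circle m r K'" "{p, p + v1, p + v2, p + v3} \<subseteq> K'"
      using K' unfolding tp by (elim conjE exE)
    then show ?thesis
      by (simp only: uniq)
  qed
  have ex1: "\<exists>!K. through_points \<gamma> i K"
    using tpK tp_eq by (rule ex1I)
  have cK: "curvature_circle \<gamma> i = K"
    unfolding curvature_circle_def using tpK tp_eq by (rule the_equality)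
  have c: "circle_center K = p + offset" "circle_radius K = norm offset"
    by (rule is_circle_unique[OF K]; rule uniq; assumption)+
  show "discrete_torsion_defined \<gamma> i"
    using domains ex1 unfolding discrete_torsion_defined_def a_def b_def c_def d_def by blast
  have pbc: "the (p_bc \<gamma> i) = p"
    by (simp add: points p_def)
  show off: "circle_center (curvature_circle \<gamma> i) - the (p_bc \<gamma> i) = offset"
    by (simp add: cK c pbc)
  have N: "discrete_normal \<gamma> i = offset /\<^sub>R norm offset"
    unfolding discrete_normal_def off by (simp add: Let_def)
  have "norm offset > 0"
    using K(1) by (simp add: is_circle_def)
  then show "discrete_torsion \<gamma> i = - (9 * (qIm (cross_ratio a b c d) \<bullet> offset) / (2 * (norm (b - c))\<^sup>2))"
    unfolding discrete_torsion_def N discrete_curvature_def cK c a_def b_def c_def d_def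
    by (simp add: field_simps)
qed

end

text \<open>
  Quaternion conjugation reverses products, so the reversed cross-ratio is the conjugate of
  the original one, conjugated by \<open>d - a\<close>. On imaginary parts this is the reflection in the
  plane orthogonal to \<open>d - a\<close>.
\<close>
lemma cross_ratio_reverse:
  "qIm (cross_ratio d c b a) = qIm (cross_ratio a b c d) -
    (2 * ((d - a) \<bullet> qIm (cross_ratio a b c d)) / ((d - a) \<bullet> (d - a))) *\<^sub>R (d - a)"
proof (cases "d = a")
  case False
  define y where "y = qIm (inverse (im_quat b - im_quat c))"
  have y: "inverse (im_quat b - im_quat c) = im_quat y"
    unfolding y_def by (rule im_quat_qIm[symmetric]) (simp add: qRe_inverse)
  have y': "inverse (im_quat c - im_quat b) = - im_quat y"
    unfolding y[symmetric] by (simp flip: inverse_minus_eq)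
  define t where "t = d - a"
  define k where "k = 1 / (t \<bullet> t)"
  have tt: "t \<bullet> t \<noteq> 0"
    using False by (simp add: t_def)
  have t: "inverse (im_quat d - im_quat a) = im_quat (- k *\<^sub>R t)"
    "inverse (im_quat a - im_quat d) = im_quat (k *\<^sub>R t)"
    unfolding im_quat_diff[symmetric] k_def t_def
    by (simp_all add: quat_eq_iff qRe_inverse qIm_inverse power2_norm_eq_inner divide_inverse
        norm_minus_commute[of a d] scaleR_diff_right inner_commute algebra_simps)
  define U where "U = im_quat (a - b) * im_quat y * im_quat (c - d)"
  define V where "V = im_quat (d - c) * im_quat y * im_quat (b - a)"
  have UV: "qRe V = - qRe U" "qIm V = qIm U"
    unfolding U_def V_def
    by (simp_all add: quat_mult_sel cross3_simps forall_3)
  have 1: "cross_ratio a b c d = U * im_quat (- k *\<^sub>R t)"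
    by (simp add: cross_ratio_def U_def y t im_quat_diff mult.assoc)
  have 2: "cross_ratio d c b a = - (V * im_quat (k *\<^sub>R t))"
    by (simp add: cross_ratio_def V_def y' t im_quat_diff mult.assoc)
  have "t \<bullet> qIm (cross_ratio a b c d) = - (qRe U * k * (t \<bullet> t))"
    unfolding 1 by (simp add: quat_mult_sel inner_diff_right dot_cross_self cross_mult_right)
  then have "2 * (t \<bullet> qIm (cross_ratio a b c d)) / (t \<bullet> t) = - 2 * qRe U * k"
    using tt by simp
  then show ?thesis
    unfolding t_def[symmetric]
    by (simp add: 1 2 quat_mult_sel UV cross_mult_right algebra_simps flip: scaleR_add_left)
qed (simp add: cross_ratio_def)

text \<open>
  Reversal exchanges \<open>p\<^sub>a\<^sub>b\<close> with \<open>p\<^sub>c\<^sub>d\<close> and fixes \<open>p\<^sub>b\<^sub>c\<close> and \<open>p\<^sub>d\<^sub>a\<close>, by the two symmetries of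
  \<open>f\<close>.
\<close>
lemma through_points_reverse:
  assumes "discrete_torsion_defined \<gamma> i" "\<And>k. \<gamma>' k = \<gamma> (2 * i + 1 - k)"
  shows "through_points \<gamma>' i K \<longleftrightarrow> through_points \<gamma> i K" "p_bc \<gamma>' i = p_bc \<gamma> i"
proof -
  define a b c d where "a = \<gamma> (i - 1)" "b = \<gamma> i" "c = \<gamma> (i + 1)" "d = \<gamma> (i + 2)"
  note abcd = this
  have r: "\<gamma>' (i - 1) = d" "\<gamma>' i = c" "\<gamma>' (i + 1) = b" "\<gamma>' (i + 2) = a"
    by (simp_all add: assms(2) abcd algebra_simps)
  have dom: "f_point_dom d a b c" "f_point_dom a b c d" "f_point_dom b c d a" "f_point_dom c d a b"
    using assms(1) by (simp_all add: discrete_torsion_defined_def abcd)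
  have swap: "f_point d' c' b' a' = f_point a' b' c' d'" if "f_point_dom a' b' c' d'" for a' b' c' d'
    using that f_point_swap_inner f_point_swap_outer by metis
  have p: "p_ab \<gamma>' i = p_cd \<gamma> i" "p_bc \<gamma>' i = p_bc \<gamma> i" "p_cd \<gamma>' i = p_ab \<gamma> i" "p_da \<gamma>' i = p_da \<gamma> i"
    using dom by (simp_all add: p_ab_def p_bc_def p_cd_def p_da_def r swap[OF dom(1)]
        swap[OF dom(2)] swap[OF dom(3)] swap[OF dom(4)] flip: abcd)
  then show "p_bc \<gamma>' i = p_bc \<gamma> i"
    by simp
  show "through_points \<gamma>' i K \<longleftrightarrow> through_points \<gamma> i K"
    unfolding through_points_def p by (simp add: insert_commute)
qed

lemma curvature_circle_reverse:
  assumes "discrete_torsion_defined \<gamma> i" "\<And>k. \<gamma>' k = \<gamma> (2 * i + 1 - k)"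
  shows "circle_center (curvature_circle \<gamma>' i) - the (p_bc \<gamma>' i) =
    circle_center (curvature_circle \<gamma> i) - the (p_bc \<gamma> i)"
  unfolding curvature_circle_def through_points_reverse[OF assms] ..

section \<open>Taylor expansion of the samples\<close>

lemma nth_vderiv_Suc: "nth_vderiv (Suc n) s = (\<lambda>t. vector_derivative (nth_vderiv n s) (at t))"
  by (simp add: nth_vderiv_def)

lemma taylor_remainder_bounded:
  assumes "C_class n s" "n > 0"
  obtains \<rho> where "Bfun \<rho> (at 0)"
    "\<And>\<epsilon>. \<epsilon> \<noteq> 0 \<Longrightarrow> s (u + c * \<epsilon>) =
      (\<Sum>j<n. ((c * \<epsilon>) ^ j / fact j) *\<^sub>R nth_vderiv j s u) + \<epsilon> ^ n *\<^sub>R \<rho> \<epsilon>"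
proof -
  define \<rho> where "\<rho> \<epsilon> = (1 / \<epsilon> ^ n) *\<^sub>R
    (s (u + c * \<epsilon>) - (\<Sum>j<n. ((c * \<epsilon>) ^ j / fact j) *\<^sub>R nth_vderiv j s u))" for \<epsilon>
  have "isCont (nth_vderiv n s) u"
    using assms(1) by (simp add: C_class_def continuous_on_eq_continuous_at)
  then obtain \<delta> where \<delta>: "\<delta> > 0" "\<And>t. dist t u < \<delta> \<Longrightarrow> dist (nth_vderiv n s t) (nth_vderiv n s u) < 1"
    unfolding continuous_at_eps_delta by (meson zero_less_one)
  define M where "M = norm (nth_vderiv n s u) + 1"
  have M: "norm (nth_vderiv n s t) \<le> M" if "\<bar>t - u\<bar> < \<delta>" for t
    using \<delta>(2)[of t] that norm_triangle_sub[of "nth_vderiv n s t" "nth_vderiv n s u"]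
    by (simp add: M_def dist_norm)
  have deriv: "((\<lambda>t. nth_vderiv m s (u + t) $ i) has_real_derivative nth_vderiv (Suc m) s (u + t) $ i) (at t)"
    if "m < n" for m t and i :: 3
  proof -
    have "(nth_vderiv m s has_vector_derivative nth_vderiv (Suc m) s (u + t)) (at (u + t))"
      using assms(1) that by (simp add: C_class_def nth_vderiv_Suc flip: vector_derivative_works)
    then have "((\<lambda>t. nth_vderiv m s t $ i) has_real_derivative nth_vderiv (Suc m) s (u + t) $ i) (at (u + t))"
      unfolding has_real_derivative_iff_has_vector_derivative
      by (rule bounded_linear.has_vector_derivative[OF bounded_linear_vec_nth])
    then show ?thesis
      by (simp add: DERIV_shift add.commute)
  qed
  have comp: "\<bar>(s (u + x) - (\<Sum>j<n. (x ^ j / fact j) *\<^sub>R nth_vderiv j s u)) $ i\<bar> \<le> M * \<bar>x\<bar> ^ n"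
    if "\<bar>x\<bar> < \<delta>" for x and i :: 3
  proof -
    have "\<exists>t. \<bar>t\<bar> \<le> \<bar>x\<bar> \<and> s (u + x) $ i =
      (\<Sum>m<n. nth_vderiv m s (u + 0) $ i / fact m * x ^ m) + nth_vderiv n s (u + t) $ i / fact n * x ^ n"
      by (rule Maclaurin_bi_le[where diff = "\<lambda>m t. nth_vderiv m s (u + t) $ i"])
         (use deriv in \<open>auto simp: nth_vderiv_def\<close>)
    then obtain t where t: "\<bar>t\<bar> \<le> \<bar>x\<bar>" "s (u + x) $ i =
      (\<Sum>m<n. nth_vderiv m s (u + 0) $ i / fact m * x ^ m) + nth_vderiv n s (u + t) $ i / fact n * x ^ n"
      by blast
    have "(s (u + x) - (\<Sum>j<n. (x ^ j / fact j) *\<^sub>R nth_vderiv j s u)) $ i =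
        nth_vderiv n s (u + t) $ i / fact n * x ^ n"
      using t(2) by (simp add: sum_component algebra_simps)
    also have "\<bar>\<dots>\<bar> \<le> (M / 1) * \<bar>x\<bar> ^ n"
      unfolding abs_mult abs_divide power_abs
    proof (intro mult_right_mono frac_le)
      show "\<bar>nth_vderiv n s (u + t) $ i\<bar> \<le> M"
        using M[of "u + t"] component_le_norm_cart[of "nth_vderiv n s (u + t)" i] t(1) that by simp
    qed (simp_all add: M_def)
    finally show ?thesis by simp
  qed
  have bound: "norm (\<rho> \<epsilon>) \<le> 3 * M * \<bar>c\<bar> ^ n" if \<epsilon>: "\<epsilon> \<noteq> 0" "\<bar>c * \<epsilon>\<bar> < \<delta>" for \<epsilon>
  proof -
    let ?v = "s (u + c * \<epsilon>) - (\<Sum>j<n. ((c * \<epsilon>) ^ j / fact j) *\<^sub>R nth_vderiv j s u)"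
    have "norm ?v \<le> (\<Sum>i\<in>UNIV. \<bar>?v $ i\<bar>)"
      by (rule norm_le_l1_cart)
    also have "\<dots> \<le> (\<Sum>i\<in>(UNIV :: 3 set). M * \<bar>c * \<epsilon>\<bar> ^ n)"
      by (intro sum_mono comp \<epsilon>(2))
    also have "\<dots> = \<bar>\<epsilon>\<bar> ^ n * (3 * M * \<bar>c\<bar> ^ n)"
      by (simp add: abs_mult power_mult_distrib)
    finally have "norm ?v \<le> \<bar>\<epsilon>\<bar> ^ n * (3 * M * \<bar>c\<bar> ^ n)" .
    moreover have "norm (\<rho> \<epsilon>) = norm ?v / \<bar>\<epsilon>\<bar> ^ n"
      unfolding \<rho>_def norm_scaleR by (simp add: power_abs)
    moreover have "\<bar>\<epsilon>\<bar> ^ n > 0"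
      using \<epsilon>(1) by simp
    ultimately show ?thesis
      by (simp add: pos_divide_le_eq mult.commute)
  qed
  have "((\<lambda>\<epsilon>::real. \<bar>c * \<epsilon>\<bar>) \<longlongrightarrow> \<bar>c * 0\<bar>) (at 0)"
    by (intro tendsto_intros)
  then have "\<forall>\<^sub>F \<epsilon> in at 0. \<bar>c * \<epsilon>\<bar> < \<delta>"
    using \<delta>(1) by (intro order_tendstoD) auto
  then have "\<forall>\<^sub>F \<epsilon> in at 0. norm (\<rho> \<epsilon>) \<le> 3 * M * \<bar>c\<bar> ^ n + 1"
    using eventually_neq_at_within[of 0 0 UNIV]
    by eventually_elim (use bound in fastforce)
  moreover have "3 * M * \<bar>c\<bar> ^ n + 1 > 0"
    by (simp add: M_def add_nonneg_pos)
  ultimately have "Bfun \<rho> (at 0)"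
    by (auto simp: Bfun_def)
  then show thesis
    by (rule that) (simp add: \<rho>_def)
qed

lemma expandable_eps_power:
  assumes "Bfun f (at 0)"
  shows "expandable n (\<lambda>\<epsilon>. \<epsilon> ^ n *\<^sub>R f \<epsilon>)"
proof (induction n)
  case (Suc n)
  then show ?case
    using expandable_times_ident[of n "\<lambda>\<epsilon>. \<epsilon> ^ n *\<^sub>R f \<epsilon>"] by (simp add: mult.commute)
qed (use assms in simp)

lemma expandable_power:
  fixes f :: "real \<Rightarrow> real"
  shows "expandable n f \<Longrightarrow> expandable n (\<lambda>\<epsilon>. f \<epsilon> ^ k)"
  by (induction k) (simp_all add: expandable_mult)

text \<open>
  The parameters of \<open>a, b, c, d\<close> are \<open>u - 3 \<epsilon>\<close>, \<open>u - \<epsilon>\<close>, \<open>u + \<epsilon>\<close> and \<open>u + 3 \<epsilon>\<close>. Five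
  derivatives are what the third difference needs: after division by \<open>\<epsilon>\<^sup>3\<close> a remainder of
  order \<open>\<epsilon>\<^sup>2\<close> must be left.
\<close>
lemma difference_quotients_expandable:
  fixes s :: "real \<Rightarrow> real^3" and u :: real
  assumes "C_class 5 s"
  defines "Q \<equiv> \<lambda>\<epsilon>. (1 / (2 * \<epsilon>)) *\<^sub>R (s (u + \<epsilon>) - s (u - \<epsilon>))"
    and "X \<equiv> \<lambda>\<epsilon>. (1 / (2 * \<epsilon>\<^sup>2)) *\<^sub>R (s (u + \<epsilon>) - 2 *\<^sub>R s (u - \<epsilon>) + s (u - 3 * \<epsilon>))"
    and "Z \<equiv> \<lambda>\<epsilon>. (1 / (2 * \<epsilon> ^ 3)) *\<^sub>R
        (s (u + 3 * \<epsilon>) - 3 *\<^sub>R s (u + \<epsilon>) + 3 *\<^sub>R s (u - \<epsilon>) - s (u - 3 * \<epsilon>))"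
  shows "expandable 2 Q" "expandable 2 X" "expandable 2 Z"
    and "(Q \<longlongrightarrow> nth_vderiv 1 s u) (at 0)" "(X \<longlongrightarrow> 2 *\<^sub>R nth_vderiv 2 s u) (at 0)"
      "(Z \<longlongrightarrow> 4 *\<^sub>R nth_vderiv 3 s u) (at 0)"
proof -
  define D where "D j = nth_vderiv j s u" for j
  have "\<exists>\<rho>. Bfun \<rho> (at 0) \<and> (\<forall>\<epsilon>. \<epsilon> \<noteq> 0 \<longrightarrow> s (u + c * \<epsilon>) =
      (\<Sum>j<5. ((c * \<epsilon>) ^ j / fact j) *\<^sub>R D j) + \<epsilon> ^ 5 *\<^sub>R \<rho> \<epsilon>)" for c
    by (rule taylor_remainder_bounded[OF assms(1), of u c]) (auto simp: D_def)
  then obtain \<rho> where "\<forall>c. Bfun (\<rho> c) (at 0) \<and> (\<forall>\<epsilon>. \<epsilon> \<noteq> 0 \<longrightarrow> s (u + c * \<epsilon>) =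
      (\<Sum>j<5. ((c * \<epsilon>) ^ j / fact j) *\<^sub>R D j) + \<epsilon> ^ 5 *\<^sub>R \<rho> c \<epsilon>)"
    by (rule choice[rule_format, THEN exE])
  then have \<rho>: "\<And>c. Bfun (\<rho> c) (at 0)"
    and T: "\<And>c \<epsilon>. \<epsilon> \<noteq> 0 \<Longrightarrow> s (u + c * \<epsilon>) =
      (\<Sum>j<5. ((c * \<epsilon>) ^ j / fact j) *\<^sub>R D j) + \<epsilon> ^ 5 *\<^sub>R \<rho> c \<epsilon>"
    by auto
  have T': "s (u + c * \<epsilon>) $ i = D 0 $ i + c * \<epsilon> * D 1 $ i + c^2 * \<epsilon>^2 / 2 * D 2 $ i + c^3 * \<epsilon>^3 / 6 * D 3 $ i
      + c^4 * \<epsilon>^4 / 24 * D 4 $ i + \<epsilon>^5 * \<rho> c \<epsilon> $ i" if "\<epsilon> \<noteq> 0" for c \<epsilon> and i :: 3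
    unfolding T[OF that] by (simp add: eval_nat_numeral fact_numeral power_mult_distrib)
  have T1: "s (u + \<epsilon>) $ i = D 0 $ i + \<epsilon> * D 1 $ i + \<epsilon>^2 / 2 * D 2 $ i + \<epsilon>^3 / 6 * D 3 $ i
      + \<epsilon>^4 / 24 * D 4 $ i + \<epsilon>^5 * \<rho> 1 \<epsilon> $ i"
    "s (u - \<epsilon>) $ i = D 0 $ i - \<epsilon> * D 1 $ i + \<epsilon>^2 / 2 * D 2 $ i - \<epsilon>^3 / 6 * D 3 $ i
      + \<epsilon>^4 / 24 * D 4 $ i + \<epsilon>^5 * \<rho> (- 1) \<epsilon> $ i"
    "s (u + 3 * \<epsilon>) $ i = D 0 $ i + 3 * \<epsilon> * D 1 $ i + 9 * \<epsilon>^2 / 2 * D 2 $ i + 27 * \<epsilon>^3 / 6 * D 3 $ i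
      + 81 * \<epsilon>^4 / 24 * D 4 $ i + \<epsilon>^5 * \<rho> 3 \<epsilon> $ i"
    "s (u - 3 * \<epsilon>) $ i = D 0 $ i - 3 * \<epsilon> * D 1 $ i + 9 * \<epsilon>^2 / 2 * D 2 $ i - 27 * \<epsilon>^3 / 6 * D 3 $ i
      + 81 * \<epsilon>^4 / 24 * D 4 $ i + \<epsilon>^5 * \<rho> (- 3) \<epsilon> $ i" if "\<epsilon> \<noteq> 0" for \<epsilon> and i :: 3
    using T'[OF that, of 1 i] T'[OF that, of "- 1" i] T'[OF that, of 3 i] T'[OF that, of "- 3" i] by simp_all
  have ev: "\<forall>\<^sub>F \<epsilon>::real in at 0. \<epsilon> \<noteq> 0"
    by (rule eventually_neq_at_within)
  let ?rQ = "\<lambda>\<epsilon>. \<epsilon>\<^sup>2 *\<^sub>R (\<epsilon>\<^sup>2 *\<^sub>R ((1/2) *\<^sub>R (\<rho> 1 \<epsilon> - \<rho> (- 1) \<epsilon>)))"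
  let ?rX = "\<lambda>\<epsilon>. \<epsilon>\<^sup>2 *\<^sub>R (\<epsilon> *\<^sub>R ((1/2) *\<^sub>R (\<rho> 1 \<epsilon> - 2 *\<^sub>R \<rho> (- 1) \<epsilon> + \<rho> (- 3) \<epsilon>)))"
  let ?rZ = "\<lambda>\<epsilon>. \<epsilon>\<^sup>2 *\<^sub>R ((1/2) *\<^sub>R (\<rho> 3 \<epsilon> - 3 *\<^sub>R \<rho> 1 \<epsilon> + 3 *\<^sub>R \<rho> (- 1) \<epsilon> - \<rho> (- 3) \<epsilon>))"
  have b: "expandable 0 (\<rho> c)" for c
    using \<rho> by simp
  have eQ: "expandable 2 (\<lambda>\<epsilon>. D 1 + (\<epsilon>\<^sup>2 / 6) *\<^sub>R D 3 + ?rQ \<epsilon>)"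
    by (intro expandable_add expandable_eps_power expandable_bounded[of 0] expandable_scaleR
        expandable_diff expandable_const expandable_power expandable_ident expandable_mult b
        bounded_linear.expandable[OF bounded_linear_divide])
  have eX: "expandable 2 (\<lambda>\<epsilon>. 2 *\<^sub>R D 2 - (2 * \<epsilon>) *\<^sub>R D 3 + (5 / 3 * \<epsilon>\<^sup>2) *\<^sub>R D 4 + ?rX \<epsilon>)"
    by (intro expandable_add expandable_eps_power expandable_bounded[of 0] expandable_scaleR
        expandable_diff expandable_const expandable_power expandable_ident expandable_mult b)
  have eZ: "expandable 2 (\<lambda>\<epsilon>. 4 *\<^sub>R D 3 + ?rZ \<epsilon>)"
    by (intro expandable_add expandable_eps_power expandable_bounded[of 0] expandable_scaleR
        expandable_diff expandable_const expandable_power expandable_ident expandable_mult b)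
  have Q: "\<forall>\<^sub>F \<epsilon> in at 0. D 1 + (\<epsilon>\<^sup>2 / 6) *\<^sub>R D 3 + ?rQ \<epsilon> = Q \<epsilon>"
    using ev
  proof eventually_elim
    case (elim \<epsilon>)
    then show ?case
      by (simp add: Q_def vec_eq_iff T1[OF elim]) (simp add: field_simps eval_nat_numeral)
  qed
  have X: "\<forall>\<^sub>F \<epsilon> in at 0. 2 *\<^sub>R D 2 - (2 * \<epsilon>) *\<^sub>R D 3 + (5 / 3 * \<epsilon>\<^sup>2) *\<^sub>R D 4 + ?rX \<epsilon> = X \<epsilon>"
    using ev
  proof eventually_elim
    case (elim \<epsilon>)
    then show ?case
      by (simp add: X_def vec_eq_iff T1[OF elim]) (simp add: field_simps eval_nat_numeral)
  qed
  have Z: "\<forall>\<^sub>F \<epsilon> in at 0. 4 *\<^sub>R D 3 + ?rZ \<epsilon> = Z \<epsilon>"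
    using ev
  proof eventually_elim
    case (elim \<epsilon>)
    then show ?case
      by (simp add: Z_def vec_eq_iff T1[OF elim]) (simp add: field_simps eval_nat_numeral)
  qed
  show "expandable 2 Q" "expandable 2 X" "expandable 2 Z"
    using expandable_cong[OF eQ Q] expandable_cong[OF eX X] expandable_cong[OF eZ Z] by auto
  have lim0: "((\<lambda>\<epsilon>. \<epsilon>\<^sup>2 *\<^sub>R f \<epsilon>) \<longlongrightarrow> 0) (at 0)" if "expandable 0 f" for f :: "real \<Rightarrow> real^3"
    by (rule expandable_tendsto_of_bounded[where g = "\<lambda>\<epsilon>. \<epsilon> *\<^sub>R f \<epsilon>"])
       (use expandable_scaleR[OF expandable_ident that] in \<open>auto simp: power2_eq_square\<close>)
  have lQ: "(?rQ \<longlongrightarrow> 0) (at 0)" and lX: "(?rX \<longlongrightarrow> 0) (at 0)" and lZ: "(?rZ \<longlongrightarrow> 0) (at 0)"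
    by (rule lim0; intro expandable_add expandable_scaleR
        expandable_diff expandable_const expandable_power expandable_ident b)+
  have "((\<lambda>\<epsilon>. D 1 + (\<epsilon>\<^sup>2 / 6) *\<^sub>R D 3 + ?rQ \<epsilon>) \<longlongrightarrow> D 1 + (0\<^sup>2 / 6) *\<^sub>R D 3 + 0) (at 0)"
    by (intro tendsto_intros lQ) simp_all
  from Lim_transform_eventually[OF this Q] show "(Q \<longlongrightarrow> nth_vderiv 1 s u) (at 0)"
    by (simp add: D_def)
  have "((\<lambda>\<epsilon>. 2 *\<^sub>R D 2 - (2 * \<epsilon>) *\<^sub>R D 3 + (5 / 3 * \<epsilon>\<^sup>2) *\<^sub>R D 4 + ?rX \<epsilon>) \<longlongrightarrow>
      2 *\<^sub>R D 2 - (2 * 0) *\<^sub>R D 3 + (5 / 3 * 0\<^sup>2) *\<^sub>R D 4 + 0) (at 0)"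
    by (intro tendsto_intros lX)
  from Lim_transform_eventually[OF this X] show "(X \<longlongrightarrow> 2 *\<^sub>R nth_vderiv 2 s u) (at 0)"
    by (simp add: D_def)
  have "((\<lambda>\<epsilon>. 4 *\<^sub>R D 3 + ?rZ \<epsilon>) \<longlongrightarrow> 4 *\<^sub>R D 3 + 0) (at 0)"
    by (intro tendsto_intros lZ)
  from Lim_transform_eventually[OF this Z] show "(Z \<longlongrightarrow> 4 *\<^sub>R nth_vderiv 3 s u) (at 0)"
    by (simp add: D_def)
qed

text \<open>
  The images under inversion grow like \<open>1 / \<epsilon>\<close> when the samples approach each other, so the
  expansions are made for \<open>\<epsilon>\<close> times the images. All constructions are homogeneous and the
  factor drops out, except in \<open>B + g\<close>: this sum is itself of order \<open>\<epsilon>\<close>, and its quotient \<open>L\<close>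
  by \<open>\<epsilon>\<close> takes its place.
\<close>
lemma inverted_edge_scaled:
  fixes A B D :: quat
  assumes "\<epsilon> \<noteq> 0"
    and ABD: "inv_at (\<gamma> (i + 1)) (\<gamma> (i - 1)) = (1 / \<epsilon>) *\<^sub>R A"
      "inv_at (\<gamma> (i + 1)) (\<gamma> i) = (1 / \<epsilon>) *\<^sub>R B"
      "inv_at (\<gamma> (i + 1)) (\<gamma> (i + 2)) = (1 / \<epsilon>) *\<^sub>R D"
  defines "\<alpha> \<equiv> A - B" and "\<delta> \<equiv> D - B" and "g \<equiv> gmean (A - B) (D - B)"
    and "h \<equiv> gmean (D - B) ((D - B) - (A - B))"
  assumes distinct: "distinct [\<gamma> (i - 1), \<gamma> i, \<gamma> (i + 1), \<gamma> (i + 2)]"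
    and slit: "slit_quat (inverse \<alpha> * \<delta>)" "slit_quat (inverse \<delta> * (\<delta> - \<alpha>))"
    and finite_points: "B - g \<noteq> 0" "B + g = \<epsilon> *\<^sub>R L" "L \<noteq> 0" "D - h \<noteq> 0" "D + h \<noteq> 0"
  defines "y \<equiv> qIm (- ((B - g) * inverse (2 *\<^sub>R g) * L))"
    and "e \<equiv> qIm (- ((B - g) * (inverse (\<delta> - h + g) - inverse (\<delta> + h + g)) * (B - g)))"
  assumes indep: "y \<times> e \<noteq> 0"
  shows "discrete_torsion_defined \<gamma> i"
    and "circle_center (curvature_circle \<gamma> i) - the (p_bc \<gamma> i) = centre_offset y e"
    and "discrete_torsion \<gamma> i = - (9 * (qIm (cross_ratio (\<gamma> (i - 1)) (\<gamma> i) (\<gamma> (i + 1)) (\<gamma> (i + 2)))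
        \<bullet> centre_offset y e) / (2 * (norm (\<gamma> i - \<gamma> (i + 1)))\<^sup>2))"
proof -
  define t where "t = 1 / \<epsilon>"
  have t: "t \<noteq> 0" using assms(1) by (simp add: t_def)
  have sc: "inverse (t *\<^sub>R p) * (t *\<^sub>R p') = inverse p * p'" if "p \<noteq> 0" for p p' :: quat
    using t that by (simp add: nonzero_inverse_scaleR_distrib)
  have nz: "\<alpha> \<noteq> 0" "\<delta> \<noteq> 0"
    using slit by (auto simp: slit_quat_def)
  note ABD' = ABD[folded t_def]
  have e: "t *\<^sub>R A - t *\<^sub>R B = t *\<^sub>R \<alpha>" "t *\<^sub>R D - t *\<^sub>R B = t *\<^sub>R \<delta>"
    "t *\<^sub>R \<delta> - t *\<^sub>R \<alpha> = t *\<^sub>R (\<delta> - \<alpha>)"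
    by (simp_all add: \<alpha>_def \<delta>_def scaleR_diff_right)
  have gh: "gmean (t *\<^sub>R \<alpha>) (t *\<^sub>R \<delta>) = t *\<^sub>R g" "gmean (t *\<^sub>R \<delta>) (t *\<^sub>R (\<delta> - \<alpha>)) = t *\<^sub>R h"
    by (simp_all add: gmean_scaleR[OF t] g_def h_def \<alpha>_def \<delta>_def)
  have tBgL: "t *\<^sub>R B + t *\<^sub>R g = L"
    using finite_points(2) assms(1) by (simp add: t_def flip: scaleR_add_right)
  have pm: "t *\<^sub>R B - t *\<^sub>R g = t *\<^sub>R (B - g)" "t *\<^sub>R D - t *\<^sub>R h = t *\<^sub>R (D - h)"
    "t *\<^sub>R D + t *\<^sub>R h = t *\<^sub>R (D + h)" "t *\<^sub>R \<delta> - t *\<^sub>R h + t *\<^sub>R g = t *\<^sub>R (\<delta> - h + g)"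
    "t *\<^sub>R \<delta> + t *\<^sub>R h + t *\<^sub>R g = t *\<^sub>R (\<delta> + h + g)" "2 *\<^sub>R t *\<^sub>R g = t *\<^sub>R 2 *\<^sub>R g"
    by (simp_all add: scaleR_diff_right scaleR_add_right)
  have g0: "g \<noteq> 0"
    using gmean_nonzero[OF nz(1) slit(1)] by (simp add: g_def \<alpha>_def \<delta>_def)
  have H: "\<delta> - h + g \<noteq> 0" "\<delta> + h + g \<noteq> 0"
    using harmonic_square_roots[OF nz slit] by (simp_all add: g_def h_def \<alpha>_def \<delta>_def)
  have base: "inverted_edge \<gamma> i"
    unfolding inverted_edge_def ABD' e gh tBgL pm sc[OF nz(1)] sc[OF nz(2)]
    using distinct slit finite_points t by simp
  have y: "inverted_edge.inv_far \<gamma> i = y"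
    unfolding inverted_edge.inv_far_def[OF base] ABD' e gh tBgL pm y_def
    using t g0 by (simp add: nonzero_inverse_scaleR_distrib)
  have ld: "inverted_edge.inv_line \<gamma> i = t *\<^sub>R e"
    unfolding inverted_edge.inv_line_def[OF base] ABD' e gh tBgL pm e_def
    using t H by (simp add: nonzero_inverse_scaleR_distrib flip: scaleR_diff_right)
  have "inverted_edge.inv_far \<gamma> i \<times> inverted_edge.inv_line \<gamma> i \<noteq> 0"
    using indep t by (simp add: y ld cross_mult_right)
  note R = inverted_edge.discrete_torsion_inverted_edge[OF base this]
  have off: "inverted_edge.offset \<gamma> i = centre_offset y e"
    by (simp add: inverted_edge.offset_def[OF base] y ld centre_offset_scaleR[OF t])
  show "discrete_torsion_defined \<gamma> i"
    "circle_center (curvature_circle \<gamma> i) - the (p_bc \<gamma> i) = centre_offset y e"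
    "discrete_torsion \<gamma> i = - (9 * (qIm (cross_ratio (\<gamma> (i - 1)) (\<gamma> i) (\<gamma> (i + 1)) (\<gamma> (i + 2)))
        \<bullet> centre_offset y e) / (2 * (norm (\<gamma> i - \<gamma> (i + 1)))\<^sup>2))"
    using R by (simp_all add: off)
qed

section \<open>Limits of the circle centre and of the cross-ratio\<close>

lemma quat_sandwich:
  "im_quat u * im_quat v * im_quat u = im_quat ((u \<bullet> u) *\<^sub>R v - (2 * (u \<bullet> v)) *\<^sub>R u)"
  by (simp add: quat_eq_iff quat_mult_sel cross3_simps forall_3)

text \<open>
  Here \<open>u\<close> and \<open>v\<close> are the first two derivatives of the curve. Up to a factor, \<open>j v j\<close>
  differs from \<open>v\<close> only in the component along \<open>u\<close>, which does not affect the foot. The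
  result is the vector from the curve point to the centre of the osculating circle.
\<close>
lemma limit_offset:
  fixes u v :: "real^3"
  assumes "u \<times> v \<noteq> 0" "k \<noteq> 0"
  defines "j \<equiv> inverse (im_quat u)"
  shows "qIm (- (1/2) *\<^sub>R (j * im_quat v * j)) \<times> (k *\<^sub>R u) \<noteq> 0"
    and "centre_offset (qIm (- (1/2) *\<^sub>R (j * im_quat v * j))) (k *\<^sub>R u) =
      ((u \<bullet> u)\<^sup>2 / (norm (u \<times> v))\<^sup>2) *\<^sub>R (v - ((u \<bullet> v) / (u \<bullet> u)) *\<^sub>R u)"
proof -
  define n where "n = v - ((u \<bullet> v) / (u \<bullet> u)) *\<^sub>R u"
  have u: "u \<bullet> u \<noteq> 0"
    using assms by auto
  define m where "m = - 1 / (2 * (u \<bullet> u))"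
  define y where "y = qIm (- (1/2) *\<^sub>R (j * im_quat v * j))"
  have m0: "m \<noteq> 0"
    using u by (simp add: m_def)
  have "j * im_quat v * j = (1 / (u \<bullet> u)\<^sup>2) *\<^sub>R (im_quat u * im_quat v * im_quat u)"
    unfolding j_def inverse_im_quat im_quat_scaleR by (simp add: power2_eq_square)
  then have y: "y = m *\<^sub>R (v - (2 * (u \<bullet> v) / (u \<bullet> u)) *\<^sub>R u)"
    unfolding y_def quat_sandwich using u
    by (simp add: m_def power2_eq_square scaleR_diff_right)
  have "y \<times> (k *\<^sub>R u) = (m * k) *\<^sub>R (v \<times> u)"
    by (simp add: y cross_mult_left cross_mult_right Cross3.left_diff_distrib)
  then show "y \<times> (k *\<^sub>R u) \<noteq> 0"
    using assms(1,2) m0 cross_skew[of u v] by auto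
  have f: "foot_point y (k *\<^sub>R u) = m *\<^sub>R n"
    unfolding foot_point_scaleR[OF assms(2)] using u
    by (simp add: foot_point_def y n_def inner_commute[of v u] inner_diff_left
        scaleR_diff_right right_diff_distrib flip: scaleR_add_left scaleR_diff_left)
  have "n \<bullet> n = v \<bullet> v - (u \<bullet> v)\<^sup>2 / (u \<bullet> u)"
    using u by (simp add: n_def inner_diff inner_commute[of v u] power2_eq_square field_simps)
  moreover have "(norm (u \<times> v))\<^sup>2 = (u \<bullet> u) * (v \<bullet> v) - (u \<bullet> v)\<^sup>2"
    using norm_cross_dot[of u v] by (simp add: power_mult_distrib power2_norm_eq_inner)
  ultimately have nn: "n \<bullet> n = (norm (u \<times> v))\<^sup>2 / (u \<bullet> u)"
    using u by (simp add: field_simps)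
  have "centre_offset y (k *\<^sub>R u) = (- (1 / (2 * m * (n \<bullet> n)))) *\<^sub>R n"
    using m0 by (simp add: centre_offset_def f)
  also have "- (1 / (2 * m * (n \<bullet> n))) = (u \<bullet> u)\<^sup>2 / (norm (u \<times> v))\<^sup>2"
    unfolding nn m_def using u by (simp add: power2_eq_square)
  finally show "centre_offset y (k *\<^sub>R u) = ((u \<bullet> u)\<^sup>2 / (norm (u \<times> v))\<^sup>2) *\<^sub>R n" .
qed

text \<open>
  Here \<open>u, v, x\<close> are the first three derivatives of the curve, and \<open>G\<close> is the limit of \<open>Im
  cr / \<epsilon>\<^sup>2\<close>. The summand with \<open>v\<close> twice is the square of the quaternion \<open>v j\<close>, whose
  imaginary part is a multiple of \<open>u \<times> v\<close>. So the osculating plane only sees \<open>x \<times> u\<close>.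
\<close>
lemma limit_cross_ratio:
  fixes u v x :: "real^3"
  assumes "u \<noteq> 0"
  defines "j \<equiv> inverse (im_quat u)"
  defines "G \<equiv> qIm (- (4/9) *\<^sub>R (2 *\<^sub>R (im_quat x * j) - 3 *\<^sub>R (im_quat v * j * im_quat v * j)))"
  shows "u \<bullet> G = 0" "v \<bullet> G = 8 / 9 * ((u \<times> v) \<bullet> x) / (u \<bullet> u)"
proof -
  have uu: "u \<bullet> u \<noteq> 0"
    using assms by simp
  define k where "k = 1 / (u \<bullet> u)"
  have j: "j = - k *\<^sub>R im_quat u"
    unfolding j_def inverse_im_quat im_quat_scaleR k_def by simp
  have G: "G = (8/9 * k) *\<^sub>R (x \<times> u) + (8/3 * k\<^sup>2 * (v \<bullet> u)) *\<^sub>R (u \<times> v)"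
    unfolding G_def j
    by (simp add: quat_mult_sel vec_eq_iff cross3_simps forall_3 power2_eq_square)
  show "u \<bullet> G = 0"
    by (simp add: G inner_add_right dot_cross_self)
  have "v \<bullet> (x \<times> u) = (u \<times> v) \<bullet> x"
    by (simp add: cross3_simps)
  then show "v \<bullet> G = 8 / 9 * ((u \<times> v) \<bullet> x) / (u \<bullet> u)"
    by (simp add: G inner_add_right dot_cross_self k_def)
qed

section \<open>Expansion of the discrete torsion\<close>

text \<open>
  Used twice in a row, this gives the inverse up to second order with an exact remainder.
\<close>
lemma inverse_perturbation:
  fixes q y :: "'a::real_normed_div_algebra"
  assumes "q \<noteq> 0" "q + t *\<^sub>R y \<noteq> 0"
  shows "inverse (q + t *\<^sub>R y) = inverse q - t *\<^sub>R (inverse q * y * inverse (q + t *\<^sub>R y))"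
  using inverse_diff_right[OF assms(2,1)] by (simp add: algebra_simps)

text \<open>
  The vectors \<open>s1\<close>, \<open>s2\<close>, \<open>s3\<close> are the derivatives of the curve. The factors 2 and 4 come
  from the normalisation of the differences: the sample distance is \<open>2 \<epsilon>\<close>, and each quotient
  only divides by \<open>2 \<epsilon>\<^sup>k\<close>.
\<close>
locale edge_expansion =
  fixes Q X Z :: "real \<Rightarrow> real^3" and s1 s2 s3 :: "real^3"
  assumes exp: "expandable 2 Q" "expandable 2 X" "expandable 2 Z"
    and lim: "(Q \<longlongrightarrow> s1) (at 0)" "(X \<longlongrightarrow> 2 *\<^sub>R s2) (at 0)" "(Z \<longlongrightarrow> 4 *\<^sub>R s3) (at 0)"
    and curved: "s1 \<times> s2 \<noteq> 0"
begin

definition j where "j = inverse (im_quat s1)"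

definition q where "q \<epsilon> = im_quat (Q \<epsilon>)"
definition x where "x \<epsilon> = im_quat (X \<epsilon>)"
definition z where "z \<epsilon> = im_quat (Z \<epsilon>)"
definition y where "y \<epsilon> = x \<epsilon> + \<epsilon> *\<^sub>R z \<epsilon>"
text \<open>
  With these definitions \<open>a - c = - 4 \<epsilon> N\<close>, \<open>b - c = - 2 \<epsilon> q\<close> and \<open>d - c = 2 \<epsilon> R\<close>.
  Accordingly \<open>A\<close>, \<open>B\<close> and \<open>D\<close> below are \<open>\<epsilon>\<close> times the images under inversion at \<open>c\<close>.
\<close>
definition N where "N \<epsilon> = q \<epsilon> + (- \<epsilon> / 2) *\<^sub>R x \<epsilon>"
definition R where "R \<epsilon> = q \<epsilon> + \<epsilon> *\<^sub>R y \<epsilon>"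
definition A where "A \<epsilon> = (- 1 / 4) *\<^sub>R inverse (N \<epsilon>)"
definition B where "B \<epsilon> = (- 1 / 2) *\<^sub>R inverse (q \<epsilon>)"
definition D where "D \<epsilon> = (1 / 2) *\<^sub>R inverse (R \<epsilon>)"
text \<open>
  The quotient of \<open>4 \<alpha> - \<delta>\<close> by \<open>\<epsilon>\<^sup>2\<close>, see \<open>four_alpha_minus_delta\<close>.
\<close>
definition H where "H \<epsilon> =
  (1 / 2) *\<^sub>R (inverse (q \<epsilon>) * z \<epsilon> * inverse (q \<epsilon>)) -
  (1 / 4) *\<^sub>R (inverse (q \<epsilon>) * x \<epsilon> * inverse (q \<epsilon>) * x \<epsilon> * inverse (N \<epsilon>)) -
  (1 / 2) *\<^sub>R (inverse (q \<epsilon>) * y \<epsilon> * inverse (q \<epsilon>) * y \<epsilon> * inverse (R \<epsilon>))"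
definition \<alpha> where "\<alpha> \<epsilon> = A \<epsilon> - B \<epsilon>"
definition \<delta> where "\<delta> \<epsilon> = D \<epsilon> - B \<epsilon>"
definition r where "r \<epsilon> = qsqrt (inverse (\<alpha> \<epsilon>) * \<delta> \<epsilon>)"
definition g where "g \<epsilon> = gmean (\<alpha> \<epsilon>) (\<delta> \<epsilon>)"
definition h where "h \<epsilon> = gmean (\<delta> \<epsilon>) (\<delta> \<epsilon> - \<alpha> \<epsilon>)"
text \<open>
  The quotient of \<open>B + g\<close> by \<open>\<epsilon>\<close>, see \<open>B_plus_g\<close>.
\<close>
definition L where "L \<epsilon> =
  (- 1 / 4) *\<^sub>R (inverse (q \<epsilon>) * x \<epsilon> * inverse (N \<epsilon>)) - \<epsilon> *\<^sub>R (H \<epsilon> * inverse (r \<epsilon> + 2))"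
definition inv_far where "inv_far \<epsilon> = qIm (- ((B \<epsilon> - g \<epsilon>) * inverse (2 *\<^sub>R g \<epsilon>) * L \<epsilon>))"
definition inv_line where "inv_line \<epsilon> = qIm (- ((B \<epsilon> - g \<epsilon>) *
  (inverse (\<delta> \<epsilon> - h \<epsilon> + g \<epsilon>) - inverse (\<delta> \<epsilon> + h \<epsilon> + g \<epsilon>)) * (B \<epsilon> - g \<epsilon>)))"
definition w where "w \<epsilon> = centre_offset (inv_far \<epsilon>) (inv_line \<epsilon>)"
text \<open>
  This is \<open>1 - \<delta> \<alpha>\<^sup>-\<^sup>1\<close>, and \<open>G\<close> is \<open>Im cr / \<epsilon>\<^sup>2\<close>; both are written in terms of \<open>H\<close>, so that no
  small denominator is left.
\<close>
definition V where "V \<epsilon> = - 3 + \<epsilon>\<^sup>2 *\<^sub>R (H \<epsilon> * inverse (\<alpha> \<epsilon>))"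
definition G where "G \<epsilon> = qIm ((1 / 3) *\<^sub>R
  (inverse (A \<epsilon>) * H \<epsilon> * inverse (\<alpha> \<epsilon>) * inverse (V \<epsilon>) * A \<epsilon>))"

lemma j_nonzero: "s1 \<noteq> 0" "j \<noteq> 0"
  using curved by (auto simp: j_def)

lemma lim_basic:
  "(q \<longlongrightarrow> im_quat s1) (at 0)" "(x \<longlongrightarrow> 2 *\<^sub>R im_quat s2) (at 0)"
  "(z \<longlongrightarrow> 4 *\<^sub>R im_quat s3) (at 0)" "(y \<longlongrightarrow> 2 *\<^sub>R im_quat s2) (at 0)"
  "(N \<longlongrightarrow> im_quat s1) (at 0)" "(R \<longlongrightarrow> im_quat s1) (at 0)"
proof -
  show q: "(q \<longlongrightarrow> im_quat s1) (at 0)" and x: "(x \<longlongrightarrow> 2 *\<^sub>R im_quat s2) (at 0)"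
    and z: "(z \<longlongrightarrow> 4 *\<^sub>R im_quat s3) (at 0)"
    unfolding q_def x_def z_def
    using tendsto_im_quat[OF lim(1)] tendsto_im_quat[OF lim(2)] tendsto_im_quat[OF lim(3)]
    by (simp_all add: im_quat_scaleR)
  have "(y \<longlongrightarrow> 2 *\<^sub>R im_quat s2 + 0 *\<^sub>R (4 *\<^sub>R im_quat s3)) (at 0)"
    unfolding y_def by (intro tendsto_intros x z)
  then show y: "(y \<longlongrightarrow> 2 *\<^sub>R im_quat s2) (at 0)" by simp
  have "(N \<longlongrightarrow> im_quat s1 + (- 0 / 2) *\<^sub>R (2 *\<^sub>R im_quat s2)) (at 0)"
    unfolding N_def by (intro tendsto_intros q x) simp
  then show "(N \<longlongrightarrow> im_quat s1) (at 0)" by simp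
  have "(R \<longlongrightarrow> im_quat s1 + 0 *\<^sub>R (2 *\<^sub>R im_quat s2)) (at 0)"
    unfolding R_def by (intro tendsto_intros q y)
  then show "(R \<longlongrightarrow> im_quat s1) (at 0)" by simp
qed

lemma exp_basic:
  "expandable 2 q" "expandable 2 x" "expandable 2 z" "expandable 2 y" "expandable 2 N" "expandable 2 R"
proof -
  show q: "expandable 2 q" and x: "expandable 2 x" and z: "expandable 2 z"
    unfolding q_def x_def z_def by (intro expandable_im_quat exp)+
  show y: "expandable 2 y"
    unfolding y_def by (intro expandable_add expandable_scaleR expandable_ident x z)
  show "expandable 2 N"
    unfolding N_def divide_inverse
    by (intro expandable_add expandable_scaleR expandable_minus expandable_mult expandable_ident
        expandable_const q x)
  show "expandable 2 R"
    unfolding R_def by (intro expandable_add expandable_scaleR expandable_ident q y)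
qed

lemma lim_inverse:
  "((\<lambda>\<epsilon>. inverse (q \<epsilon>)) \<longlongrightarrow> j) (at 0)" "((\<lambda>\<epsilon>. inverse (N \<epsilon>)) \<longlongrightarrow> j) (at 0)"
  "((\<lambda>\<epsilon>. inverse (R \<epsilon>)) \<longlongrightarrow> j) (at 0)"
  unfolding j_def using j_nonzero by (auto intro!: tendsto_inverse lim_basic)

lemma exp_inverse:
  "expandable 2 (\<lambda>\<epsilon>. inverse (q \<epsilon>))" "expandable 2 (\<lambda>\<epsilon>. inverse (N \<epsilon>))"
  "expandable 2 (\<lambda>\<epsilon>. inverse (R \<epsilon>))"
  using j_nonzero
  by (auto intro!: expandable_inverse[OF lim_basic(1)] expandable_inverse[OF lim_basic(5)]
      expandable_inverse[OF lim_basic(6)] exp_basic)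

lemma lim_ABD:
  "(A \<longlongrightarrow> (- 1 / 4) *\<^sub>R j) (at 0)" "(B \<longlongrightarrow> (- 1 / 2) *\<^sub>R j) (at 0)" "(D \<longlongrightarrow> (1 / 2) *\<^sub>R j) (at 0)"
  "(\<alpha> \<longlongrightarrow> (1 / 4) *\<^sub>R j) (at 0)" "(\<delta> \<longlongrightarrow> j) (at 0)"
proof -
  show A: "(A \<longlongrightarrow> (- 1 / 4) *\<^sub>R j) (at 0)" and B: "(B \<longlongrightarrow> (- 1 / 2) *\<^sub>R j) (at 0)"
    and D: "(D \<longlongrightarrow> (1 / 2) *\<^sub>R j) (at 0)"
    unfolding A_def B_def D_def by (intro tendsto_intros lim_inverse)+
  have "(\<alpha> \<longlongrightarrow> (- 1 / 4) *\<^sub>R j - (- 1 / 2) *\<^sub>R j) (at 0)"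
    unfolding \<alpha>_def by (intro tendsto_intros A B)
  moreover have "(- 1 / 4) *\<^sub>R j - (- 1 / 2) *\<^sub>R j = (1 / 4) *\<^sub>R j"
    by (simp only: scaleR_diff_left[symmetric]) simp
  ultimately show "(\<alpha> \<longlongrightarrow> (1 / 4) *\<^sub>R j) (at 0)" by simp
  have "(\<delta> \<longlongrightarrow> (1 / 2) *\<^sub>R j - (- 1 / 2) *\<^sub>R j) (at 0)"
    unfolding \<delta>_def by (intro tendsto_intros D B)
  moreover have "(1 / 2) *\<^sub>R j - (- 1 / 2) *\<^sub>R j = j"
    by (simp only: scaleR_diff_left[symmetric]) simp
  ultimately show "(\<delta> \<longlongrightarrow> j) (at 0)" by simp
qed

lemma exp_ABD: "expandable 2 A" "expandable 2 B" "expandable 2 D" "expandable 2 \<alpha>" "expandable 2 \<delta>"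
proof -
  show A: "expandable 2 A" and B: "expandable 2 B" and D: "expandable 2 D"
    unfolding A_def B_def D_def by (intro expandable_scaleR expandable_const exp_inverse)+
  show "expandable 2 \<alpha>" "expandable 2 \<delta>"
    unfolding \<alpha>_def \<delta>_def by (intro expandable_diff A B D)+
qed

lemma lim_H:
  "(H \<longlongrightarrow> 2 *\<^sub>R (j * im_quat s3 * j) - 3 *\<^sub>R (j * im_quat s2 * j * im_quat s2 * j)) (at 0)"
proof -
  have "(H \<longlongrightarrow> (1 / 2) *\<^sub>R (j * (4 *\<^sub>R im_quat s3) * j) -
    (1 / 4) *\<^sub>R (j * (2 *\<^sub>R im_quat s2) * j * (2 *\<^sub>R im_quat s2) * j) -
    (1 / 2) *\<^sub>R (j * (2 *\<^sub>R im_quat s2) * j * (2 *\<^sub>R im_quat s2) * j)) (at 0)"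
    unfolding H_def by (intro tendsto_intros lim_basic lim_inverse)
  moreover have "(1 / 2) *\<^sub>R (j * (4 *\<^sub>R im_quat s3) * j) -
    (1 / 4) *\<^sub>R (j * (2 *\<^sub>R im_quat s2) * j * (2 *\<^sub>R im_quat s2) * j) -
    (1 / 2) *\<^sub>R (j * (2 *\<^sub>R im_quat s2) * j * (2 *\<^sub>R im_quat s2) * j) =
    2 *\<^sub>R (j * im_quat s3 * j) - 3 *\<^sub>R (j * im_quat s2 * j * im_quat s2 * j)"
    by (simp add: quat_eq_iff vec_eq_iff)
  ultimately show ?thesis
    by (simp only:)
qed

lemma exp_H: "expandable 2 H"
  unfolding H_def
  by (intro expandable_diff expandable_scaleR expandable_const expandable_mult exp_basic exp_inverse)

lemma ratio_limits:
  "((\<lambda>\<epsilon>. inverse (\<alpha> \<epsilon>) * \<delta> \<epsilon>) \<longlongrightarrow> of_real 4) (at 0)"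
  "((\<lambda>\<epsilon>. inverse (\<delta> \<epsilon>) * (\<delta> \<epsilon> - \<alpha> \<epsilon>)) \<longlongrightarrow> of_real (3 / 4)) (at 0)"
proof -
  have "((\<lambda>\<epsilon>. inverse (\<alpha> \<epsilon>) * \<delta> \<epsilon>) \<longlongrightarrow> inverse ((1 / 4) *\<^sub>R j) * j) (at 0)"
    using j_nonzero by (intro tendsto_intros lim_ABD) auto
  moreover have "inverse ((1 / 4) *\<^sub>R j) * j = of_real 4"
    using j_nonzero by (simp add: nonzero_inverse_scaleR_distrib quat_eq_iff)
  ultimately show "((\<lambda>\<epsilon>. inverse (\<alpha> \<epsilon>) * \<delta> \<epsilon>) \<longlongrightarrow> of_real 4) (at 0)" by simp
  have "((\<lambda>\<epsilon>. inverse (\<delta> \<epsilon>) * (\<delta> \<epsilon> - \<alpha> \<epsilon>)) \<longlongrightarrow> inverse j * (j - (1 / 4) *\<^sub>R j)) (at 0)"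
    using j_nonzero by (intro tendsto_intros lim_ABD) auto
  moreover have "inverse j * (j - (1 / 4) *\<^sub>R j) = of_real (3 / 4)"
    unfolding of_real_def using j_nonzero by (simp add: right_diff_distrib quat_eq_iff)
  ultimately show "((\<lambda>\<epsilon>. inverse (\<delta> \<epsilon>) * (\<delta> \<epsilon> - \<alpha> \<epsilon>)) \<longlongrightarrow> of_real (3 / 4)) (at 0)"
    by simp
qed

lemma exp_ratio:
  "expandable 2 (\<lambda>\<epsilon>. inverse (\<alpha> \<epsilon>) * \<delta> \<epsilon>)" "expandable 2 (\<lambda>\<epsilon>. inverse (\<delta> \<epsilon>) * (\<delta> \<epsilon> - \<alpha> \<epsilon>))"
  using j_nonzero
  by (auto intro!: expandable_mult expandable_diff expandable_inverse[OF lim_ABD(4)]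
      expandable_inverse[OF lim_ABD(5)] exp_ABD)

lemma lim_gh:
  "(r \<longlongrightarrow> 2) (at 0)" "(g \<longlongrightarrow> (1 / 2) *\<^sub>R j) (at 0)" "(h \<longlongrightarrow> sqrt (3 / 4) *\<^sub>R j) (at 0)"
proof -
  have "sqrt 4 = 2"
    by (metis real_sqrt_four)
  then show r: "(r \<longlongrightarrow> 2) (at 0)"
    using tendsto_qsqrt[OF ratio_limits(1)] by (simp add: r_def[abs_def])
  have "(g \<longlongrightarrow> ((1 / 4) *\<^sub>R j) * 2) (at 0)"
    unfolding g_def gmean_def r_def[symmetric] by (intro tendsto_intros lim_ABD r)
  then show "(g \<longlongrightarrow> (1 / 2) *\<^sub>R j) (at 0)"
    by (simp flip: scaleR_2 add: mult_2_right)
  have "(h \<longlongrightarrow> j * of_real (sqrt (3 / 4))) (at 0)"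
    unfolding h_def gmean_def by (intro tendsto_intros lim_ABD tendsto_qsqrt ratio_limits) simp
  then show "(h \<longlongrightarrow> sqrt (3 / 4) *\<^sub>R j) (at 0)"
    by (simp add: of_real_def del: real_sqrt_divide)
qed

lemma exp_gh: "expandable 2 r" "expandable 2 g" "expandable 2 h"
proof -
  show r: "expandable 2 r"
    unfolding r_def by (rule expandable_qsqrt[OF ratio_limits(1)]) (simp_all add: exp_ratio)
  show "expandable 2 g"
    unfolding g_def gmean_def r_def[symmetric] by (intro expandable_mult exp_ABD r)
  have "expandable 2 (\<lambda>\<epsilon>. qsqrt (inverse (\<delta> \<epsilon>) * (\<delta> \<epsilon> - \<alpha> \<epsilon>)))"
    by (rule expandable_qsqrt[OF ratio_limits(2)]) (simp_all add: exp_ratio)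
  then show "expandable 2 h"
    unfolding h_def gmean_def by (intro expandable_mult exp_ABD)
qed

lemma lim_L: "(L \<longlongrightarrow> (- 1 / 2) *\<^sub>R (j * im_quat s2 * j)) (at 0)"
proof -
  have "(L \<longlongrightarrow> (- 1 / 4) *\<^sub>R (j * (2 *\<^sub>R im_quat s2) * j) - 0 *\<^sub>R
      ((2 *\<^sub>R (j * im_quat s3 * j) - 3 *\<^sub>R (j * im_quat s2 * j * im_quat s2 * j)) * inverse (2 + 2))) (at 0)"
    unfolding L_def by (intro tendsto_intros lim_basic lim_inverse lim_H lim_gh) simp
  then show ?thesis by simp
qed

lemma exp_L: "expandable 2 L"
proof -
  have "((\<lambda>\<epsilon>. r \<epsilon> + 2) \<longlongrightarrow> 2 + 2) (at 0)"
    by (intro tendsto_intros lim_gh)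
  then have "expandable 2 (\<lambda>\<epsilon>. inverse (r \<epsilon> + 2))"
    by (rule expandable_inverse) (auto intro: expandable_add exp_gh)
  then show ?thesis
    unfolding L_def
    by (intro expandable_diff expandable_scaleR expandable_const expandable_ident expandable_mult
        exp_basic exp_inverse exp_H)
qed

lemma lim_V: "(V \<longlongrightarrow> - 3) (at 0)"
proof -
  have "(V \<longlongrightarrow> - 3 + 0\<^sup>2 *\<^sub>R ((2 *\<^sub>R (j * im_quat s3 * j) - 3 *\<^sub>R (j * im_quat s2 * j * im_quat s2 * j))
      * inverse ((1 / 4) *\<^sub>R j))) (at 0)"
    unfolding V_def using j_nonzero by (intro tendsto_intros lim_H lim_ABD) auto
  then show ?thesis by simp
qed

lemma nonzero_3: "- 3 \<noteq> (0 :: quat)"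
  by simp

lemma exp_V: "expandable 2 V"
  unfolding V_def using j_nonzero
  by (intro expandable_add expandable_const expandable_scaleR expandable_power expandable_ident
      expandable_mult exp_H expandable_inverse[OF lim_ABD(4)] exp_ABD) auto

lemma lim_G: "(G \<longlongrightarrow> qIm (- (4/9) *\<^sub>R (2 *\<^sub>R (im_quat s3 * j) - 3 *\<^sub>R (im_quat s2 * j * im_quat s2 * j)))) (at 0)"
proof -
  let ?H = "2 *\<^sub>R (j * im_quat s3 * j) - 3 *\<^sub>R (j * im_quat s2 * j * im_quat s2 * j)"
  have i3: "inverse (- 3 :: quat) = (- 1 / 3) *\<^sub>R 1"
    by (rule inverse_unique) (simp add: quat_eq_iff quat_mult_sel)
  have "(G \<longlongrightarrow> qIm ((1 / 3) *\<^sub>R (inverse ((- 1 / 4) *\<^sub>R j) * ?H * inverse ((1 / 4) *\<^sub>R j) *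
      inverse (- 3) * ((- 1 / 4) *\<^sub>R j)))) (at 0)"
    unfolding G_def using j_nonzero
    by (intro tendsto_qIm tendsto_intros lim_ABD lim_H lim_V) auto
  also have "(1 / 3) *\<^sub>R (inverse ((- 1 / 4) *\<^sub>R j) * ?H * inverse ((1 / 4) *\<^sub>R j) *
      inverse (- 3) * ((- 1 / 4) *\<^sub>R j)) = - (4/9) *\<^sub>R (inverse j * ?H)"
    unfolding i3 using j_nonzero
    by (simp add: nonzero_inverse_scaleR_distrib mult.assoc)
  also have "inverse j * ?H = 2 *\<^sub>R (im_quat s3 * j) - 3 *\<^sub>R (im_quat s2 * j * im_quat s2 * j)"
    using j_nonzero by (simp add: right_diff_distrib mult.assoc mult_inverse_cancel_left)
  finally show ?thesis .
qed

lemma exp_G: "expandable 2 G"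
  unfolding G_def using j_nonzero nonzero_3
  by (intro expandable_qIm expandable_scaleR expandable_const expandable_mult exp_H
      expandable_inverse[OF lim_ABD(4)] expandable_inverse[OF lim_ABD(1)] expandable_inverse[OF lim_V]
      exp_ABD exp_V) auto

text \<open>
  The limits of \<open>\<delta> - h + g\<close> and \<open>\<delta> + h + g\<close> in units of \<open>j\<close>: \<open>\<delta>\<close> tends to \<open>j\<close>, \<open>g\<close> to \<open>j /
  2\<close> and \<open>h\<close> to \<open>sqrt (3 / 4) j\<close>.
\<close>
definition k1 :: real where "k1 = 3 / 2 - sqrt (3 / 4)"
definition k2 :: real where "k2 = 3 / 2 + sqrt (3 / 4)"

lemma k_pos: "0 < k1" "k1 < k2"
proof -
  have "sqrt (3 / 4) < 3 / 2"
    by (rule real_less_lsqrt) (auto simp: power2_eq_square)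
  then show "0 < k1" "k1 < k2"
    by (simp_all add: k1_def k2_def)
qed

lemma lim_denominators:
  "((\<lambda>\<epsilon>. B \<epsilon> - g \<epsilon>) \<longlongrightarrow> - j) (at 0)"
  "((\<lambda>\<epsilon>. D \<epsilon> - h \<epsilon>) \<longlongrightarrow> (k1 - 1) *\<^sub>R j) (at 0)"
  "((\<lambda>\<epsilon>. D \<epsilon> + h \<epsilon>) \<longlongrightarrow> (k2 - 1) *\<^sub>R j) (at 0)"
  "((\<lambda>\<epsilon>. \<delta> \<epsilon> - h \<epsilon> + g \<epsilon>) \<longlongrightarrow> k1 *\<^sub>R j) (at 0)"
  "((\<lambda>\<epsilon>. \<delta> \<epsilon> + h \<epsilon> + g \<epsilon>) \<longlongrightarrow> k2 *\<^sub>R j) (at 0)"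
proof -
  have "((\<lambda>\<epsilon>. B \<epsilon> - g \<epsilon>) \<longlongrightarrow> (- 1 / 2) *\<^sub>R j - (1 / 2) *\<^sub>R j) (at 0)"
    by (intro tendsto_intros lim_ABD lim_gh)
  moreover have "(- 1 / 2) *\<^sub>R j - (1 / 2) *\<^sub>R j = - j"
    by (simp only: scaleR_diff_left[symmetric]) simp
  ultimately show "((\<lambda>\<epsilon>. B \<epsilon> - g \<epsilon>) \<longlongrightarrow> - j) (at 0)"
    by simp
  have "((\<lambda>\<epsilon>. D \<epsilon> - h \<epsilon>) \<longlongrightarrow> (1 / 2) *\<^sub>R j - sqrt (3 / 4) *\<^sub>R j) (at 0)"
    by (intro tendsto_intros lim_ABD lim_gh)
  then show "((\<lambda>\<epsilon>. D \<epsilon> - h \<epsilon>) \<longlongrightarrow> (k1 - 1) *\<^sub>R j) (at 0)"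
    by (simp add: k1_def flip: scaleR_diff_left)
  have "((\<lambda>\<epsilon>. D \<epsilon> + h \<epsilon>) \<longlongrightarrow> (1 / 2) *\<^sub>R j + sqrt (3 / 4) *\<^sub>R j) (at 0)"
    by (intro tendsto_intros lim_ABD lim_gh)
  then show "((\<lambda>\<epsilon>. D \<epsilon> + h \<epsilon>) \<longlongrightarrow> (k2 - 1) *\<^sub>R j) (at 0)"
    by (simp add: k2_def flip: scaleR_add_left)
  have "((\<lambda>\<epsilon>. \<delta> \<epsilon> - h \<epsilon> + g \<epsilon>) \<longlongrightarrow> 1 *\<^sub>R j - sqrt (3 / 4) *\<^sub>R j + (1 / 2) *\<^sub>R j) (at 0)"
    by (intro tendsto_intros lim_ABD[unfolded scaleR_one] lim_gh) (simp add: lim_ABD)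
  then show "((\<lambda>\<epsilon>. \<delta> \<epsilon> - h \<epsilon> + g \<epsilon>) \<longlongrightarrow> k1 *\<^sub>R j) (at 0)"
    by (simp only: k1_def flip: scaleR_diff_left scaleR_add_left) (simp add: algebra_simps)
  have "((\<lambda>\<epsilon>. \<delta> \<epsilon> + h \<epsilon> + g \<epsilon>) \<longlongrightarrow> 1 *\<^sub>R j + sqrt (3 / 4) *\<^sub>R j + (1 / 2) *\<^sub>R j) (at 0)"
    by (intro tendsto_intros lim_ABD[unfolded scaleR_one] lim_gh) (simp add: lim_ABD)
  then show "((\<lambda>\<epsilon>. \<delta> \<epsilon> + h \<epsilon> + g \<epsilon>) \<longlongrightarrow> k2 *\<^sub>R j) (at 0)"
    by (simp only: k2_def flip: scaleR_add_left) (simp add: algebra_simps)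
qed

lemma denominators_nonzero: "k1 *\<^sub>R j \<noteq> 0" "k2 *\<^sub>R j \<noteq> 0" "(k1 - 1) *\<^sub>R j \<noteq> 0" "(k2 - 1) *\<^sub>R j \<noteq> 0"
proof -
  have "sqrt (3 / 4) > 1 / 2"
    by (rule real_less_rsqrt) (simp add: power2_eq_square)
  then have "k1 < 1" "1 < k2"
    by (simp_all add: k1_def k2_def)
  then show "k1 *\<^sub>R j \<noteq> 0" "k2 *\<^sub>R j \<noteq> 0" "(k1 - 1) *\<^sub>R j \<noteq> 0" "(k2 - 1) *\<^sub>R j \<noteq> 0"
    using k_pos j_nonzero by auto
qed

text \<open>
  The limit of \<open>inv_line\<close> in units of the tangent. The centre depends on its direction only,
  so it matters just that \<open>k\<close> does not vanish.
\<close>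
definition k where "k = (inverse k1 - inverse k2) / (s1 \<bullet> s1)"

lemma k_nonzero: "k \<noteq> 0"
  using k_pos j_nonzero by (simp add: k_def)

abbreviation "inv_far0 \<equiv> qIm (- (1 / 2) *\<^sub>R (j * im_quat s2 * j))"

lemma lim_inv_far_line: "(inv_far \<longlongrightarrow> inv_far0) (at 0)" "(inv_line \<longlongrightarrow> k *\<^sub>R s1) (at 0)"
proof -
  have "(inv_far \<longlongrightarrow> qIm (- (- j * inverse (2 *\<^sub>R ((1 / 2) *\<^sub>R j)) * ((- 1 / 2) *\<^sub>R (j * im_quat s2 * j))))) (at 0)"
    unfolding inv_far_def using j_nonzero
    by (intro tendsto_qIm tendsto_intros lim_denominators lim_gh lim_L) auto
  then show "(inv_far \<longlongrightarrow> inv_far0) (at 0)"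
    using j_nonzero by simp
  have "(inv_line \<longlongrightarrow> qIm (- (- j * (inverse (k1 *\<^sub>R j) - inverse (k2 *\<^sub>R j)) * - j))) (at 0)"
    unfolding inv_line_def
    by (intro tendsto_qIm tendsto_intros lim_denominators denominators_nonzero)
  also have "- j * (inverse (k1 *\<^sub>R j) - inverse (k2 *\<^sub>R j)) * - j = (inverse k1 - inverse k2) *\<^sub>R j"
    using j_nonzero denominators_nonzero
    by (simp add: nonzero_inverse_scaleR_distrib left_diff_distrib right_diff_distrib scaleR_diff_left)
  finally show "(inv_line \<longlongrightarrow> k *\<^sub>R s1) (at 0)"
    by (simp add: k_def j_def inverse_im_quat)
qed

lemma exp_inv_far_line: "expandable 2 inv_far" "expandable 2 inv_line"
proof -
  have "((\<lambda>\<epsilon>. 2 *\<^sub>R g \<epsilon>) \<longlongrightarrow> 2 *\<^sub>R ((1 / 2) *\<^sub>R j)) (at 0)"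
    by (intro tendsto_intros lim_gh)
  then have "expandable 2 (\<lambda>\<epsilon>. inverse (2 *\<^sub>R g \<epsilon>))"
    using j_nonzero by (intro expandable_inverse) (auto intro: expandable_scaleR exp_gh)
  then show "expandable 2 inv_far"
    unfolding inv_far_def
    by (intro expandable_qIm expandable_minus expandable_mult expandable_diff exp_ABD exp_gh exp_L)
  show "expandable 2 inv_line"
    unfolding inv_line_def
    by (intro expandable_qIm expandable_minus expandable_mult expandable_diff expandable_add exp_ABD
        exp_gh expandable_inverse[OF lim_denominators(4) denominators_nonzero(1)]
        expandable_inverse[OF lim_denominators(5) denominators_nonzero(2)])
qed

lemmas inv_far0_cross = limit_offset(1)[OF curved k_nonzero, folded j_def]

abbreviation "w0 \<equiv> ((s1 \<bullet> s1)\<^sup>2 / (norm (s1 \<times> s2))\<^sup>2) *\<^sub>R (s2 - ((s1 \<bullet> s2) / (s1 \<bullet> s1)) *\<^sub>R s1)"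

lemma w_limit: "expandable 2 w" "(w \<longlongrightarrow> w0) (at 0)"
  unfolding w_def limit_offset(2)[OF curved k_nonzero, folded j_def, symmetric]
  by (rule expandable_centre_offset exp_inv_far_line lim_inv_far_line inv_far0_cross)+

text \<open>
  In terms of the inverses of \<open>q\<close>, \<open>N\<close> and \<open>R\<close> the left-hand side is \<open>(3 / 2) q\<^sup>-\<^sup>1 - N\<^sup>-\<^sup>1 - (1
  / 2) R\<^sup>-\<^sup>1\<close>. For points at parameters \<open>- 3, - 1, 1, 3\<close> on a line this is zero, and the
  first-order terms of \<open>N\<^sup>-\<^sup>1\<close> and \<open>R\<^sup>-\<^sup>1\<close> cancel as well, because both come from the same
  second difference.
\<close>
lemma four_alpha_minus_delta:
  assumes "q \<epsilon> \<noteq> 0" "N \<epsilon> \<noteq> 0" "R \<epsilon> \<noteq> 0"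
  shows "4 *\<^sub>R \<alpha> \<epsilon> - \<delta> \<epsilon> = \<epsilon>\<^sup>2 *\<^sub>R H \<epsilon>"
proof -
  let ?q = "inverse (q \<epsilon>)" and ?N = "inverse (N \<epsilon>)" and ?R = "inverse (R \<epsilon>)"
  have N1: "?N = ?q + (\<epsilon> / 2) *\<^sub>R (?q * x \<epsilon> * ?N)"
    using inverse_perturbation[OF assms(1), of "- \<epsilon> / 2" "x \<epsilon>"] assms(2) unfolding N_def by simp
  have R1: "?R = ?q - \<epsilon> *\<^sub>R (?q * y \<epsilon> * ?R)"
    using inverse_perturbation[OF assms(1), of "\<epsilon>" "y \<epsilon>"] assms(3) unfolding R_def by simp
  have N2: "?N = ?q + (\<epsilon> / 2) *\<^sub>R (?q * x \<epsilon> * ?q) + (\<epsilon>\<^sup>2 / 4) *\<^sub>R (?q * x \<epsilon> * ?q * x \<epsilon> * ?N)"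
  proof -
    have "?q * x \<epsilon> * ?N = ?q * x \<epsilon> * ?q + (\<epsilon> / 2) *\<^sub>R (?q * x \<epsilon> * ?q * x \<epsilon> * ?N)"
      by (subst N1) (simp add: distrib_left mult.assoc)
    then show ?thesis
      by (subst N1) (simp add: scaleR_add_right power2_eq_square)
  qed
  have R2: "?R = ?q - \<epsilon> *\<^sub>R (?q * x \<epsilon> * ?q) - \<epsilon>\<^sup>2 *\<^sub>R (?q * z \<epsilon> * ?q) + \<epsilon>\<^sup>2 *\<^sub>R (?q * y \<epsilon> * ?q * y \<epsilon> * ?R)"
  proof -
    have "?q * y \<epsilon> * ?R = ?q * y \<epsilon> * ?q - \<epsilon> *\<^sub>R (?q * y \<epsilon> * ?q * y \<epsilon> * ?R)"
      by (subst R1) (simp add: right_diff_distrib mult.assoc)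
    moreover have "?q * y \<epsilon> * ?q = ?q * x \<epsilon> * ?q + \<epsilon> *\<^sub>R (?q * z \<epsilon> * ?q)"
      by (simp add: y_def distrib_left distrib_right)
    ultimately show ?thesis
      by (subst R1) (simp add: scaleR_add_right scaleR_diff_right power2_eq_square)
  qed
  define u1 u2 u3 u4 where "u1 = ?q * x \<epsilon> * ?q * x \<epsilon> * ?N" "u2 = ?q * y \<epsilon> * ?q * y \<epsilon> * ?R"
    "u3 = ?q * x \<epsilon> * ?q" "u4 = ?q * z \<epsilon> * ?q"
  note u = this
  have "4 *\<^sub>R \<alpha> \<epsilon> - \<delta> \<epsilon> = (3 / 2) *\<^sub>R ?q - ?N - (1 / 2) *\<^sub>R ?R"
    by (simp add: \<alpha>_def \<delta>_def A_def B_def D_def algebra_simps flip: scaleR_add_left)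
  also have "\<dots> = \<epsilon>\<^sup>2 *\<^sub>R ((1 / 2) *\<^sub>R u4 - (1 / 4) *\<^sub>R u1 - (1 / 2) *\<^sub>R u2)"
    unfolding N2[folded u] R2[folded u]
    by (simp add: quat_eq_iff vec_eq_iff field_simps)
  also have "\<dots> = \<epsilon>\<^sup>2 *\<^sub>R H \<epsilon>"
    by (simp add: H_def u)
  finally show ?thesis .
qed

text \<open>
  Since \<open>\<delta> \<approx> 4 \<alpha>\<close>, the mean \<open>g = \<alpha> r\<close> is nearly \<open>2 \<alpha>\<close>. Precisely, \<open>\<alpha> (r - 2) (r + 2) = \<delta> - 4
  \<alpha>\<close>, which has order \<open>\<epsilon>\<^sup>2\<close>. What remains is \<open>B + 2 \<alpha> = 2 A - B\<close>, the difference of \<open>q\<^sup>-\<^sup>1 / 2\<close>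
  and \<open>N\<^sup>-\<^sup>1 / 2\<close>.
\<close>
lemma B_plus_g:
  assumes "q \<epsilon> \<noteq> 0" "N \<epsilon> \<noteq> 0" "R \<epsilon> \<noteq> 0" "slit_quat (inverse (\<alpha> \<epsilon>) * \<delta> \<epsilon>)"
  shows "B \<epsilon> + g \<epsilon> = \<epsilon> *\<^sub>R L \<epsilon>"
proof -
  have \<alpha>0: "\<alpha> \<epsilon> \<noteq> 0"
    using assms(4) by (auto simp: slit_quat_def)
  have s4: "sqrt 4 = 2"
    by (rule real_sqrt_four)
  have "r \<epsilon> - 2 = (inverse (\<alpha> \<epsilon>) * \<delta> \<epsilon> - 4) * inverse (r \<epsilon> + 2)"
    using qsqrt_minus_sqrt[OF assms(4), of 4] by (simp add: s4 r_def)
  then have "\<alpha> \<epsilon> * (r \<epsilon> - 2) = (\<alpha> \<epsilon> * (inverse (\<alpha> \<epsilon>) * \<delta> \<epsilon> - 4)) * inverse (r \<epsilon> + 2)"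
    by (simp add: mult.assoc)
  also have "\<alpha> \<epsilon> * (inverse (\<alpha> \<epsilon>) * \<delta> \<epsilon> - 4) = - (4 *\<^sub>R \<alpha> \<epsilon> - \<delta> \<epsilon>)"
    using \<alpha>0 by (simp add: right_diff_distrib mult_inverse_cancel_left)
      (simp add: quat_eq_iff quat_mult_sel)
  also have "4 *\<^sub>R \<alpha> \<epsilon> - \<delta> \<epsilon> = \<epsilon>\<^sup>2 *\<^sub>R H \<epsilon>"
    by (rule four_alpha_minus_delta[OF assms(1-3)])
  finally have "\<alpha> \<epsilon> * (r \<epsilon> - 2) = - (\<epsilon>\<^sup>2 *\<^sub>R (H \<epsilon> * inverse (r \<epsilon> + 2)))"
    by simp
  moreover have "\<alpha> \<epsilon> * (r \<epsilon> - 2) = g \<epsilon> - 2 *\<^sub>R \<alpha> \<epsilon>"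
    by (simp add: g_def gmean_def r_def right_diff_distrib) (simp add: quat_eq_iff quat_mult_sel)
  ultimately have "g \<epsilon> - 2 *\<^sub>R \<alpha> \<epsilon> = - (\<epsilon>\<^sup>2 *\<^sub>R (H \<epsilon> * inverse (r \<epsilon> + 2)))"
    by (simp only:)
  then have g: "g \<epsilon> = 2 *\<^sub>R \<alpha> \<epsilon> - \<epsilon>\<^sup>2 *\<^sub>R (H \<epsilon> * inverse (r \<epsilon> + 2))"
    by (simp add: diff_eq_eq)
  have N1: "inverse (N \<epsilon>) = inverse (q \<epsilon>) + (\<epsilon> / 2) *\<^sub>R (inverse (q \<epsilon>) * x \<epsilon> * inverse (N \<epsilon>))"
    using inverse_perturbation[OF assms(1), of "- \<epsilon> / 2" "x \<epsilon>"] assms(2) unfolding N_def by simp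
  define u where "u = inverse (q \<epsilon>) * x \<epsilon> * inverse (N \<epsilon>)"
  have "B \<epsilon> + 2 *\<^sub>R \<alpha> \<epsilon> = (1 / 2) *\<^sub>R (inverse (q \<epsilon>) - inverse (N \<epsilon>))"
    by (simp add: \<alpha>_def A_def B_def quat_eq_iff vec_eq_iff)
  also have "\<dots> = - (\<epsilon> / 4) *\<^sub>R u"
    unfolding N1[folded u_def] by simp
  finally show ?thesis
    unfolding g L_def u_def by (simp add: scaleR_diff_right power2_eq_square algebra_simps)
qed

definition nondegenerate where "nondegenerate \<epsilon> \<longleftrightarrow> \<epsilon> \<noteq> 0 \<and> q \<epsilon> \<noteq> 0 \<and> N \<epsilon> \<noteq> 0 \<and> R \<epsilon> \<noteq> 0 \<and>
  slit_quat (inverse (\<alpha> \<epsilon>) * \<delta> \<epsilon>) \<and> slit_quat (inverse (\<delta> \<epsilon>) * (\<delta> \<epsilon> - \<alpha> \<epsilon>)) \<and>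
  B \<epsilon> - g \<epsilon> \<noteq> 0 \<and> L \<epsilon> \<noteq> 0 \<and> D \<epsilon> - h \<epsilon> \<noteq> 0 \<and> D \<epsilon> + h \<epsilon> \<noteq> 0 \<and> inv_far \<epsilon> \<times> inv_line \<epsilon> \<noteq> 0"

lemma eventually_nondegenerate: "\<forall>\<^sub>F \<epsilon> in at 0. nondegenerate \<epsilon>"
proof -
  have s1: "im_quat s1 \<noteq> 0"
    using j_nonzero by simp
  have L0: "(- 1 / 2) *\<^sub>R (j * im_quat s2 * j) \<noteq> 0"
    using j_nonzero curved by auto
  have "bounded_bilinear ((\<times>) :: real^3 \<Rightarrow> _)"
    using bilinear_conv_bounded_bilinear bilinear_cross by blast
  then have "((\<lambda>\<epsilon>. inv_far \<epsilon> \<times> inv_line \<epsilon>) \<longlongrightarrow> inv_far0 \<times> (k *\<^sub>R s1)) (at 0)"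
    by (rule bounded_bilinear.tendsto) (rule lim_inv_far_line)+
  then have "\<forall>\<^sub>F \<epsilon> in at 0. inv_far \<epsilon> \<times> inv_line \<epsilon> \<noteq> 0"
    using inv_far0_cross by (rule tendsto_imp_eventually_ne)
  moreover have "- j \<noteq> 0"
    using j_nonzero by simp
  ultimately show ?thesis
    unfolding nondegenerate_def
    using s1 L0 denominators_nonzero
    by (intro eventually_conj eventually_neq_at_within
        eventually_slit_quat[OF ratio_limits(1)] eventually_slit_quat[OF ratio_limits(2)]
        tendsto_imp_eventually_ne[OF lim_basic(1)] tendsto_imp_eventually_ne[OF lim_basic(5)]
        tendsto_imp_eventually_ne[OF lim_basic(6)] tendsto_imp_eventually_ne[OF lim_L]
        tendsto_imp_eventually_ne[OF lim_denominators(1)]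
        tendsto_imp_eventually_ne[OF lim_denominators(2)]
        tendsto_imp_eventually_ne[OF lim_denominators(3)]) auto
qed

definition F where "F \<epsilon> = - (9 * (G \<epsilon> \<bullet> w \<epsilon>) / (8 * (Q \<epsilon> \<bullet> Q \<epsilon>)))"

definition G0 where
  "G0 = qIm (- (4/9) *\<^sub>R (2 *\<^sub>R (im_quat s3 * j) - 3 *\<^sub>R (im_quat s2 * j * im_quat s2 * j)))"

lemma G0_inner: "s1 \<bullet> G0 = 0" "s2 \<bullet> G0 = 8 / 9 * ((s1 \<times> s2) \<bullet> s3) / (s1 \<bullet> s1)"
  unfolding G0_def j_def by (rule limit_cross_ratio[OF j_nonzero(1)])+

text \<open>
  The vector \<open>w0\<close> lies in the osculating plane, and of \<open>G0\<close> only the component along \<open>s2\<close>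
  survives. The factor \<open>9 / 8\<close> cancels the \<open>8 / 9\<close> of \<open>G0_inner\<close>.
\<close>
lemma lim_F: "(F \<longlongrightarrow> - (((s1 \<times> s2) \<bullet> s3) / (norm (s1 \<times> s2))\<^sup>2)) (at 0)"
proof -
  have s: "s1 \<bullet> s1 \<noteq> 0"
    using j_nonzero by simp
  have "(F \<longlongrightarrow> - (9 * (G0 \<bullet> w0) / (8 * (s1 \<bullet> s1)))) (at 0)"
    unfolding F_def using s by (intro tendsto_intros lim_G[folded G0_def] w_limit lim) auto
  moreover have "G0 \<bullet> w0 = (s1 \<bullet> s1)\<^sup>2 / (norm (s1 \<times> s2))\<^sup>2 * (8 / 9 * ((s1 \<times> s2) \<bullet> s3) / (s1 \<bullet> s1))"
    using G0_inner by (simp add: inner_diff_right inner_commute[of G0])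
  then have "9 * (G0 \<bullet> w0) / (8 * (s1 \<bullet> s1)) = ((s1 \<times> s2) \<bullet> s3) / (norm (s1 \<times> s2))\<^sup>2"
    using s by (simp add: power2_eq_square[of "s1 \<bullet> s1"])
  ultimately show ?thesis
    by (simp only:)
qed

lemma exp_F: "expandable 2 F"
proof -
  have "((\<lambda>\<epsilon>. 8 * (Q \<epsilon> \<bullet> Q \<epsilon>)) \<longlongrightarrow> 8 * (s1 \<bullet> s1)) (at 0)"
    by (intro tendsto_intros lim)
  then have "expandable 2 (\<lambda>\<epsilon>. inverse (8 * (Q \<epsilon> \<bullet> Q \<epsilon>)))"
  proof (rule expandable_inverse)
    show "8 * (s1 \<bullet> s1) \<noteq> 0"
      using j_nonzero by simp
    show "expandable 2 (\<lambda>\<epsilon>. 8 * (Q \<epsilon> \<bullet> Q \<epsilon>))"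
      by (intro expandable_mult expandable_const expandable_inner exp)
  qed
  then show ?thesis
    unfolding F_def divide_inverse
    by (intro expandable_minus expandable_mult expandable_inner expandable_const exp_G w_limit)
qed

text \<open>
  The bridge between the discrete notions at a fixed small \<open>\<epsilon>\<close> and the functions whose
  expansions are known.
\<close>
lemma discrete_torsion_at:
  fixes c :: "int \<Rightarrow> real^3"
  assumes nondegenerate: "nondegenerate \<epsilon>"
    and c: "c 0 - c 1 = - (2 * \<epsilon>) *\<^sub>R Q \<epsilon>"
      "c (- 1) - c 1 = - (4 * \<epsilon>) *\<^sub>R (Q \<epsilon> - (\<epsilon> / 2) *\<^sub>R X \<epsilon>)"
      "c 2 - c 1 = (2 * \<epsilon>) *\<^sub>R (Q \<epsilon> + \<epsilon> *\<^sub>R (X \<epsilon> + \<epsilon> *\<^sub>R Z \<epsilon>))"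
  shows "discrete_torsion_defined c 0"
    and "circle_center (curvature_circle c 0) - the (p_bc c 0) = w \<epsilon>"
    and "qIm (cross_ratio (c (- 1)) (c 0) (c 1) (c 2)) = \<epsilon>\<^sup>2 *\<^sub>R G \<epsilon>"
    and "discrete_torsion c 0 = F \<epsilon>"
proof -
  have \<epsilon>: "\<epsilon> \<noteq> 0" and nz: "q \<epsilon> \<noteq> 0" "N \<epsilon> \<noteq> 0" "R \<epsilon> \<noteq> 0"
    and slit: "slit_quat (inverse (\<alpha> \<epsilon>) * \<delta> \<epsilon>)" "slit_quat (inverse (\<delta> \<epsilon>) * (\<delta> \<epsilon> - \<alpha> \<epsilon>))"
    using nondegenerate by (simp_all add: nondegenerate_def)
  have nz': "\<alpha> \<epsilon> \<noteq> 0" "\<delta> \<epsilon> \<noteq> 0" "\<delta> \<epsilon> - \<alpha> \<epsilon> \<noteq> 0"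
    using slit by (auto simp: slit_quat_def)
  have "im_quat (c 0) - im_quat (c 1) = - (2 * \<epsilon>) *\<^sub>R q \<epsilon>"
    "im_quat (c (- 1)) - im_quat (c 1) = - (4 * \<epsilon>) *\<^sub>R N \<epsilon>"
    "im_quat (c 2) - im_quat (c 1) = (2 * \<epsilon>) *\<^sub>R R \<epsilon>"
    unfolding im_quat_diff[symmetric] c
    by (simp_all only: im_quat_scaleR im_quat_diff im_quat_add q_def N_def R_def y_def x_def z_def)
       simp_all
  then have inv: "inv_at (c 1) (c 0) = (1 / \<epsilon>) *\<^sub>R B \<epsilon>" "inv_at (c 1) (c (- 1)) = (1 / \<epsilon>) *\<^sub>R A \<epsilon>"
    "inv_at (c 1) (c 2) = (1 / \<epsilon>) *\<^sub>R D \<epsilon>"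
    using \<epsilon> nz by (simp_all add: A_def B_def D_def nonzero_inverse_scaleR_distrib inverse_eq_divide[of \<epsilon>])
  have ABD: "A \<epsilon> \<noteq> 0" "B \<epsilon> \<noteq> 0" "D \<epsilon> \<noteq> 0"
    using nz by (simp_all add: A_def B_def D_def)
  have "c 0 \<noteq> c 1" "c (- 1) \<noteq> c 1" "c 2 \<noteq> c 1"
    using inv ABD \<epsilon> by auto
  moreover have "inv_at (c 1) (c (- 1)) \<noteq> inv_at (c 1) (c 0)" "inv_at (c 1) (c 2) \<noteq> inv_at (c 1) (c 0)"
    "inv_at (c 1) (c (- 1)) \<noteq> inv_at (c 1) (c 2)"
    unfolding inv using nz' \<epsilon> by (simp_all add: \<alpha>_def \<delta>_def)
  ultimately have dist: "distinct [c (- 1), c 0, c 1, c 2]"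
    by auto
  have BL: "B \<epsilon> + g \<epsilon> = \<epsilon> *\<^sub>R L \<epsilon>"
    by (rule B_plus_g[OF nz slit(1)])
  have main: "discrete_torsion_defined c 0"
    "circle_center (curvature_circle c 0) - the (p_bc c 0) = w \<epsilon>"
    "discrete_torsion c 0 = - (9 * (qIm (cross_ratio (c (- 1)) (c 0) (c 1) (c 2)) \<bullet> w \<epsilon>)
      / (2 * (norm (c 0 - c 1))\<^sup>2))"
    using inverted_edge_scaled[OF \<epsilon>, of c 0 "A \<epsilon>" "B \<epsilon>" "D \<epsilon>" "L \<epsilon>",
        folded \<alpha>_def \<delta>_def, folded g_def h_def, folded inv_far_def inv_line_def, folded w_def] inv dist slit BL nondegenerate
    by (simp_all add: nondegenerate_def del: distinct.simps)
  show "discrete_torsion_defined c 0" "circle_center (curvature_circle c 0) - the (p_bc c 0) = w \<epsilon>"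
    by (rule main)+
  show C: "qIm (cross_ratio (c (- 1)) (c 0) (c 1) (c 2)) = \<epsilon>\<^sup>2 *\<^sub>R G \<epsilon>"
  proof -
    have "cross_ratio (c (- 1)) (c 0) (c 1) (c 2) =
        inverse (A \<epsilon>) * inverse (1 - \<delta> \<epsilon> * inverse (\<alpha> \<epsilon>)) * A \<epsilon>"
      unfolding cross_ratio_inversion_third[OF dist] inv using \<epsilon> nz' ABD
      by (simp add: nonzero_inverse_scaleR_distrib \<alpha>_def \<delta>_def flip: scaleR_diff_right)
    also have V: "1 - \<delta> \<epsilon> * inverse (\<alpha> \<epsilon>) = V \<epsilon>"
    proof -
      have "V \<epsilon> = - 3 + (4 *\<^sub>R \<alpha> \<epsilon> - \<delta> \<epsilon>) * inverse (\<alpha> \<epsilon>)"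
        by (simp add: V_def four_alpha_minus_delta[OF nz])
      also have "\<dots> = - 3 + (4 *\<^sub>R 1 - \<delta> \<epsilon> * inverse (\<alpha> \<epsilon>))"
        using nz' by (simp add: left_diff_distrib)
      finally show ?thesis
        by (simp add: quat_eq_iff)
    qed
    also have "inverse (V \<epsilon>) = (- 1 / 3) *\<^sub>R 1 + (1 / 3) *\<^sub>R (\<epsilon>\<^sup>2 *\<^sub>R (H \<epsilon> * inverse (\<alpha> \<epsilon>)) * inverse (V \<epsilon>))"
    proof -
      have "V \<epsilon> \<noteq> 0"
      proof
        assume "V \<epsilon> = 0"
        then have "\<delta> \<epsilon> * inverse (\<alpha> \<epsilon>) = 1"
          using V by simp
        then have "\<delta> \<epsilon> = \<alpha> \<epsilon>"
          using nz'(1) by (metis left_inverse mult.assoc mult_1_left mult_1_right)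
        with nz' show False by simp
      qed
      then have "(V \<epsilon> + 3) * inverse (V \<epsilon>) = 1 + 3 * inverse (V \<epsilon>)"
        by (simp add: distrib_right)
      moreover have "V \<epsilon> + 3 = \<epsilon>\<^sup>2 *\<^sub>R (H \<epsilon> * inverse (\<alpha> \<epsilon>))"
        by (simp add: V_def)
      ultimately have "\<epsilon>\<^sup>2 *\<^sub>R (H \<epsilon> * inverse (\<alpha> \<epsilon>)) * inverse (V \<epsilon>) = 1 + 3 * inverse (V \<epsilon>)"
        by simp
      then show ?thesis
        by (simp only:) (simp add: quat_eq_iff quat_mult_sel add_divide_distrib)
    qed
    finally have "cross_ratio (c (- 1)) (c 0) (c 1) (c 2) = (- 1 / 3) *\<^sub>R 1 + \<epsilon>\<^sup>2 *\<^sub>R ((1 / 3) *\<^sub>R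
        (inverse (A \<epsilon>) * H \<epsilon> * inverse (\<alpha> \<epsilon>) * inverse (V \<epsilon>) * A \<epsilon>))"
      using ABD by (simp add: left_diff_distrib right_diff_distrib mult.assoc)
    then show ?thesis
      by (simp add: G_def)
  qed
  have "(norm (c 0 - c 1))\<^sup>2 = \<epsilon>\<^sup>2 * (4 * (Q \<epsilon> \<bullet> Q \<epsilon>))"
    unfolding power2_norm_eq_inner c by (simp add: power2_eq_square)
  then show "discrete_torsion c 0 = F \<epsilon>"
    unfolding main(3) C F_def using \<epsilon> by simp
qed

text \<open>
  The sample difference \<open>d - a\<close> divided by \<open>2 \<epsilon>\<close>.
\<close>
definition S where "S \<epsilon> = 3 *\<^sub>R Q \<epsilon> + \<epsilon>\<^sup>2 *\<^sub>R Z \<epsilon>"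

lemma S_limit: "expandable 2 S" "(S \<longlongrightarrow> 3 *\<^sub>R s1) (at 0)"
proof -
  show "expandable 2 S"
    unfolding S_def
    by (intro expandable_add expandable_scaleR expandable_const expandable_power expandable_ident exp)
  have "(S \<longlongrightarrow> 3 *\<^sub>R s1 + 0\<^sup>2 *\<^sub>R (4 *\<^sub>R s3)) (at 0)"
    unfolding S_def by (intro tendsto_intros lim)
  then show "(S \<longlongrightarrow> 3 *\<^sub>R s1) (at 0)" by simp
qed

text \<open>
  Under \<open>\<epsilon> \<mapsto> - \<epsilon>\<close> the vectors \<open>Q\<close> and \<open>w\<close> stay fixed, and \<open>G\<close> is reflected in the plane
  orthogonal to \<open>S\<close>. So the torsion changes by a multiple of \<open>(S \<bullet> G) (S \<bullet> w)\<close>. Both factors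
  tend to zero, because the limits of \<open>G\<close> and \<open>w\<close> are orthogonal to the tangent; having
  expansions, they are \<open>O(\<epsilon>)\<close>.
\<close>
theorem discrete_torsion_asymptotics:
  fixes \<gamma> :: "real \<Rightarrow> int \<Rightarrow> real^3"
  assumes \<gamma>: "\<And>\<epsilon>. \<epsilon> \<noteq> 0 \<Longrightarrow> \<gamma> \<epsilon> 0 - \<gamma> \<epsilon> 1 = - (2 * \<epsilon>) *\<^sub>R Q \<epsilon>"
      "\<And>\<epsilon>. \<epsilon> \<noteq> 0 \<Longrightarrow> \<gamma> \<epsilon> (- 1) - \<gamma> \<epsilon> 1 = - (4 * \<epsilon>) *\<^sub>R (Q \<epsilon> - (\<epsilon> / 2) *\<^sub>R X \<epsilon>)"
      "\<And>\<epsilon>. \<epsilon> \<noteq> 0 \<Longrightarrow> \<gamma> \<epsilon> 2 - \<gamma> \<epsilon> 1 = (2 * \<epsilon>) *\<^sub>R (Q \<epsilon> + \<epsilon> *\<^sub>R (X \<epsilon> + \<epsilon> *\<^sub>R Z \<epsilon>))"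
    and reverse: "\<And>\<epsilon> k. \<gamma> (- \<epsilon>) k = \<gamma> \<epsilon> (1 - k)"
  shows "\<forall>\<^sub>F \<epsilon> in at 0. discrete_torsion_defined (\<gamma> \<epsilon>) 0"
    and "(\<lambda>\<epsilon>. discrete_torsion (\<gamma> \<epsilon>) 0 - - (((s1 \<times> s2) \<bullet> s3) / (norm (s1 \<times> s2))\<^sup>2)) \<in> O[at 0](\<lambda>\<epsilon>. \<epsilon>\<^sup>2)"
proof -
  let ?T = "\<lambda>\<epsilon>. discrete_torsion (\<gamma> \<epsilon>) 0"
  note at = discrete_torsion_at[OF _ \<gamma>]
  show "\<forall>\<^sub>F \<epsilon> in at 0. discrete_torsion_defined (\<gamma> \<epsilon>) 0"
    using eventually_nondegenerate by eventually_elim (rule at(1); simp add: nondegenerate_def)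
  have T: "\<forall>\<^sub>F \<epsilon> in at 0. F \<epsilon> = ?T \<epsilon>"
    using eventually_nondegenerate by eventually_elim (rule at(4)[symmetric]; simp add: nondegenerate_def)
  have exp_T: "expandable 2 ?T"
    using expandable_cong[OF exp_F T] .
  have lim_T: "(?T \<longlongrightarrow> - (((s1 \<times> s2) \<bullet> s3) / (norm (s1 \<times> s2))\<^sup>2)) (at 0)"
    using Lim_transform_eventually[OF lim_F T] .
  have "((\<lambda>\<epsilon>. S \<epsilon> \<bullet> G \<epsilon>) \<longlongrightarrow> (3 *\<^sub>R s1) \<bullet> G0) (at 0)"
    by (intro tendsto_intros S_limit lim_G[folded G0_def])
  then have SG: "((\<lambda>\<epsilon>. S \<epsilon> \<bullet> G \<epsilon>) \<longlongrightarrow> 0) (at 0)"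
    by (simp add: G0_inner)
  have "expandable (Suc 1) (\<lambda>\<epsilon>. S \<epsilon> \<bullet> G \<epsilon>)"
    unfolding Suc_1 by (intro expandable_inner S_limit exp_G)
  then obtain m where m: "expandable 1 m" "\<forall>\<^sub>F \<epsilon> in at 0. S \<epsilon> \<bullet> G \<epsilon> = 0 + \<epsilon> *\<^sub>R m \<epsilon>"
    using SG by (rule expandable_Suc_limitE)
  have "((\<lambda>\<epsilon>. S \<epsilon> \<bullet> w \<epsilon>) \<longlongrightarrow> (3 *\<^sub>R s1) \<bullet> w0) (at 0)"
    by (intro tendsto_intros S_limit w_limit)
  then have Sw: "((\<lambda>\<epsilon>. S \<epsilon> \<bullet> w \<epsilon>) \<longlongrightarrow> 0) (at 0)"
    using j_nonzero by (simp add: inner_diff_right)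
  have "expandable (Suc 1) (\<lambda>\<epsilon>. S \<epsilon> \<bullet> w \<epsilon>)"
    unfolding Suc_1 by (intro expandable_inner S_limit w_limit)
  then obtain l where l: "expandable 1 l" "\<forall>\<^sub>F \<epsilon> in at 0. S \<epsilon> \<bullet> w \<epsilon> = 0 + \<epsilon> *\<^sub>R l \<epsilon>"
    using Sw by (rule expandable_Suc_limitE)
  define b where "b \<epsilon> = (9 / 4) * (m \<epsilon> * l \<epsilon> * inverse ((S \<epsilon> \<bullet> S \<epsilon>) * (Q \<epsilon> \<bullet> Q \<epsilon>)))" for \<epsilon>
  have SQ: "((\<lambda>\<epsilon>. (S \<epsilon> \<bullet> S \<epsilon>) * (Q \<epsilon> \<bullet> Q \<epsilon>)) \<longlongrightarrow> ((3 *\<^sub>R s1) \<bullet> (3 *\<^sub>R s1)) * (s1 \<bullet> s1)) (at 0)"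
    by (intro tendsto_intros S_limit lim)
  have "((3 *\<^sub>R s1) \<bullet> (3 *\<^sub>R s1)) * (s1 \<bullet> s1) \<noteq> 0"
    using j_nonzero by simp
  then have "expandable 2 (\<lambda>\<epsilon>. inverse ((S \<epsilon> \<bullet> S \<epsilon>) * (Q \<epsilon> \<bullet> Q \<epsilon>)))"
    by (rule expandable_inverse[OF SQ]) (intro expandable_mult expandable_inner S_limit exp)
  then have "expandable 1 (\<lambda>\<epsilon>. inverse ((S \<epsilon> \<bullet> S \<epsilon>) * (Q \<epsilon> \<bullet> Q \<epsilon>)))"
    using expandable_SucD[of 1] unfolding Suc_1 by blast
  then have b: "expandable 1 b"
    unfolding b_def by (intro expandable_mult expandable_const m l)
  obtain C where C: "C > 0" "\<forall>\<^sub>F \<epsilon> in at 0. \<bar>b \<epsilon>\<bar> \<le> C"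
    using expandable_bounded[OF b] by (auto simp: Bfun_def)
  have good': "\<forall>\<^sub>F \<epsilon> in at 0. nondegenerate (- \<epsilon>)"
  proof -
    have "\<forall>\<^sub>F \<epsilon> in filtermap uminus (at 0). nondegenerate \<epsilon>"
      using eventually_nondegenerate by (simp add: filtermap_at_minus)
    then show ?thesis
      by (simp add: eventually_filtermap)
  qed
  have "\<forall>\<^sub>F \<epsilon> in at 0. norm (?T (- \<epsilon>) - ?T \<epsilon>) \<le> C * norm (\<epsilon>\<^sup>2)"
    using eventually_nondegenerate good' m(2) l(2) C(2)
      tendsto_imp_eventually_ne[OF S_limit(2), of 0, simplified, OF j_nonzero(1)]
  proof eventually_elim
    case (elim \<epsilon>)
    then have \<epsilon>: "\<epsilon> \<noteq> 0"
      by (simp add: nondegenerate_def)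
    let ?c = "\<gamma> \<epsilon>"
    let ?C = "qIm (cross_ratio (?c (- 1)) (?c 0) (?c 1) (?c 2))"
    let ?C' = "qIm (cross_ratio (?c 2) (?c 1) (?c 0) (?c (- 1)))"
    have def: "discrete_torsion_defined ?c 0" and off: "circle_center (curvature_circle ?c 0) - the (p_bc ?c 0) = w \<epsilon>"
      and C: "?C = \<epsilon>\<^sup>2 *\<^sub>R G \<epsilon>" and T: "?T \<epsilon> = F \<epsilon>"
      by (rule at[OF elim(1)]; fact \<epsilon>)+
    have def': "discrete_torsion_defined (\<gamma> (- \<epsilon>)) 0"
      and off': "circle_center (curvature_circle (\<gamma> (- \<epsilon>)) 0) - the (p_bc (\<gamma> (- \<epsilon>)) 0) = w (- \<epsilon>)"
      and C': "qIm (cross_ratio (\<gamma> (- \<epsilon>) (- 1)) (\<gamma> (- \<epsilon>) 0) (\<gamma> (- \<epsilon>) 1) (\<gamma> (- \<epsilon>) 2)) =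
        (- \<epsilon>)\<^sup>2 *\<^sub>R G (- \<epsilon>)"
      and T': "?T (- \<epsilon>) = F (- \<epsilon>)"
      by (rule at[OF elim(2)]; use \<epsilon> in simp)+
    have w: "w (- \<epsilon>) = w \<epsilon>"
      unfolding off[symmetric] off'[symmetric]
      by (rule curvature_circle_reverse[OF def]) (simp add: reverse)
    have "(2 * \<epsilon>) *\<^sub>R Q (- \<epsilon>) = - (?c 0 - ?c 1)"
      using \<gamma>(1)[of "- \<epsilon>"] \<epsilon> by (simp add: reverse)
    also have "\<dots> = (2 * \<epsilon>) *\<^sub>R Q \<epsilon>"
      unfolding \<gamma>(1)[OF \<epsilon>] by simp
    finally have "(2 * \<epsilon>) *\<^sub>R Q (- \<epsilon>) = (2 * \<epsilon>) *\<^sub>R Q \<epsilon>" .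
    then have Q: "Q (- \<epsilon>) = Q \<epsilon>"
      using \<epsilon> by simp
    have d: "?c 2 - ?c (- 1) = (2 * \<epsilon>) *\<^sub>R S \<epsilon>"
    proof -
      have "?c 2 - ?c (- 1) = (?c 2 - ?c 1) - (?c (- 1) - ?c 1)"
        by simp
      also have "\<dots> = (2 * \<epsilon>) *\<^sub>R S \<epsilon>"
        unfolding \<gamma>(2)[OF \<epsilon>] \<gamma>(3)[OF \<epsilon>] S_def
        by (simp add: vec_eq_iff power2_eq_square algebra_simps)
      finally show ?thesis .
    qed
    have S0: "S \<epsilon> \<bullet> S \<epsilon> \<noteq> 0"
      using elim(6) by simp
    have "\<epsilon>\<^sup>2 *\<^sub>R G (- \<epsilon>) = ?C'"
      using C' by (simp add: reverse)
    also have "\<dots> = \<epsilon>\<^sup>2 *\<^sub>R (G \<epsilon> - (2 * (S \<epsilon> \<bullet> G \<epsilon>) / (S \<epsilon> \<bullet> S \<epsilon>)) *\<^sub>R S \<epsilon>)"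
      unfolding cross_ratio_reverse[of "?c 2"] C d using \<epsilon> S0
      by (simp add: scaleR_diff_right power2_eq_square)
    finally have G: "G (- \<epsilon>) = G \<epsilon> - (2 * (S \<epsilon> \<bullet> G \<epsilon>) / (S \<epsilon> \<bullet> S \<epsilon>)) *\<^sub>R S \<epsilon>"
      using \<epsilon> by simp
    have Q0: "Q \<epsilon> \<bullet> Q \<epsilon> \<noteq> 0"
      using elim(1) by (auto simp: nondegenerate_def q_def)
    have "F (- \<epsilon>) - F \<epsilon> =
        (9 / 4) * ((S \<epsilon> \<bullet> G \<epsilon>) * (S \<epsilon> \<bullet> w \<epsilon>) * inverse ((S \<epsilon> \<bullet> S \<epsilon>) * (Q \<epsilon> \<bullet> Q \<epsilon>)))"
      unfolding F_def w Q G inner_diff_left inner_scaleR_left using S0 Q0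
      by (simp add: field_simps)
    also have "\<dots> = \<epsilon>\<^sup>2 * b \<epsilon>"
      unfolding b_def elim(3,4) by (simp add: power2_eq_square)
    finally have "norm (?T (- \<epsilon>) - ?T \<epsilon>) = \<bar>b \<epsilon>\<bar> * norm (\<epsilon>\<^sup>2)"
      by (simp add: T T' abs_mult)
    then show ?case
      using mult_right_mono[OF elim(5), of "norm (\<epsilon>\<^sup>2)"] by simp
  qed
  then have "(\<lambda>\<epsilon>. ?T (- \<epsilon>) - ?T \<epsilon>) \<in> O[at 0](\<lambda>\<epsilon>. \<epsilon>\<^sup>2)"
    by (rule landau_o.bigI[OF C(1)])
  then show "(\<lambda>\<epsilon>. ?T \<epsilon> - - (((s1 \<times> s2) \<bullet> s3) / (norm (s1 \<times> s2))\<^sup>2)) \<in> O[at 0](\<lambda>\<epsilon>. \<epsilon>\<^sup>2)"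
    by (rule expandable_even_bigo[OF exp_T lim_T])
qed

end

theorem theorem34:
  shows "\<exists>k. \<forall>(s :: real \<Rightarrow> real^3) (u :: real).
    C_class k s \<longrightarrow> regular_curve s \<longrightarrow> smooth_curvature s u \<noteq> 0 \<longrightarrow>
      (\<forall>\<^sub>F \<epsilon> in at 0. discrete_torsion_defined (sampling s u \<epsilon>) 0) \<and>
      (\<lambda>\<epsilon>. discrete_torsion (sampling s u \<epsilon>) 0 - smooth_torsion s u) \<in> O[at 0](\<lambda>\<epsilon>. \<epsilon>\<^sup>2)"
proof (intro exI[of _ 5] allI impI)
  fix s :: "real \<Rightarrow> real^3" and u :: real
  assume s: "C_class 5 s" and curv: "smooth_curvature s u \<noteq> 0"
  define Q where "Q \<epsilon> = (1 / (2 * \<epsilon>)) *\<^sub>R (s (u + \<epsilon>) - s (u - \<epsilon>))" for \<epsilon>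
  define X where "X \<epsilon> = (1 / (2 * \<epsilon>\<^sup>2)) *\<^sub>R (s (u + \<epsilon>) - 2 *\<^sub>R s (u - \<epsilon>) + s (u - 3 * \<epsilon>))" for \<epsilon>
  define Z where "Z \<epsilon> = (1 / (2 * \<epsilon> ^ 3)) *\<^sub>R
      (s (u + 3 * \<epsilon>) - 3 *\<^sub>R s (u + \<epsilon>) + 3 *\<^sub>R s (u - \<epsilon>) - s (u - 3 * \<epsilon>))" for \<epsilon>
  have "nth_vderiv 1 s u \<times> nth_vderiv 2 s u \<noteq> 0"
    using curv by (auto simp: smooth_curvature_def)
  then interpret edge_expansion Q X Z "nth_vderiv 1 s u" "nth_vderiv 2 s u" "nth_vderiv 3 s u"
    using difference_quotients_expandable[OF s, of u]
    by unfold_locales (simp_all add: Q_def[abs_def] X_def[abs_def] Z_def[abs_def])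
  have samp: "sampling s u \<epsilon> 0 = s (u - \<epsilon>)" "sampling s u \<epsilon> 1 = s (u + \<epsilon>)"
    "sampling s u \<epsilon> (- 1) = s (u - 3 * \<epsilon>)" "sampling s u \<epsilon> 2 = s (u + 3 * \<epsilon>)" for \<epsilon>
    by (simp_all add: sampling_def)
  have "sampling s u \<epsilon> 0 - sampling s u \<epsilon> 1 = - (2 * \<epsilon>) *\<^sub>R Q \<epsilon>"
    "sampling s u \<epsilon> (- 1) - sampling s u \<epsilon> 1 = - (4 * \<epsilon>) *\<^sub>R (Q \<epsilon> - (\<epsilon> / 2) *\<^sub>R X \<epsilon>)"
    "sampling s u \<epsilon> 2 - sampling s u \<epsilon> 1 = (2 * \<epsilon>) *\<^sub>R (Q \<epsilon> + \<epsilon> *\<^sub>R (X \<epsilon> + \<epsilon> *\<^sub>R Z \<epsilon>))"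
    if "\<epsilon> \<noteq> 0" for \<epsilon>
    using that unfolding samp Q_def X_def Z_def
    by (simp_all add: vec_eq_iff field_simps power2_eq_square power3_eq_cube)
  moreover have "sampling s u (- \<epsilon>) k = sampling s u \<epsilon> (1 - k)" for \<epsilon> k
    by (simp add: sampling_def algebra_simps)
  ultimately show "(\<forall>\<^sub>F \<epsilon> in at 0. discrete_torsion_defined (sampling s u \<epsilon>) 0) \<and>
      (\<lambda>\<epsilon>. discrete_torsion (sampling s u \<epsilon>) 0 - smooth_torsion s u) \<in> O[at 0](\<lambda>\<epsilon>. \<epsilon>\<^sup>2)"
    unfolding smooth_torsion_def by (intro conjI discrete_torsion_asymptotics)
qed

end
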